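(* For all $n \geq 0$, $p_{\xi}(96n+76) \equiv 0 \pmod{9}$.
   Context: $(a;q)_n=(1-a)(1-aq)\cdots(1-aq^{n-1})$, $(a;q)_0=1$. The coefficients $p_\xi(n)$ are defined by $\sum_{n\ge0}p_\xi(n)q^n=\xi(q)=1+2\sum_{n\ge1}\frac{q^{6n^2-6n+1}}{(q;q^6)_n(q^5;q^6)_n}$. *)

theory Defs
  imports "HOL-Computational_Algebra.Computational_Algebra" "HOL-Number_Theory.Cong"
begin

unbundle fps_syntax

definition qpochhammer :: "'a::comm_ring_1 \<Rightarrow> 'a \<Rightarrow> nat \<Rightarrow> 'a" where
  "qpochhammer a q n = (\<Prod>k<n. 1 - a * q ^ k)"

definition xi_denom :: "nat \<Rightarrow> int fps" where
  "xi_denom n = qpochhammer fps_X (fps_X ^ 6) n * qpochhammer (fps_X ^ 5) (fps_X ^ 6) n"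

(* Since int has no inverse operation, neither does int fps; fps_right_inverse f 1 is the
   reciprocal of a series f with constant term 1 (see xi_term_times_denom below). The
   subtraction in the exponent does not truncate, as 6 n \<le> 6 n^2. *)
definition xi_term :: "nat \<Rightarrow> int fps" where
  "xi_term n = fps_X ^ (6 * n ^ 2 - 6 * n + 1) * fps_right_inverse (xi_denom n) 1"

(* suminf in the X-adic topology on formal power series; the sum starts at n = 1. *)
definition xi :: "int fps" where
  "xi = 1 + 2 * (\<Sum>n. xi_term (Suc n))"

definition p_xi :: "nat \<Rightarrow> int" where
  "p_xi n = xi $ n"

lemma xi_denom_nth_0: "xi_denom n $ 0 = 1"
proof -
  have "qpochhammer (fps_X ^ a) (fps_X ^ 6) n $ 0 = (1::int)" if "a > 0" for a
    using that unfolding qpochhammer_def by (induction n) (auto simp: fps_nth_power_0)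
  from this[of 1] this[of 5] show ?thesis
    by (simp add: xi_denom_def)
qed

lemma xi_term_times_denom: "xi_term n * xi_denom n = fps_X ^ (6 * n ^ 2 - 6 * n + 1)"
proof -
  have "xi_denom n * fps_right_inverse (xi_denom n) 1 = 1"
    by (rule fps_right_inverse) (simp add: xi_denom_nth_0)
  then show ?thesis
    by (simp add: xi_term_def ac_simps)
qed

lemma xi_term_nth_eq_0:
  assumes "m < n"
  shows "xi_term (Suc n) $ m = 0"
proof -
  have "6 * Suc n ^ 2 - 6 * Suc n + 1 = 6 * (n * n) + 6 * n + 1"
    by (simp add: power2_eq_square algebra_simps)
  then show ?thesis
    using assms by (simp only: xi_term_def fps_X_power_mult_nth) simp
qed

lemma xi_terms_sums: "(\<lambda>n. xi_term (Suc n)) sums Abs_fps (\<lambda>m. \<Sum>n\<le>m. xi_term (Suc n) $ m)"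
  unfolding sums_def
proof (rule tendsto_fpsI)
  fix m
  show "eventually (\<lambda>N. (\<Sum>n<N. xi_term (Suc n)) $ m =
          Abs_fps (\<lambda>m. \<Sum>n\<le>m. xi_term (Suc n) $ m) $ m) sequentially"
    using eventually_gt_at_top[of m]
  proof eventually_elim
    case (elim N)
    have "(\<Sum>n<N. xi_term (Suc n) $ m) = (\<Sum>n\<le>m. xi_term (Suc n) $ m)"
      using elim by (intro sum.mono_neutral_right) (auto simp: xi_term_nth_eq_0)
    then show ?case
      by (simp add: fps_sum_nth)
  qed
qed

lemma p_xi_eq: "p_xi m = (if m = 0 then 1 else 0) + 2 * (\<Sum>n\<le>m. xi_term (Suc n) $ m)"
  by (simp add: p_xi_def xi_def sums_unique[OF xi_terms_sums, symmetric] fps_numeral_fps_const)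

end

theory Submission
  imports Defs
begin

text \<open>
  Write \<open>f\<^sub>k\<close> for the infinite product of \<open>1 - q\<^sup>k\<^sup>n\<close>. A finite partial fraction expansion in
  \<open>x\<close> of \<open>1 / ((x; Q)\<^sub>n\<^sub>+\<^sub>1 (Q/x; Q)\<^sub>n\<^sub>+\<^sub>1)\<close>, summed against \<open>Q\<^sup>n\<^sup>(\<^sup>n\<^sup>+\<^sup>1\<^sup>)\<close>, turns \<open>\<xi>\<close> into an Appell--Lerch sum of
  level three. Picking out the exponents \<open>1\<close> modulo \<open>3\<close> lowers the level to one, where the same
  expansion with \<open>n \<rightarrow> \<infinity>\<close> evaluates the sum as a product: the generating function of
  \<open>p\<^sub>\<xi>(3n + 1)\<close> is \<open>2 f\<^sub>3 f\<^sub>6 / f\<^sub>1\<close>.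

  Since \<open>96n + 76 = 3 (32n + 25) + 1\<close> and \<open>25\<close> is \<open>11001\<close> in binary, it remains to take the odd, even,
  even, odd and odd part in turn. The first two steps are exact and give
  \<open>f\<^sub>2\<^sup>6 f\<^sub>3 f\<^sub>6 / (f\<^sub>1\<^sup>5 f\<^sub>4\<^sup>2) = \<phi>(q) f\<^sub>2 f\<^sub>6 / b\<close> with \<open>b = f\<^sub>1\<^sup>3 / f\<^sub>3 \<equiv> 1\<close> modulo \<open>3\<close>. As \<open>1 / b \<equiv> 2 - b \<equiv> b\<^sup>2\<close> modulo \<open>9\<close>,
  the last three steps only need the splitting \<open>b(q) = b(q\<^sup>4) - 3 q \<beta>(q\<^sup>2)\<close>, and the final odd part is
  three times a series that vanishes modulo \<open>3\<close>.
\<close>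

section \<open>Convergence of formal power series\<close>

text \<open>Level three drops to one for an arithmetical reason. With x = q, y = q^5, Q = q^6 the
  summand of index j is, up to sign and the factor 1/f_6 (a series in q^3), q^(9j(j+1)) times a
  combination of geometric series in q^(6j+1) and q^(6j+5). Extracting every third coefficient
  divides 9j(j+1) by three but fixes the geometric series, whose steps are prime to 3; what remains
  is the sum without the weight Q^(j(j+1)). Integer power series cannot be divided freely, so
  quotients of f_k appear as identities with cleared denominators, cancelled in an integral domain.
  A parity step becomes possible once the quotient is rewritten as a series in q^2 times theta
  series whose splitting is known; this dictates which theta identities are proved. Two
  representatives of 1/b modulo 9 serve different steps: 2 - b is linear, so its splitting is read
  off from that of b, while in b^2 one copy of b is absorbed into a series in q^2.\<close>

instance fps :: (comm_ring_1) topological_ab_group_add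
proof
  fix a b :: "'a fps"
  show "((\<lambda>x. fst x + snd x) \<longlongrightarrow> a + b) (nhds a \<times>\<^sub>F nhds b)"
  proof (rule tendsto_fpsI)
    fix n
    have "\<forall>\<^sub>F x in nhds a. x $ n = a $ n" "\<forall>\<^sub>F x in nhds b. x $ n = b $ n"
      using filterlim_ident[of "nhds a"] filterlim_ident[of "nhds b"]
      unfolding tendsto_fps_iff by blast+
    then show "\<forall>\<^sub>F x in nhds a \<times>\<^sub>F nhds b. (fst x + snd x) $ n = (a + b) $ n"
      by (rule eventually_mono[OF eventually_prodI]) simp
  qed
next
  fix a :: "'a fps"
  show "(uminus \<longlongrightarrow> - a) (nhds a)"
    using filterlim_ident[of "nhds a"] unfolding tendsto_fps_iff by simp
qed

lemma eventually_fps_nth_le: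
  fixes F :: "'i \<Rightarrow> 'a::comm_ring_1 fps"
  assumes "(F \<longlongrightarrow> f) A"
  shows "\<forall>\<^sub>F i in A. \<forall>k\<in>{..n}. F i $ k = f $ k"
  using assms by (subst eventually_ball_finite_distrib) (auto simp: tendsto_fps_iff)

instance fps :: (comm_ring_1) topological_comm_monoid_mult
proof
  fix a b :: "'a fps"
  show "((\<lambda>x. fst x * snd x) \<longlongrightarrow> a * b) (nhds a \<times>\<^sub>F nhds b)"
  proof (rule tendsto_fpsI)
    fix n
    have "\<forall>\<^sub>F x in nhds a. \<forall>k\<in>{..n}. x $ k = a $ k" "\<forall>\<^sub>F x in nhds b. \<forall>k\<in>{..n}. x $ k = b $ k"
      by (rule eventually_fps_nth_le[OF filterlim_ident])+
    from eventually_prodI[OF this] show "\<forall>\<^sub>F x in nhds a \<times>\<^sub>F nhds b. (fst x * snd x) $ n = (a * b) $ n"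
    proof (rule eventually_mono)
      fix x :: "'a fps \<times> 'a fps"
      assume "(\<forall>k\<in>{..n}. fst x $ k = a $ k) \<and> (\<forall>k\<in>{..n}. snd x $ k = b $ k)"
      then show "(fst x * snd x) $ n = (a * b) $ n"
        by (simp add: fps_mult_nth)
    qed
  qed
qed

lemma tendsto_fps_compose_X_power [tendsto_intros]:
  fixes F :: "'i \<Rightarrow> 'a::comm_ring_1 fps"
  assumes "(F \<longlongrightarrow> f) A"
  shows "((\<lambda>i. F i oo fps_X ^ k) \<longlongrightarrow> (f oo fps_X ^ k)) A"
  using assms by (auto simp: tendsto_fps_iff fps_nth_compose_X_power)

text \<open>Dominated convergence for the X-adic topology: up to degree \<open>N\<close> only the
  finitely many indices in \<open>S N\<close> contribute, whatever the factors \<open>K M j\<close>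
  are. The index type is left open because the sums run over the naturals here and over the integers
  for the triple product.\<close>

lemma tendsto_fps_tannery:
  fixes c :: "'i \<Rightarrow> 'a::comm_ring_1 fps" and K :: "nat \<Rightarrow> 'i \<Rightarrow> 'a fps"
  assumes S: "\<And>N. finite (S N)" "\<And>N j k. k \<le> N \<Longrightarrow> j \<notin> S N \<Longrightarrow> c j $ k = 0"
    and K: "\<And>j. (\<lambda>M. K M j) \<longlonglongrightarrow> L j"
    and A: "\<And>M. finite (A M)" "\<And>j. \<forall>\<^sub>F M in sequentially. j \<in> A M"
  shows "(\<lambda>M. \<Sum>j\<in>A M. c j * K M j) \<longlonglongrightarrow> Abs_fps (\<lambda>N. \<Sum>j\<in>S N. (c j * L j) $ N)"
proof (rule tendsto_fpsI)
  fix N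
  have 1: "\<forall>\<^sub>F M in sequentially. \<forall>j\<in>S N. j \<in> A M"
    using S(1) A(2) by (simp add: eventually_ball_finite_distrib)
  have 2: "\<forall>\<^sub>F M in sequentially. \<forall>j\<in>S N. (c j * K M j) $ N = (c j * L j) $ N"
    using S(1) tendsto_mult[OF tendsto_const K]
    by (subst eventually_ball_finite_distrib) (auto simp: tendsto_fps_iff)
  have 0: "(c j * K M j) $ N = 0" if "j \<notin> S N" for j M
    using S(2)[OF _ that] by (simp add: fps_mult_nth)
  show "\<forall>\<^sub>F M in sequentially. (\<Sum>j\<in>A M. c j * K M j) $ N =
      Abs_fps (\<lambda>N. \<Sum>j\<in>S N. (c j * L j) $ N) $ N"
    using 1 2
  proof eventually_elim
    case (elim M)
    have "(\<Sum>j\<in>A M. (c j * K M j) $ N) = (\<Sum>j\<in>S N. (c j * K M j) $ N)"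
      using elim A(1) 0 by (intro sum.mono_neutral_right) auto
    then show ?case using elim by (simp add: fps_sum_nth)
  qed
qed

lemma fps_power_nth_eq_0:
  fixes Q :: "'a::comm_ring_1 fps"
  assumes "Q $ 0 = 0" "k < n"
  shows "(Q ^ n) $ k = 0"
  using assms by (simp add: startsby_zero_power_prefix)

lemma fps_power_mult_nth_eq_0:
  fixes Q :: "'a::comm_ring_1 fps"
  assumes "Q $ 0 = 0" "k < n"
  shows "(Q ^ n * F) $ k = 0"
  using assms by (simp add: fps_mult_nth fps_power_nth_eq_0)

section \<open>Reciprocals of series with constant term 1\<close>

definition fps_recip :: "'a::comm_ring_1 fps \<Rightarrow> 'a fps" where
  "fps_recip f = fps_right_inverse f 1"

lemma fps_recip: "f $ 0 = 1 \<Longrightarrow> f * fps_recip f = 1"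
  by (simp add: fps_recip_def fps_right_inverse)

lemma fps_recip_unique: "f * g = (1::'a::idom fps) \<Longrightarrow> f $ 0 = 1 \<Longrightarrow> g = fps_recip f"
  by (metis fps_recip mult_cancel_left mult_zero_left zero_neq_one)

lemma tendsto_fps_recip:
  fixes F :: "'i \<Rightarrow> 'a::idom fps"
  assumes "(F \<longlongrightarrow> f) A" "\<And>i. F i $ 0 = 1" "f $ 0 = 1"
  shows "((\<lambda>i. fps_recip (F i)) \<longlongrightarrow> fps_recip f) A"
proof (rule tendsto_fpsI)
  fix n
  \<comment> \<open>The difference of the reciprocals is a multiple of \<open>f - F i\<close>, so
    agreement up to degree \<open>n\<close> is inherited.\<close>
  have *: "fps_recip (F i) - fps_recip f = fps_recip (F i) * fps_recip f * (f - F i)" for i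
  proof -
    have "fps_recip (F i) * fps_recip f * (f - F i) =
        fps_recip (F i) * (f * fps_recip f) - fps_recip f * (F i * fps_recip (F i))"
      by (simp add: algebra_simps)
    then show ?thesis using assms by (simp add: fps_recip)
  qed
  show "\<forall>\<^sub>F i in A. fps_recip (F i) $ n = fps_recip f $ n"
    using eventually_fps_nth_le[OF assms(1), of n]
  proof eventually_elim
    case (elim i)
    have "(fps_recip (F i) - fps_recip f) $ n = 0"
      unfolding * using elim by (subst fps_mult_nth) (auto intro!: sum.neutral)
    then show ?case by simp
  qed
qed

section \<open>Finite and infinite q-Pochhammer products\<close>

lemma qpochhammer_Suc: "qpochhammer a q (Suc n) = qpochhammer a q n * (1 - a * q ^ n)"
  by (simp add: qpochhammer_def)

lemma qpochhammer_0 [simp]: "qpochhammer a q 0 = 1"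
  by (simp add: qpochhammer_def)

lemma qpochhammer_nth_0: "a $ 0 = 0 \<Longrightarrow> qpochhammer a q n $ 0 = 1"
  by (induction n) (auto simp: qpochhammer_Suc)

text \<open>The infinite product (a; q)_infinity. If \<open>q\<close> has constant term zero, the
  factors after the first \<open>N + 1\<close> only affect degrees above \<open>N\<close>, so
  coefficient \<open>N\<close> can be read off a finite product.\<close>

definition qpoch_inf :: "'a::comm_ring_1 fps \<Rightarrow> 'a fps \<Rightarrow> 'a fps" where
  "qpoch_inf a q = Abs_fps (\<lambda>N. qpochhammer a q (Suc N) $ N)"

lemma qpochhammer_tendsto:
  fixes a q :: "'a::comm_ring_1 fps"
  assumes "q $ 0 = 0"
  shows "qpochhammer a q \<longlonglongrightarrow> qpoch_inf a q"
proof (rule tendsto_fpsI)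
  fix N
  have *: "qpochhammer a q (Suc N + d) $ N = qpochhammer a q (Suc N) $ N" for d
  proof (induction d)
    case (Suc d)
    have "qpochhammer a q (Suc (Suc N + d)) =
        qpochhammer a q (Suc N + d) - q ^ (Suc N + d) * (qpochhammer a q (Suc N + d) * a)"
      unfolding qpochhammer_Suc by (simp add: right_diff_distrib mult_ac)
    moreover have "(q ^ (Suc N + d) * (qpochhammer a q (Suc N + d) * a)) $ N = 0"
      by (rule fps_power_mult_nth_eq_0[OF assms]) simp
    ultimately show ?case using Suc by simp
  qed simp
  show "\<forall>\<^sub>F n in sequentially. qpochhammer a q n $ N = qpoch_inf a q $ N"
    unfolding eventually_sequentially
  proof (intro exI allI impI)
    fix n assume "Suc N \<le> n"
    then show "qpochhammer a q n $ N = qpoch_inf a q $ N"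
      using *[of "n - Suc N"] by (simp add: qpoch_inf_def)
  qed
qed

text \<open>Evaluates the product along a subsequence of partial products; splitting into residue
  classes modulo \<open>k\<close> needs \<open>g n = n * k\<close>.\<close>

lemma qpoch_inf_eqI:
  fixes a q :: "'a::comm_ring_1 fps"
  assumes "q $ 0 = 0" "\<And>n. qpochhammer a q (g n) = F n" "F \<longlonglongrightarrow> L" "strict_mono g"
  shows "qpoch_inf a q = L"
proof -
  have "(\<lambda>n. qpochhammer a q (g n)) \<longlonglongrightarrow> qpoch_inf a q"
    using LIMSEQ_subseq_LIMSEQ[OF qpochhammer_tendsto[OF assms(1)] assms(4)] by (simp add: o_def)
  then show ?thesis using assms(2,3) LIMSEQ_unique by auto
qed

lemma qpoch_inf_nth_0: "a $ 0 = 0 \<Longrightarrow> qpoch_inf a q $ 0 = 1"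
  by (simp add: qpoch_inf_def qpochhammer_nth_0)

lemma qpoch_inf_minus:
  fixes a q :: "'a::comm_ring_1 fps"
  assumes "q $ 0 = 0"
  shows "qpoch_inf a q * qpoch_inf (- a) q = qpoch_inf (a ^ 2) (q ^ 2)"
proof -
  have *: "qpochhammer (a ^ 2) (q ^ 2) n = qpochhammer a q n * qpochhammer (- a) q n" for n
  proof (induction n)
    case (Suc n)
    have "1 - a ^ 2 * (q ^ 2) ^ n = (1 - a * q ^ n) * (1 + a * q ^ n)"
      by (simp add: algebra_simps power2_eq_square power_mult_distrib)
    then show ?case using Suc by (simp add: qpochhammer_Suc mult.assoc mult.left_commute)
  qed simp
  have "(\<lambda>n. qpochhammer a q n * qpochhammer (- a) q n) \<longlonglongrightarrow> qpoch_inf a q * qpoch_inf (- a) q"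
    by (intro tendsto_intros qpochhammer_tendsto assms)
  from qpoch_inf_eqI[OF _ * this] assms show ?thesis
    by (simp add: strict_mono_def fps_nth_power_0)
qed

lemma qpoch_inf_split:
  fixes a q :: "'a::comm_ring_1 fps"
  assumes "q $ 0 = 0" "k > 0"
  shows "qpoch_inf a q = (\<Prod>i<k. qpoch_inf (a * q ^ i) (q ^ k))"
proof (rule qpoch_inf_eqI[OF assms(1)])
  show "qpochhammer a q (n * k) = (\<Prod>i<k. qpochhammer (a * q ^ i) (q ^ k) n)" for n
  proof (induction n)
    case (Suc n)
    have *: "qpochhammer a q (m + l) = qpochhammer a q m * (\<Prod>i<l. 1 - a * q ^ (m + i))" for m l
      by (induction l) (simp_all add: qpochhammer_Suc)
    have "qpochhammer a q (Suc n * k) = qpochhammer a q (n * k) * (\<Prod>i<k. 1 - a * q ^ (n * k + i))"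
      using *[of "n * k" k] by (simp add: add.commute)
    also have "\<dots> = (\<Prod>i<k. qpochhammer (a * q ^ i) (q ^ k) n * (1 - a * q ^ (n * k + i)))"
      by (simp add: Suc prod.distrib)
    also have "\<dots> = (\<Prod>i<k. qpochhammer (a * q ^ i) (q ^ k) (Suc n))"
      by (intro prod.cong) (simp_all add: qpochhammer_Suc power_add power_mult mult_ac flip: power_mult)
    finally show ?case .
  qed simp
  have "(q ^ k) $ 0 = 0" using assms by (simp add: fps_nth_power_0 zero_power)
  then show "(\<lambda>n. \<Prod>i<k. qpochhammer (a * q ^ i) (q ^ k) n) \<longlonglongrightarrow>
      (\<Prod>i<k. qpoch_inf (a * q ^ i) (q ^ k))"
    by (intro tendsto_prod' qpochhammer_tendsto)
  show "strict_mono (\<lambda>n. n * k)" using assms by (simp add: strict_mono_def)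
qed

lemma qpochhammer_compose:
  fixes a q :: "'a::idom fps"
  assumes "c $ 0 = 0"
  shows "qpochhammer a q n oo c = qpochhammer (a oo c) (q oo c) n"
  using assms by (induction n)
    (simp_all add: qpochhammer_Suc fps_compose_mult_distrib fps_compose_sub_distrib fps_compose_power)

lemma qpoch_inf_compose:
  fixes a q :: "'a::idom fps"
  assumes "q $ 0 = 0" "k > 0"
  shows "qpoch_inf a q oo fps_X ^ k = qpoch_inf (a oo fps_X ^ k) (q oo fps_X ^ k)"
proof (rule sym, rule qpoch_inf_eqI)
  show "(q oo fps_X ^ k) $ 0 = 0" using assms by (simp add: fps_nth_compose_X_power)
  show "qpochhammer (a oo fps_X ^ k) (q oo fps_X ^ k) n = qpochhammer a q n oo fps_X ^ k" for n
    using assms by (subst qpochhammer_compose) (auto simp: fps_nth_power_0)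
  show "(\<lambda>n. qpochhammer a q n oo fps_X ^ k) \<longlonglongrightarrow> (qpoch_inf a q oo fps_X ^ k)"
    by (intro tendsto_intros qpochhammer_tendsto assms)
  show "strict_mono (\<lambda>n::nat. n)" by (simp add: strict_mono_def)
qed

section \<open>The finite triple product and partial fractions\<close>

lemma sums_fps_null:
  fixes F :: "nat \<Rightarrow> 'a::comm_ring_1 fps"
  assumes "\<And>n k. k < n \<Longrightarrow> F n $ k = 0"
  shows "F sums suminf F"
proof -
  have "(\<lambda>M. \<Sum>n<M. F n * 1) \<longlonglongrightarrow> Abs_fps (\<lambda>N. \<Sum>n\<in>{..N}. (F n * 1) $ N)"
  proof (rule tendsto_fps_tannery)
    show "\<forall>\<^sub>F M in sequentially. j \<in> {..<M}" for j :: nat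
      using eventually_gt_at_top[of j] by simp
    show "F j $ k = 0" if "k \<le> N" "j \<notin> {..N}" for N j k
      by (rule assms) (use that in simp)
  qed simp_all
  then have "F sums Abs_fps (\<lambda>N. \<Sum>n\<in>{..N}. (F n * 1) $ N)"
    by (simp add: sums_def)
  from this[unfolded sums_unique[OF this]] show ?thesis by simp
qed

lemma suminf_fps_tannery:
  fixes c :: "nat \<Rightarrow> 'a::comm_ring_1 fps"
  assumes c: "\<And>n k. k < n \<Longrightarrow> c n $ k = 0" and K: "\<And>j. (\<lambda>M. K M j) \<longlonglongrightarrow> L j"
  shows "(\<lambda>M. \<Sum>j<M. c j * K M j) \<longlonglongrightarrow> (\<Sum>j. c j * L j)"
proof -
  \<comment> \<open>Used twice: with the constant kernel \<open>L\<close> it identifies the limit as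
    the infinite series, with the given \<open>K\<close> it yields the claim.\<close>
  have *: "(\<lambda>M. \<Sum>j<M. c j * K M j) \<longlonglongrightarrow> Abs_fps (\<lambda>N. \<Sum>j\<in>{..N}. (c j * L j) $ N)"
    if "\<And>j. (\<lambda>M. K M j) \<longlonglongrightarrow> L j" for K
  proof (rule tendsto_fps_tannery)
    show "\<forall>\<^sub>F M in sequentially. j \<in> {..<M}" for j :: nat
      using eventually_gt_at_top[of j] by simp
    show "c j $ k = 0" if "k \<le> N" "j \<notin> {..N}" for N j k
      by (rule c) (use that in simp)
  qed (simp_all add: that)
  have "(\<lambda>j. c j * L j) sums Abs_fps (\<lambda>N. \<Sum>j\<in>{..N}. (c j * L j) $ N)"
    unfolding sums_def by (rule *[of "\<lambda>_. L"]) (rule tendsto_const)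
  from *[OF K, folded sums_unique[OF this, symmetric]] show ?thesis by simp
qed

text \<open>Setting the reciprocal to \<open>0\<close> at negative arguments makes the recurrence \<open>recip_qfact_pred\<close>
  hold for all integers, so that sums over a range of indices can be shifted freely.\<close>
definition recip_qfact :: "'a::idom fps \<Rightarrow> int \<Rightarrow> 'a fps" where
  "recip_qfact Q z = (if z < 0 then 0 else fps_recip (qpochhammer Q Q (nat z)))"

lemma recip_qfact_0 [simp]: "recip_qfact Q 0 = 1"
  by (simp add: recip_qfact_def) (metis fps_recip fps_one_nth mult_1)

lemma recip_qfact_neg: "z < 0 \<Longrightarrow> recip_qfact Q z = 0"
  by (simp add: recip_qfact_def)

lemma recip_qfact_pred:
  assumes "Q $ 0 = 0"
  shows "recip_qfact Q (z - 1) = recip_qfact Q z * (1 - Q ^ nat z)"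
proof (cases "z > 0")
  case True
  then obtain n where n: "z = int (Suc n)"
    by (metis gr0_conv_Suc zero_less_imp_eq_int)
  have "qpochhammer Q Q n * ((1 - Q ^ Suc n) * fps_recip (qpochhammer Q Q (Suc n))) = 1"
    using fps_recip[OF qpochhammer_nth_0[OF assms], of Q "Suc n"]
    by (simp add: qpochhammer_Suc mult.assoc)
  then have "(1 - Q ^ Suc n) * fps_recip (qpochhammer Q Q (Suc n)) = fps_recip (qpochhammer Q Q n)"
    by (rule fps_recip_unique) (simp add: qpochhammer_nth_0 assms)
  then show ?thesis unfolding n recip_qfact_def
    by (simp add: nat_add_distrib mult.commute)
qed (cases "z = 0"; simp add: recip_qfact_neg)

lemma recip_qfact_tendsto:
  assumes "Q $ 0 = 0"
  shows "(\<lambda>n. recip_qfact Q (int n)) \<longlonglongrightarrow> fps_recip (qpoch_inf Q Q)"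
  using assms unfolding recip_qfact_def
  by (auto intro!: tendsto_fps_recip qpochhammer_tendsto qpochhammer_nth_0 qpoch_inf_nth_0)

section \<open>Theta terms and the finite triple product\<close>

definition triangular :: "int \<Rightarrow> int" where
  "triangular j = j * (j + 1) div 2"

lemma triangular: "2 * triangular j = j * (j + 1)"
  by (simp add: triangular_def)

lemma triangular_nonneg [simp]: "triangular j \<ge> 0"
proof -
  have "j * (j + 1) \<ge> 0"
    by (cases "j \<ge> 0") (auto intro: mult_nonneg_nonneg mult_nonpos_nonpos)
  then show ?thesis using triangular[of j] by linarith
qed

lemma triangular_simps:
  "triangular (j + 1) = triangular j + j + 1"
  "triangular (- (j + 1)) = triangular (- j) + j"
  "triangular (- j - 1) = triangular (- j) + j"
  using triangular[of j] triangular[of "j + 1"] triangular[of "- (j + 1)"] triangular[of "-j"]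
    triangular[of "- j - 1"]
  by (simp_all add: algebra_simps)

text \<open>The summand of Ramanujan's f(x, y), with exponents j(j+1)/2 and j(j-1)/2.\<close>

definition theta_term :: "'a::comm_ring_1 \<Rightarrow> 'a \<Rightarrow> int \<Rightarrow> 'a" where
  "theta_term x y j = x ^ nat (triangular j) * y ^ nat (triangular (- j))"

lemma theta_term_swap: "theta_term x y j = theta_term y x (- j)"
  by (simp add: theta_term_def mult.commute)

text \<open>The ratio of consecutive terms is x (xy)^j; cross-multiplied in this form it involves no
  negative exponents.\<close>

lemma theta_term_shift_right:
  assumes "j \<le> int n"
  shows "x * (x * y) ^ n * theta_term x y j = (x * y) ^ nat (int n - j) * theta_term x y (j + 1)"
proof -
  have 1: "Suc (n + nat (triangular j)) = nat (int n - j) + nat (triangular (j + 1))"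
    using assms triangular_nonneg[of j] triangular_nonneg[of "j+1"] triangular_simps(1)[of j]
    by linarith
  have 2: "n + nat (triangular (- j)) = nat (int n - j) + nat (triangular (- (j + 1)))"
    using assms triangular_nonneg[of "-j"] triangular_nonneg[of "-(j+1)"] triangular_simps(2)[of j]
    by linarith
  have "x * (x * y) ^ n * theta_term x y j =
      x ^ Suc (n + nat (triangular j)) * y ^ (n + nat (triangular (- j)))"
    by (simp add: theta_term_def power_mult_distrib power_add mult_ac)
  also have "\<dots> = (x * y) ^ nat (int n - j) * theta_term x y (j + 1)"
    unfolding 1 2 by (simp add: theta_term_def power_mult_distrib power_add mult_ac)
  finally show ?thesis .
qed

lemma theta_term_shift_left:
  assumes "- j \<le> int n"
  shows "y * (x * y) ^ n * theta_term x y j = (x * y) ^ nat (int n + j) * theta_term x y (j - 1)"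
  using theta_term_shift_right[OF assms, of y x]
  by (simp add: theta_term_swap[of x y] mult.commute[of y x])

definition alt_sign :: "int \<Rightarrow> 'a::comm_ring_1" where
  "alt_sign j = (if even j then 1 else - 1)"

lemma alt_sign_simps [simp]:
  "alt_sign (j + 1) = - alt_sign j" "alt_sign (j - 1) = - alt_sign j"
  "alt_sign (- j) = alt_sign j" "alt_sign 0 = 1" "alt_sign (int k) = (- 1) ^ k"
  by (simp_all add: alt_sign_def)

lemma sum_shift_symmetric_interval:
  fixes g :: "int \<Rightarrow> 'a::comm_ring_1"
  assumes "g (int M) = 0" "g (- int M - 2) = 0"
  shows "(\<Sum>j\<in>{- int M - 1..int M}. g (j - 1)) = (\<Sum>j\<in>{- int M - 1..int M}. g j)"
proof -
  have "(\<Sum>j\<in>{- int M - 1..int M}. g (j - 1)) = (\<Sum>j\<in>{- int M - 2..int M - 1}. g j)"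
    by (rule sum.reindex_bij_witness[of _ "\<lambda>j. j + 1" "\<lambda>j. j - 1"]) auto
  also have "\<dots> = (\<Sum>j\<in>{- int M - 2..int M}. g j)"
  proof (rule sum.mono_neutral_left)
    show "\<forall>j\<in>{- int M - 2..int M} - {- int M - 2..int M - 1}. g j = 0"
    proof
      fix j assume "j \<in> {- int M - 2..int M} - {- int M - 2..int M - 1}"
      then have "j = int M" by auto
      then show "g j = 0" using assms(1) by simp
    qed
  qed auto
  also have "\<dots> = (\<Sum>j\<in>{- int M - 1..int M}. g j)"
  proof (rule sum.mono_neutral_right)
    show "\<forall>j\<in>{- int M - 2..int M} - {- int M - 1..int M}. g j = 0"
    proof
      fix j assume "j \<in> {- int M - 2..int M} - {- int M - 1..int M}"
      then have "j = - int M - 2" by auto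
      then show "g j = 0" using assms(2) by simp
    qed
  qed auto
  finally show ?thesis .
qed

text \<open>Two q-Pascal steps merged into one. The neighbours \<open>j - 1\<close> and
  \<open>j + 1\<close> carry exactly the weights that the shifts of theta terms produce.\<close>

lemma recip_qfact_recurrence:
  fixes Q :: "'a::idom fps" and n :: nat and j :: int
  assumes Q: "Q $ 0 = 0"
  defines "v \<equiv> \<lambda>n j. recip_qfact Q (int n - j) * recip_qfact Q (int n + j)"
  shows "v (Suc n) j * ((1 - Q ^ (2 * n + 1)) * (1 - Q ^ (2 * n + 2))) =
      (1 + Q ^ (2 * n + 1)) * v n j + Q ^ nat (int n + 1 - j) * v n (j - 1) +
      Q ^ nat (int n + 1 + j) * v n (j + 1)"
proof (cases "\<bar>j\<bar> \<le> int n + 1")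
  case True
  define a b where "a = nat (int n + 1 - j)" and "b = nat (int n + 1 + j)"
  define A B where "A = recip_qfact Q (int n + 1 - j)" and "B = recip_qfact Q (int n + 1 + j)"
  have ab: "a + b = 2 * n + 2" using True by (simp add: a_def b_def)
  have 1: "recip_qfact Q (int n - j) = A * (1 - Q ^ a)"
    using recip_qfact_pred[OF Q, of "int n + 1 - j"] by (simp add: A_def a_def)
  have 2: "recip_qfact Q (int n - (j + 1)) = A * (1 - Q ^ a) * (1 - Q ^ (a - 1))"
  proof -
    have "nat (int n - j) = a - 1" unfolding a_def by linarith
    then show ?thesis using recip_qfact_pred[OF Q, of "int n - j"] 1 by (simp add: diff_diff_eq)
  qed
  have 3: "recip_qfact Q (int n + j) = B * (1 - Q ^ b)"
    using recip_qfact_pred[OF Q, of "int n + 1 + j"] by (simp add: B_def b_def)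
  have 4: "recip_qfact Q (int n + (j - 1)) = B * (1 - Q ^ b) * (1 - Q ^ (b - 1))"
  proof -
    have "nat (int n + j) = b - 1" unfolding b_def by linarith
    then show ?thesis using recip_qfact_pred[OF Q, of "int n + j"] 3 by (simp add: add_diff_eq)
  qed
  \<comment> \<open>A polynomial identity once \<open>a + b = 2 * n + 2\<close> is used. The
    truncation of \<open>a - 1\<close> at \<open>a = 0\<close> is harmless, because the factor
    \<open>1 - Q ^ a\<close> vanishes there; likewise for \<open>b\<close>.\<close>
  have 5: "(1 - Q ^ (2 * n + 1)) * (1 - Q ^ (2 * n + 2)) =
      (1 + Q ^ (2 * n + 1)) * ((1 - Q ^ a) * (1 - Q ^ b)) + Q ^ a * ((1 - Q ^ b) * (1 - Q ^ (b - 1))) +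
      Q ^ b * ((1 - Q ^ a) * (1 - Q ^ (a - 1)))"
  proof (cases a; cases b)
    fix a' b' assume a': "a = Suc a'" "b = Suc b'"
    then have e: "Q ^ (2 * n + 2) = Q * (Q * (Q ^ a' * Q ^ b'))" "Q ^ (2 * n + 1) = Q * (Q ^ a' * Q ^ b')"
      using ab by (simp_all flip: power_add power_Suc)
    show ?thesis unfolding e a' by (simp add: algebra_simps)
  qed (use ab in \<open>auto simp: algebra_simps\<close>)
  have "int (Suc n) - j = int n + 1 - j" "int (Suc n) + j = int n + 1 + j" by simp_all
  moreover have "int n - (j - 1) = int n + 1 - j" "int n + (j + 1) = int n + 1 + j" by simp_all
  ultimately show ?thesis
    unfolding v_def 1 2 3 4 5 A_def[symmetric] B_def[symmetric] a_def[symmetric] b_def[symmetric]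
    by (simp only: A_def[symmetric] B_def[symmetric] 1 2 3 4 5) (simp add: algebra_simps)
next
  case False
  then have "j > int n + 1 \<or> j < - int n - 1" by linarith
  then show ?thesis by (auto simp: v_def recip_qfact_neg)
qed

text \<open>The summation window depends on \<open>M\<close> and not on \<open>n\<close>, so it
  stays fixed during the induction on \<open>n\<close>; terms with index beyond \<open>n\<close>
  vanish through \<open>recip_qfact\<close> at negative arguments. The lopsided ends allow the later
  pairing of \<open>j\<close> with \<open>- j - 1\<close>.\<close>

lemma finite_triple_product:
  fixes x y Q :: "'a::idom fps"
  assumes Q: "x * y = Q" "Q $ 0 = 0" and "n \<le> M"
  shows "qpochhammer Q Q (2 * n) * (\<Sum>j\<in>{- int M - 1..int M}. alt_sign j * theta_term x y j *
      (recip_qfact Q (int n - j) * recip_qfact Q (int n + j))) = qpochhammer x Q n * qpochhammer y Q n"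
  using \<open>n \<le> M\<close>
proof (induction n)
  case 0
  have "(\<Sum>j\<in>{- int M - 1..int M}. alt_sign j * theta_term x y j *
      (recip_qfact Q (0 - j) * recip_qfact Q (0 + j))) = (\<Sum>j\<in>{0::int}. 1)"
  proof (rule sum.mono_neutral_cong_right)
    show "\<forall>j\<in>{- int M - 1..int M} - {0}. alt_sign j * theta_term x y j *
        (recip_qfact Q (0 - j) * recip_qfact Q (0 + j)) = 0"
      by (auto simp: recip_qfact_neg neq_iff)
  qed (auto simp: theta_term_def triangular_def)
  then show ?case by simp
next
  case (Suc n)
  define v where "v n j = recip_qfact Q (int n - j) * recip_qfact Q (int n + j)" for n j
  define I where "I = {- int M - 1..int M}"
  define S where "S n = (\<Sum>j\<in>I. alt_sign j * theta_term x y j * v n j)" for n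
  have v0: "v n j = 0" if "\<bar>j\<bar> > int n" for j
    using that by (auto simp: v_def recip_qfact_neg abs_if split: if_splits)
  \<comment> \<open>Moving \<open>j\<close> by one turns multiplication by \<open>x * Q ^ n\<close>
    into the \<open>j - 1\<close> part of the recurrence; \<open>alt_sign\<close> supplies the
    minus.\<close>
  have R: "x * Q ^ n * S n = - (\<Sum>j\<in>I. alt_sign j * theta_term x y j * (Q ^ nat (int n + 1 - j) * v n (j - 1)))"
  proof -
    define g where "g j = alt_sign j * theta_term x y (j + 1) * (Q ^ nat (int n - j) * v n j)" for j
    have "x * Q ^ n * S n = (\<Sum>j\<in>I. g j)"
      unfolding S_def sum_distrib_left
    proof (rule sum.cong[OF refl])
      fix j
      have "x * Q ^ n * theta_term x y j * v n j =
          Q ^ nat (int n - j) * theta_term x y (j + 1) * v n j"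
        using theta_term_shift_right[of j n x y] v0[of j] Q by (cases "j \<le> int n") auto
      then show "x * Q ^ n * (alt_sign j * theta_term x y j * v n j) = g j"
        by (simp add: g_def mult_ac)
    qed
    also have "\<dots> = (\<Sum>j\<in>I. g (j - 1))"
      unfolding I_def using Suc.prems by (intro sum_shift_symmetric_interval[symmetric]) (auto simp: g_def v0)
    finally show ?thesis
      by (simp add: g_def sum_negf algebra_simps)
  qed
  have L: "y * Q ^ n * S n = - (\<Sum>j\<in>I. alt_sign j * theta_term x y j * (Q ^ nat (int n + 1 + j) * v n (j + 1)))"
  proof -
    define g where "g j = alt_sign j * theta_term x y j * (Q ^ nat (int n + 1 + j) * v n (j + 1))" for j
    have "y * Q ^ n * S n = (\<Sum>j\<in>I. - g (j - 1))"
      unfolding S_def sum_distrib_left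
    proof (rule sum.cong[OF refl])
      fix j
      have "y * Q ^ n * theta_term x y j * v n j =
          Q ^ nat (int n + j) * theta_term x y (j - 1) * v n j"
        using theta_term_shift_left[of j n y x] v0[of j] Q by (cases "- j \<le> int n") auto
      then show "y * Q ^ n * (alt_sign j * theta_term x y j * v n j) = - g (j - 1)"
        by (simp add: g_def mult_ac)
    qed
    also have "\<dots> = - (\<Sum>j\<in>I. g j)"
      unfolding I_def sum_negf using Suc.prems
      by (subst sum_shift_symmetric_interval) (auto simp: g_def v0)
    finally show ?thesis by (simp add: g_def)
  qed
  have "S (Suc n) * ((1 - Q ^ (2 * n + 1)) * (1 - Q ^ (2 * n + 2))) =
      (\<Sum>j\<in>I. alt_sign j * theta_term x y j * ((1 + Q ^ (2 * n + 1)) * v n j +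
        Q ^ nat (int n + 1 - j) * v n (j - 1) + Q ^ nat (int n + 1 + j) * v n (j + 1)))"
    unfolding S_def sum_distrib_right v_def
    using recip_qfact_recurrence[OF Q(2), of n] by (intro sum.cong refl) (simp only: mult.assoc)
  also have "\<dots> = (1 + Q ^ (2 * n + 1)) * S n - x * Q ^ n * S n - y * Q ^ n * S n"
    unfolding R L by (simp add: S_def sum.distrib sum_distrib_left algebra_simps)
  also have "\<dots> = (1 - x * Q ^ n) * (1 - y * Q ^ n) * S n"
  proof -
    have "x * w * (y * w) = Q * w * w" for w
      by (simp add: Q(1)[symmetric] mult_ac)
    then have "Q ^ (2 * n + 1) = x * Q ^ n * (y * Q ^ n)"
      using Q by (simp add: mult_2 power_add)
    then show ?thesis by (simp add: algebra_simps)
  qed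
  finally have step: "S (Suc n) * ((1 - Q ^ (2 * n + 1)) * (1 - Q ^ (2 * n + 2))) =
      (1 - x * Q ^ n) * (1 - y * Q ^ n) * S n" .
  have IH: "qpochhammer Q Q (2 * n) * S n = qpochhammer x Q n * qpochhammer y Q n"
    using Suc by (simp add: S_def v_def I_def)
  have "qpochhammer Q Q (2 * Suc n) * S (Suc n) =
      qpochhammer Q Q (2 * n) * (S (Suc n) * ((1 - Q ^ (2 * n + 1)) * (1 - Q ^ (2 * n + 2))))"
    by (simp add: qpochhammer_Suc mult_ac)
  also have "\<dots> = (qpochhammer Q Q (2 * n) * S n) * ((1 - x * Q ^ n) * (1 - y * Q ^ n))"
    unfolding step by (simp only: mult_ac)
  also have "\<dots> = qpochhammer x Q (Suc n) * qpochhammer y Q (Suc n)"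
    unfolding IH by (simp only: qpochhammer_Suc mult_ac)
  finally show ?case by (simp add: S_def v_def I_def)
qed

lemma sum_fold_int:
  fixes g :: "int \<Rightarrow> 'a::comm_monoid_add"
  shows "(\<Sum>j\<in>{- int M - 1..int M}. g j) = (\<Sum>j\<le>M. g (int j) + g (- int j - 1))"
proof (induction M)
  case 0
  have "{- int 0 - 1..int 0} = {-1, 0}" by auto
  then show ?case by (simp add: add.commute)
next
  case (Suc M)
  have "{- int (Suc M) - 1..int (Suc M)} =
      insert (int (Suc M)) (insert (- int (Suc M) - 1) {- int M - 1..int M})"
    by auto
  then show ?case using Suc by (simp add: ac_simps)
qed

lemma theta_term_1_left: "theta_term 1 y j = y ^ nat (triangular (- j))"
  by (simp add: theta_term_def)

lemma nat_triangular: "nat (triangular (int j)) = j * (j + 1) div 2"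
proof -
  have "triangular (int j) = int (j * (j + 1) div 2)"
    by (simp add: triangular_def zdiv_int algebra_simps)
  then show ?thesis by simp
qed

lemma qpochhammer_1: "n > 0 \<Longrightarrow> qpochhammer 1 q n = 0"
  by (auto simp: qpochhammer_def intro!: prod_zero bexI[of _ 0])

text \<open>The finite triple product at \<open>x = 1\<close>, whose right side has the factor 1 -
  1. Pairing \<open>j\<close> with \<open>- j - 1\<close> produces
  \<open>1 - Q ^ (2 * j + 1)\<close>. This sum is the remainder in the induction for the partial
  fractions.\<close>

lemma alternating_recip_qfact_sum:
  fixes Q :: "'a::idom fps"
  assumes Q: "Q $ 0 = 0" and "N > 0"
  shows "(\<Sum>j\<le>N. (- 1) ^ j * Q ^ nat (triangular (- int j)) * (1 - Q ^ (2 * j + 1)) *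
    (recip_qfact Q (int N - int j) * recip_qfact Q (int N + 1 + int j))) = 0"
proof -
  define v where "v j = recip_qfact Q (int N - j) * recip_qfact Q (int N + j)" for j
  have "qpochhammer Q Q (2 * N) * (\<Sum>j\<in>{- int N - 1..int N}. alt_sign j * theta_term 1 Q j * v j) = 0"
    using finite_triple_product[of 1 Q Q N N] assms by (simp add: v_def qpochhammer_1)
  moreover have "qpochhammer Q Q (2 * N) \<noteq> 0"
    using qpochhammer_nth_0[OF Q, of Q "2 * N"] by auto
  ultimately have "0 = (\<Sum>j\<in>{- int N - 1..int N}. alt_sign j * Q ^ nat (triangular (- j)) * v j)"
    by (simp add: theta_term_1_left)
  also have "\<dots> = (\<Sum>j\<le>N. alt_sign (int j) * Q ^ nat (triangular (- int j)) * v (int j) +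
      alt_sign (- int j - 1) * Q ^ nat (triangular (- (- int j - 1))) * v (- int j - 1))"
    by (rule sum_fold_int)
  also have "\<dots> = (\<Sum>j\<le>N. (- 1) ^ j * Q ^ nat (triangular (- int j)) * (1 - Q ^ (2 * j + 1)) *
      (recip_qfact Q (int N - int j) * recip_qfact Q (int N + 1 + int j)))"
  proof (rule sum.cong[OF refl])
    fix j assume "j \<in> {..N}"
    then have j: "j \<le> N" by simp
    define A B where "A = recip_qfact Q (int N - int j)" and "B = recip_qfact Q (int N + 1 + int j)"
    have 1: "v (int j) = A * B * (1 - Q ^ (N + 1 + j))"
      using recip_qfact_pred[OF Q, of "int N + 1 + int j"]
      by (simp add: v_def A_def B_def nat_add_distrib nat_diff_distrib')
    have 2: "v (- int j - 1) = A * B * (1 - Q ^ (N - j))"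
    proof -
      have "nat (int N - int j) = N - j" by simp
      then have "recip_qfact Q (int N + (- int j - 1)) = A * (1 - Q ^ (N - j))"
        using recip_qfact_pred[OF Q, of "int N - int j"] by (simp add: A_def add_diff_eq)
      moreover have "recip_qfact Q (int N - (- int j - 1)) = B"
        by (simp add: B_def algebra_simps)
      ultimately show ?thesis by (simp only: v_def mult_ac)
    qed
    have 3: "nat (triangular (- (- int j - 1))) = nat (triangular (- int j)) + (2 * j + 1)"
    proof -
      have "triangular (- (- int j - 1)) = triangular (- int j) + int (2 * j + 1)"
        using triangular_simps(1)[of "int j"] triangular[of "int j"] triangular[of "- int j"]
        by (simp add: algebra_simps)
      then show ?thesis by (simp only: nat_add_distrib triangular_nonneg of_nat_0_le_iff nat_int)
    qed
    have 4: "Q ^ (2 * j + 1) * Q ^ (N - j) = Q ^ (N + 1 + j)"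
      using j by (simp add: mult_2 add.commute flip: power_add)
    have 5: "alt_sign (- int j - 1) = - ((- 1) ^ j :: 'a fps)"
      by (auto simp: alt_sign_def)
    have "Q ^ nat (triangular (- int j)) * (A * B * (1 - Q ^ (N + 1 + j))) -
        Q ^ nat (triangular (- int j)) * Q ^ (2 * j + 1) * (A * B * (1 - Q ^ (N - j))) =
        Q ^ nat (triangular (- int j)) * (1 - Q ^ (2 * j + 1)) * (A * B)"
      unfolding 4[symmetric] by (simp add: algebra_simps)
    then show "alt_sign (int j) * Q ^ nat (triangular (- int j)) * v (int j) +
        alt_sign (- int j - 1) * Q ^ nat (triangular (- (- int j - 1))) * v (- int j - 1) =
        (- 1) ^ j * Q ^ nat (triangular (- int j)) * (1 - Q ^ (2 * j + 1)) *
        (recip_qfact Q (int N - int j) * recip_qfact Q (int N + 1 + int j))"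
      unfolding 1 2 3 5 A_def[symmetric] B_def[symmetric] power_add
      by (simp add: algebra_simps)
  qed
  finally show ?thesis by simp
qed

section \<open>Partial fractions of 1 / ((x; Q)_(n+1) (y; Q)_(n+1)) for xy = Q\<close>

definition theta_denom :: "'a::comm_ring_1 \<Rightarrow> 'a \<Rightarrow> 'a \<Rightarrow> nat \<Rightarrow> 'a" where
  "theta_denom x y Q j = (1 - x * Q ^ j) * (1 - y * Q ^ j)"

text \<open>For \<open>x * y = Q\<close> the bracket equals 1/(1 - x Q^j) + 1/(1 - y Q^j) - 1, so
  this is the sum of the terms with indices j and -j-1 of the Appell-Lerch series with summand
  (-1)^j Q^(j(j+1)/2) / (1 - x Q^j).\<close>

definition appell_term :: "'a::comm_ring_1 fps \<Rightarrow> 'a fps \<Rightarrow> 'a fps \<Rightarrow> nat \<Rightarrow> 'a fps" where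
  "appell_term x y Q j = (- 1) ^ j * Q ^ (j * (j + 1) div 2) * ((1 - Q ^ (2 * j + 1)) *
     fps_recip (theta_denom x y Q j))"

lemma theta_denom_nth_0: "x $ 0 = 0 \<Longrightarrow> y $ 0 = 0 \<Longrightarrow> theta_denom x y Q j $ 0 = (1::'a::comm_ring_1)"
  by (simp add: theta_denom_def)

text \<open>As xy = Q, \<open>theta_denom\<close> at j is 1 - (x+y) Q^j + Q^(2j+1), hence affine in
  x + y. The denominator at n+1 is therefore a multiple of the one at j plus a term free of x and y.
  The first part cancels the reciprocal and leaves an alternating sum that vanishes; the second
  shortens both q-factorials and leaves the expansion for n.\<close>

lemma finite_partial_fractions:
  fixes x y Q :: "'a::idom fps"
  assumes Q: "x * y = Q" and xy: "x $ 0 = 0" "y $ 0 = 0"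
  shows "(\<Sum>j\<le>n. appell_term x y Q j *
     (recip_qfact Q (int n - int j) * recip_qfact Q (int n + 1 + int j))) *
     (qpochhammer x Q (Suc n) * qpochhammer y Q (Suc n)) = 1"
proof (induction n)
  case 0
  have Q0: "Q $ 0 = 0" using assms by auto
  have d: "theta_denom x y Q 0 * fps_recip (theta_denom x y Q 0) = 1"
    by (rule fps_recip) (simp add: theta_denom_nth_0 xy)
  have r: "recip_qfact Q 1 * (1 - Q) = 1"
    using recip_qfact_pred[OF Q0, of 1] by simp
  have "appell_term x y Q 0 * recip_qfact Q 1 * theta_denom x y Q 0 =
      (recip_qfact Q 1 * (1 - Q)) * (theta_denom x y Q 0 * fps_recip (theta_denom x y Q 0))"
    by (simp add: appell_term_def mult_ac)
  then show ?case unfolding d r by (simp add: qpochhammer_Suc theta_denom_def mult_ac)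
next
  case (Suc n)
  have Q0: "Q $ 0 = 0" using assms by auto
  define u where "u n j = recip_qfact Q (int n - int j) * recip_qfact Q (int n + 1 + int j)" for n j
  define S where "S n = (\<Sum>j\<le>n. appell_term x y Q j * u n j)" for n
  define d where "d = theta_denom x y Q"
  define p where "p j = (- 1) ^ j * Q ^ (j * (j + 1) div 2) * (1 - Q ^ (2 * j + 1))" for j
  have a: "appell_term x y Q j = p j * fps_recip (d j)" for j
    by (simp add: appell_term_def p_def d_def mult_ac)
  have rec: "d j * fps_recip (d j) = 1" for j
    unfolding d_def by (rule fps_recip) (simp add: theta_denom_nth_0 xy)
  have *: "d (Suc n) * (appell_term x y Q j * u (Suc n) j) =
      p j * Q ^ (Suc n - j) * u (Suc n) j + appell_term x y Q j * u n j" if "j \<le> Suc n" for j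
  proof -
    have "d (Suc n) = Q ^ (Suc n - j) * d j + (1 - Q ^ (Suc n - j)) * (1 - Q ^ (n + 2 + j))"
    proof -
      have "x * w * (y * w) = Q * w * w" for w
        by (simp add: Q[symmetric] mult_ac)
      then have d: "d i = 1 - (x + y) * Q ^ i + Q * Q ^ i * Q ^ i" for i
        using Q by (simp add: d_def theta_denom_def algebra_simps)
      have e: "Q ^ Suc n = Q ^ (Suc n - j) * Q ^ j"
        using that by (simp only: flip: power_add) simp
      have f: "Q ^ (n + 2 + j) = Q * Q ^ Suc n * Q ^ j" by (simp add: power_add)
      have "1 - (x + y) * (a * b) + Q * (a * b) * (a * b) =
          a * (1 - (x + y) * b + Q * b * b) + (1 - a) * (1 - Q * (a * b) * b)" for a b
        by (simp add: algebra_simps)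
      then show ?thesis unfolding f d e .
    qed
    note d_eq = this
    have u_eq: "u n j = u (Suc n) j * ((1 - Q ^ (Suc n - j)) * (1 - Q ^ (n + 2 + j)))"
    proof -
      have 1: "nat (int (Suc n) - int j) = Suc n - j" "nat (int (Suc n) + 1 + int j) = n + 2 + j"
        by simp_all
      have 2: "int n - int j = int (Suc n) - int j - 1" "int n + 1 + int j = int (Suc n) + 1 + int j - 1"
        by simp_all
      show ?thesis unfolding u_def 2 recip_qfact_pred[OF Q0] 1 by (simp only: mult_ac)
    qed
    have "(E * e + s) * (z * R * w) = z * E * w * (e * R) + z * R * (w * s)" for E e s z R w :: "'a fps"
      by (simp add: algebra_simps)
    then have "d (Suc n) * (appell_term x y Q j * u (Suc n) j) =
        p j * Q ^ (Suc n - j) * u (Suc n) j * (d j * fps_recip (d j)) + appell_term x y Q j * u n j"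
      unfolding a d_eq u_eq .
    then show ?thesis unfolding rec by simp
  qed
  have regroup: "s * a * e * b * z = c * (s * g * e * z)" if "a * b = c * g" for s a e b z c g :: "'a fps"
  proof -
    have "s * a * e * b * z = s * e * z * (a * b)" by (simp only: mult_ac)
    then show ?thesis unfolding that by (simp only: mult_ac)
  qed
  have "d (Suc n) * S (Suc n) =
      (\<Sum>j\<le>Suc n. p j * Q ^ (Suc n - j) * u (Suc n) j) + (\<Sum>j\<le>Suc n. appell_term x y Q j * u n j)"
    unfolding S_def sum_distrib_left sum.distrib[symmetric] using * by (intro sum.cong) auto
  also have "(\<Sum>j\<le>Suc n. appell_term x y Q j * u n j) = S n"
    by (simp add: S_def u_def recip_qfact_neg)
  also have "(\<Sum>j\<le>Suc n. p j * Q ^ (Suc n - j) * u (Suc n) j) = Q ^ Suc n *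
      (\<Sum>j\<le>Suc n. (- 1) ^ j * Q ^ nat (triangular (- int j)) * (1 - Q ^ (2 * j + 1)) *
      (recip_qfact Q (int (Suc n) - int j) * recip_qfact Q (int (Suc n) + 1 + int j)))"
    unfolding sum_distrib_left
  proof (rule sum.cong[OF refl])
    fix j assume "j \<in> {..Suc n}"
    moreover have "triangular (int j) = triangular (- int j) + int j"
      using triangular[of "int j"] triangular[of "- int j"] by (simp add: algebra_simps)
    then have "nat (triangular (int j)) = nat (triangular (- int j)) + j"
      by (simp only: nat_add_distrib triangular_nonneg of_nat_0_le_iff nat_int)
    ultimately have "j * (j + 1) div 2 + (Suc n - j) = Suc n + nat (triangular (- int j))"
      unfolding nat_triangular by simp
    then have "Q ^ (j * (j + 1) div 2) * Q ^ (Suc n - j) = Q ^ Suc n * Q ^ nat (triangular (- int j))"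
      by (metis power_add)
    then show "p j * Q ^ (Suc n - j) * u (Suc n) j = Q ^ Suc n *
        ((- 1) ^ j * Q ^ nat (triangular (- int j)) * (1 - Q ^ (2 * j + 1)) *
        (recip_qfact Q (int (Suc n) - int j) * recip_qfact Q (int (Suc n) + 1 + int j)))"
      using regroup unfolding p_def u_def by blast
  qed
  also have "\<dots> = 0" by (subst alternating_recip_qfact_sum[OF Q0]) simp_all
  finally have step: "d (Suc n) * S (Suc n) = S n" by simp
  have "S (Suc n) * (qpochhammer x Q (Suc (Suc n)) * qpochhammer y Q (Suc (Suc n))) =
      (d (Suc n) * S (Suc n)) * (qpochhammer x Q (Suc n) * qpochhammer y Q (Suc n))"
    by (simp add: qpochhammer_Suc[of _ _ "Suc n"] d_def theta_denom_def mult_ac)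
  also have "\<dots> = 1" using Suc unfolding step by (simp add: S_def u_def)
  finally show ?case by (simp add: S_def u_def)
qed

lemma appell_term_nth_eq_0:
  assumes "Q $ 0 = 0" "k < n"
  shows "appell_term x y Q n $ k = 0"
proof -
  have "2 * n \<le> n * (n + 1)" by (cases n) auto
  then have "n \<le> n * (n + 1) div 2" by linarith
  then have "Q ^ (n * (n + 1) div 2) = Q ^ n * Q ^ (n * (n + 1) div 2 - n)"
    by (simp only: flip: power_add) simp
  then have "appell_term x y Q n = Q ^ n * (Q ^ (n * (n + 1) div 2 - n) * ((- 1) ^ n * ((1 - Q ^ (2 * n + 1)) *
     fps_recip (theta_denom x y Q n))))"
    unfolding appell_term_def by (simp only: mult_ac)
  then show ?thesis using assms by (simp add: fps_power_mult_nth_eq_0)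
qed

lemma partial_fractions:
  fixes x y Q :: "'a::idom fps"
  assumes Q: "x * y = Q" and xy: "x $ 0 = 0" "y $ 0 = 0"
  shows "(\<Sum>j. appell_term x y Q j * (fps_recip (qpoch_inf Q Q) * fps_recip (qpoch_inf Q Q))) *
     (qpoch_inf x Q * qpoch_inf y Q) = 1"
proof -
  have Q0: "Q $ 0 = 0" using assms by auto
  define r where "r = (\<lambda>n. recip_qfact Q (int n))"
  have r: "r \<longlonglongrightarrow> fps_recip (qpoch_inf Q Q)"
    unfolding r_def by (rule recip_qfact_tendsto[OF Q0])
  \<comment> \<open>Indexed so that \<open>u (Suc n) j\<close> is the coefficient in the finite
    expansion for \<open>n\<close>, matching the range \<open>j < M\<close>.\<close>
  define u where "u M j = recip_qfact Q (int M - 1 - int j) * recip_qfact Q (int M + int j)" for M j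
  have "(\<lambda>M. u M j) \<longlonglongrightarrow> fps_recip (qpoch_inf Q Q) * fps_recip (qpoch_inf Q Q)" for j
  proof -
    have "(\<lambda>M. r M * r (M + (2 * j + 1))) \<longlonglongrightarrow> fps_recip (qpoch_inf Q Q) * fps_recip (qpoch_inf Q Q)"
      by (intro tendsto_mult r LIMSEQ_ignore_initial_segment)
    also have "(\<lambda>M. r M * r (M + (2 * j + 1))) = (\<lambda>M. u (M + (j + 1)) j)"
      by (simp add: u_def r_def fun_eq_iff algebra_simps)
    finally show ?thesis by (rule LIMSEQ_offset)
  qed
  from suminf_fps_tannery[OF appell_term_nth_eq_0[OF Q0] this]
  have "(\<lambda>M. \<Sum>j<M. appell_term x y Q j * u M j) \<longlonglongrightarrow>
      (\<Sum>j. appell_term x y Q j * (fps_recip (qpoch_inf Q Q) * fps_recip (qpoch_inf Q Q)))" .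
  then have "(\<lambda>M. (\<Sum>j<M. appell_term x y Q j * u M j) * (qpochhammer x Q M * qpochhammer y Q M)) \<longlonglongrightarrow>
      (\<Sum>j. appell_term x y Q j * (fps_recip (qpoch_inf Q Q) * fps_recip (qpoch_inf Q Q))) *
      (qpoch_inf x Q * qpoch_inf y Q)"
    by (intro tendsto_mult qpochhammer_tendsto Q0)
  then have "(\<lambda>n. (\<Sum>j<Suc n. appell_term x y Q j * u (Suc n) j) *
      (qpochhammer x Q (Suc n) * qpochhammer y Q (Suc n))) \<longlonglongrightarrow>
      (\<Sum>j. appell_term x y Q j * (fps_recip (qpoch_inf Q Q) * fps_recip (qpoch_inf Q Q))) *
      (qpoch_inf x Q * qpoch_inf y Q)"
    by (rule LIMSEQ_Suc)
  moreover have "(\<Sum>j<Suc n. appell_term x y Q j * u (Suc n) j) *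
      (qpochhammer x Q (Suc n) * qpochhammer y Q (Suc n)) = 1" for n
    using finite_partial_fractions[OF assms, of n] by (simp add: u_def lessThan_Suc_atMost algebra_simps)
  ultimately show ?thesis using LIMSEQ_unique[OF _ tendsto_const] by simp
qed

text \<open>The summand of the Durfee rectangle identity: partitions sorted by the largest m by m+a
  rectangle in their diagram.\<close>

definition cauchy_term :: "'a::idom fps \<Rightarrow> nat \<Rightarrow> nat \<Rightarrow> 'a fps" where
  "cauchy_term Q a m = Q ^ (m * (m + a)) * (recip_qfact Q (int m) * recip_qfact Q (int m + int a))"

lemma cauchy_term_nth_eq_0:
  assumes "Q $ 0 = 0" "k < m"
  shows "cauchy_term Q a m $ k = 0"
proof -
  have "m \<le> m * (m + a)" by (cases m) auto
  then have "k < m * (m + a)" using assms(2) by linarith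
  then show ?thesis unfolding cauchy_term_def by (rule fps_power_mult_nth_eq_0[OF assms(1)])
qed

text \<open>Iterating this identity shows that the difference is divisible by every power of \<open>Q\<close>, so the
  sum does not depend on \<open>a\<close>; its value is found by letting \<open>a \<rightarrow> \<infinity>\<close>.\<close>
lemma cauchy_sum_diff:
  assumes Q: "Q $ 0 = 0"
  shows "suminf (cauchy_term Q a) - suminf (cauchy_term Q (Suc a)) =
    - (Q ^ Suc a) * (suminf (cauchy_term Q (Suc a)) - suminf (cauchy_term Q (Suc (Suc a))))"
proof -
  define r where "r = recip_qfact Q"
  define D where "D a m = cauchy_term Q a m - cauchy_term Q (Suc a) m" for a m
  \<comment> \<open>The telescoping part of \<open>D a m\<close>. It starts at zero because
    \<open>r (- 1) = 0\<close>, and it tends to zero because of the quadratic exponent.\<close>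
  define Y where "Y m = Q ^ (m * (m + a)) * (r (int m - 1) * r (int (m + a + 1)))" for m
  have pred: "r (z - 1) = r z * (1 - Q ^ nat z)" for z
    unfolding r_def by (rule recip_qfact_pred[OF Q])
  have D_eq: "D a m = Q ^ (m * (m + a)) * (r (int m) * r (int (m + a + 1))) * (1 - Q ^ m - Q ^ (m + a + 1))" for a m
  proof -
    have "r (int m + int a) = r (int (m + a + 1)) * (1 - Q ^ (m + a + 1))"
    proof -
      have "int m + int a = int (m + a + 1) - 1" by simp
      then show ?thesis using pred[of "int (m + a + 1)"] by (simp only: nat_int)
    qed
    moreover have "Q ^ (m * (m + Suc a)) = Q ^ (m * (m + a)) * Q ^ m"
      by (simp add: power_add[symmetric] algebra_simps)
    moreover have "int m + int (Suc a) = int (m + a + 1)" by simp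
    ultimately show ?thesis unfolding D_def cauchy_term_def r_def[symmetric]
      by (simp only: ring_distribs mult_ac diff_conv_add_uminus) simp
  qed
  have tele: "D a m = Y m - Y (Suc m) - Q ^ Suc a * D (Suc a) m" for m
  proof -
    have "r (int m - 1) = r (int m) * (1 - Q ^ m)" using pred[of "int m"] by simp
    moreover have "r (int (m + a + 1)) = r (int (m + Suc a + 1)) * (1 - Q ^ (m + a + 2))"
    proof -
      have "int (m + a + 1) = int (m + Suc a + 1) - 1" "m + Suc a + 1 = m + a + 2" by simp_all
      then show ?thesis using pred[of "int (m + Suc a + 1)"] by (simp only: nat_int)
    qed
    moreover have "Q ^ (Suc m * (Suc m + a)) = Q ^ (m * (m + a)) * Q ^ m * Q ^ m * Q ^ Suc a"
      by (simp add: power_add[symmetric] algebra_simps)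
    moreover have "Q ^ (m * (m + Suc a)) = Q ^ (m * (m + a)) * Q ^ m"
      by (simp add: power_add[symmetric] algebra_simps)
    moreover have "Q ^ (m + a + 1) = Q ^ m * Q ^ Suc a" "Q ^ (m + a + 2) = Q * Q ^ m * Q ^ Suc a"
      "Q ^ (m + Suc a + 1) = Q * Q ^ m * Q ^ Suc a"
      by (simp_all add: power_add)
    moreover have "int (Suc m) - 1 = int m" "int (Suc m + a + 1) = int (m + Suc a + 1)" by simp_all
    ultimately show ?thesis unfolding D_eq Y_def
      by (simp only: ring_distribs mult_ac diff_conv_add_uminus) simp
  qed
  have C: "(\<lambda>M. \<Sum>m<M. cauchy_term Q b m) \<longlonglongrightarrow> suminf (cauchy_term Q b)" for b
    using sums_fps_null[of "cauchy_term Q b"] cauchy_term_nth_eq_0[OF Q] by (simp add: sums_def)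
  have D: "(\<lambda>M. \<Sum>m<M. D b m) \<longlonglongrightarrow> suminf (cauchy_term Q b) - suminf (cauchy_term Q (Suc b))" for b
    unfolding D_def sum_subtractf by (intro tendsto_diff C)
  have Y: "Y \<longlonglongrightarrow> 0"
  proof (rule tendsto_fpsI)
    fix n
    show "\<forall>\<^sub>F m in sequentially. Y m $ n = 0 $ n"
      using eventually_gt_at_top[of n]
    proof eventually_elim
      case (elim m)
      then have "n < m * (m + a)" by (cases m) auto
      then show ?case unfolding Y_def by (simp add: fps_power_mult_nth_eq_0[OF Q])
    qed
  qed
  have "Y 0 = 0" by (simp add: Y_def r_def recip_qfact_neg)
  then have "(\<Sum>m<M. D a m) = - Y M - Q ^ Suc a * (\<Sum>m<M. D (Suc a) m)" for M
    using sum_lessThan_telescope'[of Y M] unfolding tele sum_subtractf sum_distrib_left by simp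
  moreover have "(\<lambda>M. - Y M - Q ^ Suc a * (\<Sum>m<M. D (Suc a) m)) \<longlonglongrightarrow>
      - 0 - Q ^ Suc a * (suminf (cauchy_term Q (Suc a)) - suminf (cauchy_term Q (Suc (Suc a))))"
    by (intro tendsto_diff tendsto_minus tendsto_mult tendsto_const Y D)
  ultimately show ?thesis using LIMSEQ_unique[OF D[of a]] by simp
qed

lemma cauchy_sum:
  assumes Q: "Q $ 0 = 0"
  shows "cauchy_term Q a sums fps_recip (qpoch_inf Q Q)"
proof -
  define C where "C a = suminf (cauchy_term Q a)" for a
  have "(C a - C (Suc a)) $ N = 0" for a N
  proof (induction N arbitrary: a rule: less_induct)
    case (less N)
    have "C a - C (Suc a) = - (Q ^ Suc a) * (C (Suc a) - C (Suc (Suc a)))"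
      unfolding C_def by (rule cauchy_sum_diff[OF Q])
    also have "\<dots> $ N = - (\<Sum>i=0..N. (Q ^ Suc a) $ i * (C (Suc a) - C (Suc (Suc a))) $ (N - i))"
      by (simp add: fps_mult_nth sum_negf)
    also have "(\<Sum>i=0..N. (Q ^ Suc a) $ i * (C (Suc a) - C (Suc (Suc a))) $ (N - i)) = 0"
    proof (rule sum.neutral, rule ballI)
      fix i assume "i \<in> {0..N}"
      then show "(Q ^ Suc a) $ i * (C (Suc a) - C (Suc (Suc a))) $ (N - i) = 0"
        using less[of "N - i" "Suc a"] Q by (cases "i = 0") auto
    qed
    finally show ?case by simp
  qed
  then have "C a = C (Suc a)" for a by (simp add: fps_eq_iff)
  then have C: "C a = C 0" for a by (induction a) auto
  have lim: "cauchy_term Q b sums C 0" for b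
    using sums_fps_null[of "cauchy_term Q b"] cauchy_term_nth_eq_0[OF Q] C[of b] by (simp add: C_def)
  have "(\<lambda>b. recip_qfact Q (int b)) \<longlonglongrightarrow> C 0"
  proof (rule tendsto_fpsI)
    fix N
    show "\<forall>\<^sub>F b in sequentially. recip_qfact Q (int b) $ N = C 0 $ N"
      using eventually_gt_at_top[of N]
    proof eventually_elim
      case (elim b)
      have "(\<lambda>M. \<Sum>m<M. cauchy_term Q b m) \<longlonglongrightarrow> C 0"
        using lim[of b] by (simp add: sums_def)
      then have "\<forall>\<^sub>F M in sequentially. (\<Sum>m<M. cauchy_term Q b m) $ N = C 0 $ N"
        by (simp add: tendsto_fps_iff)
      then obtain M0 where M0: "\<And>M. M \<ge> M0 \<Longrightarrow> (\<Sum>m<M. cauchy_term Q b m) $ N = C 0 $ N"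
        unfolding eventually_sequentially by blast
      define M where "M = Suc M0"
      have M: "(\<Sum>m<M. cauchy_term Q b m) $ N = C 0 $ N" "M > 0"
        using M0[of M] by (simp_all add: M_def)
      \<comment> \<open>For \<open>b > N\<close> every term with \<open>m > 0\<close> starts beyond
        degree \<open>N\<close>, so only 1/(Q; Q)_b survives.\<close>
      have "(\<Sum>m<M. cauchy_term Q b m $ N) = (\<Sum>m\<in>{0}. cauchy_term Q b m $ N)"
      proof (rule sum.mono_neutral_right)
        show "\<forall>m\<in>{..<M} - {0}. cauchy_term Q b m $ N = 0"
        proof
          fix m assume "m \<in> {..<M} - {0}"
          then have "N < m * (m + b)" using elim by (cases m) auto
          then show "cauchy_term Q b m $ N = 0"
            unfolding cauchy_term_def by (rule fps_power_mult_nth_eq_0[OF Q])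
        qed
      qed (use M in auto)
      then show ?case using M by (simp add: fps_sum_nth cauchy_term_def)
    qed
  qed
  then have "C 0 = fps_recip (qpoch_inf Q Q)"
    by (rule LIMSEQ_unique[OF _ recip_qfact_tendsto[OF Q]])
  then show ?thesis using lim by simp
qed

text \<open>The left side is the universal mock theta function g_3. After inserting the finite
  expansion and exchanging the sums, n = m + j turns the inner sum into Q^(j(j+1)) times the Cauchy
  sum with a = 2j + 1. The total exponent 3j(j+1)/2 is what makes the level three.\<close>

lemma universal_mock_theta_sums:
  fixes x y Q :: "'a::idom fps"
  assumes Q: "x * y = Q" and xy: "x $ 0 = 0" "y $ 0 = 0"
  shows "(\<lambda>n. Q ^ (n * (n + 1)) * fps_recip (qpochhammer x Q (Suc n) * qpochhammer y Q (Suc n))) sums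
    (\<Sum>j. appell_term x y Q j * (Q ^ (j * (j + 1)) * fps_recip (qpoch_inf Q Q)))"
proof -
  have Q0: "Q $ 0 = 0" using assms by auto
  define u where "u n j = recip_qfact Q (int n - int j) * recip_qfact Q (int n + 1 + int j)" for n j
  define K where "K M j = (\<Sum>n\<in>{j..<M}. Q ^ (n * (n + 1)) * u n j)" for M j
  have K: "(\<lambda>M. K M j) \<longlonglongrightarrow> Q ^ (j * (j + 1)) * fps_recip (qpoch_inf Q Q)" for j
  proof (rule LIMSEQ_offset[of _ j])
    have "K (M + j) j = Q ^ (j * (j + 1)) * (\<Sum>m<M. cauchy_term Q (2 * j + 1) m)" for M
    proof -
      have "K (M + j) j = (\<Sum>m<M. Q ^ ((m + j) * (m + j + 1)) * u (m + j) j)"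
        unfolding K_def by (rule sum.reindex_bij_witness[of _ "\<lambda>m. m + j" "\<lambda>n. n - j"]) auto
      also have "\<dots> = (\<Sum>m<M. Q ^ (j * (j + 1)) * cauchy_term Q (2 * j + 1) m)"
      proof (rule sum.cong[OF refl])
        fix m
        have "(m + j) * (m + j + 1) = j * (j + 1) + m * (m + (2 * j + 1))" by (simp add: algebra_simps)
        then show "Q ^ ((m + j) * (m + j + 1)) * u (m + j) j = Q ^ (j * (j + 1)) * cauchy_term Q (2 * j + 1) m"
          by (simp add: cauchy_term_def u_def power_add[symmetric] add_ac flip: mult.assoc)
      qed
      finally show ?thesis by (simp add: sum_distrib_left)
    qed
    then show "(\<lambda>M. K (M + j) j) \<longlonglongrightarrow> Q ^ (j * (j + 1)) * fps_recip (qpoch_inf Q Q)"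
      using cauchy_sum[OF Q0, of "2 * j + 1"] by (simp add: sums_def tendsto_mult)
  qed
  have "(\<Sum>n<M. Q ^ (n * (n + 1)) * fps_recip (qpochhammer x Q (Suc n) * qpochhammer y Q (Suc n))) =
      (\<Sum>j<M. appell_term x y Q j * K M j)" for M
  proof -
    have "fps_recip (qpochhammer x Q (Suc n) * qpochhammer y Q (Suc n)) =
        (\<Sum>j\<le>n. appell_term x y Q j * u n j)" for n
      using finite_partial_fractions[OF assms, of n]
      by (intro fps_recip_unique[symmetric]) (simp_all add: u_def mult.commute qpochhammer_nth_0 xy)
    then have "(\<Sum>n<M. Q ^ (n * (n + 1)) * fps_recip (qpochhammer x Q (Suc n) * qpochhammer y Q (Suc n))) =
        (\<Sum>n<M. \<Sum>j\<le>n. appell_term x y Q j * (Q ^ (n * (n + 1)) * u n j))"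
      by (simp add: sum_distrib_left mult_ac)
    also have "\<dots> = (\<Sum>n<M. \<Sum>j\<in>{j. j < M \<and> j \<le> n}. appell_term x y Q j * (Q ^ (n * (n + 1)) * u n j))"
      by (intro sum.cong) auto
    also have "\<dots> = (\<Sum>j<M. \<Sum>n\<in>{n. n < M \<and> j \<le> n}. appell_term x y Q j * (Q ^ (n * (n + 1)) * u n j))"
      using sum.swap_restrict[of "{..<M}" "{..<M}" "\<lambda>n j. appell_term x y Q j * (Q ^ (n * (n + 1)) * u n j)" "\<lambda>n j. j \<le> n"]
      by simp
    also have "\<dots> = (\<Sum>j<M. appell_term x y Q j * K M j)"
      unfolding K_def sum_distrib_left by (intro sum.cong) auto
    finally show ?thesis .
  qed
  then show ?thesis
    unfolding sums_def using suminf_fps_tannery[OF appell_term_nth_eq_0[OF Q0] K] by simp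
qed

section \<open>The coefficients at exponents 1 modulo 3\<close>

definition fps_third :: "'a::zero fps \<Rightarrow> 'a fps" where
  "fps_third F = Abs_fps (\<lambda>n. F $ (3 * n))"

lemma fps_third_nth [simp]: "fps_third F $ n = F $ (3 * n)"
  by (simp add: fps_third_def)

lemma fps_compose_X_power_mult_nth:
  fixes A B :: "'a::comm_ring_1 fps"
  assumes "k > 0" "r < k"
  shows "((A oo fps_X ^ k) * B) $ (k * n + r) = (\<Sum>i\<le>n. A $ i * B $ (k * (n - i) + r))"
proof -
  have "((A oo fps_X ^ k) * B) $ (k * n + r) =
      (\<Sum>i=0..k * n + r. (if k dvd i then A $ (i div k) else 0) * B $ (k * n + r - i))"
    by (simp add: fps_mult_nth fps_nth_compose_X_power)
  also have "\<dots> = (\<Sum>i\<in>(\<lambda>i. k * i) ` {..n}. A $ (i div k) * B $ (k * n + r - i))"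
  proof (rule sum.mono_neutral_cong_right)
    show "(\<lambda>i. k * i) ` {..n} \<subseteq> {0..k * n + r}" by (auto intro!: trans_le_add1)
    show "\<forall>i\<in>{0..k * n + r} - (\<lambda>i. k * i) ` {..n}. (if k dvd i then A $ (i div k) else 0) * B $ (k * n + r - i) = 0"
    proof
      fix i assume i: "i \<in> {0..k * n + r} - (\<lambda>i. k * i) ` {..n}"
      have "\<not> k dvd i"
      proof
        assume "k dvd i"
        then obtain l where l: "i = k * l" by blast
        have "k * l < k * (n + 1)" using i l assms by simp
        then have "l < n + 1" using mult_less_cancel1 by blast
        then have "l \<le> n" by simp
        then show False using i l by auto
      qed
      then show "(if k dvd i then A $ (i div k) else 0) * B $ (k * n + r - i) = 0" by simp
    qed
  qed auto
  also have "\<dots> = (\<Sum>i\<le>n. A $ i * B $ (k * n + r - k * i))"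
    using assms by (subst sum.reindex) (auto simp: inj_on_def)
  also have "\<dots> = (\<Sum>i\<le>n. A $ i * B $ (k * (n - i) + r))"
  proof (rule sum.cong[OF refl])
    fix i assume "i \<in> {..n}"
    then have "k * n + r - k * i = k * (n - i) + r" by (simp add: diff_mult_distrib2)
    then show "A $ i * B $ (k * n + r - k * i) = A $ i * B $ (k * (n - i) + r)" by simp
  qed
  finally show ?thesis .
qed

lemma fps_third_mult:
  fixes A B :: "'a::comm_ring_1 fps"
  shows "fps_third ((A oo fps_X ^ 3) * B) = A * fps_third B"
  using fps_compose_X_power_mult_nth[of 3 0 A B]
  by (simp add: fps_eq_iff fps_mult_nth atLeast0AtMost)

lemma fps_third_sums:
  fixes F :: "nat \<Rightarrow> 'a::comm_ring_1 fps"
  assumes "F sums S"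
  shows "(\<lambda>n. fps_third (F n)) sums fps_third S"
  using assms unfolding sums_def tendsto_fps_iff by (simp add: fps_sum_nth)

lemma fps_sums_mult:
  fixes F :: "nat \<Rightarrow> 'a::comm_ring_1 fps"
  assumes "F sums S"
  shows "(\<lambda>n. c * F n) sums (c * S)"
  using assms unfolding sums_def sum_distrib_left[symmetric] by (intro tendsto_mult tendsto_const)

lemma fps_recip_compose:
  fixes f :: "'a::idom fps"
  assumes "f $ 0 = 1" "k > 0"
  shows "fps_recip (f oo fps_X ^ k) = fps_recip f oo fps_X ^ k"
proof (rule fps_recip_unique[symmetric])
  have "(f oo fps_X ^ k) * (fps_recip f oo fps_X ^ k) = (f * fps_recip f) oo fps_X ^ k"
    using assms by (subst fps_compose_mult_distrib) auto
  then show "(f oo fps_X ^ k) * (fps_recip f oo fps_X ^ k) = 1" using assms by (simp add: fps_recip)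
qed (use assms in \<open>simp add: fps_nth_compose_X_power\<close>)

lemma fps_recip_one_minus_X_power_nth:
  assumes "m > 0"
  shows "fps_recip (1 - fps_X ^ m) $ k = (if m dvd k then 1 else (0::'a::idom))"
proof -
  have "(1 - fps_X) * Abs_fps (\<lambda>_. 1) = (1 :: 'a fps)"
    by (rule fps_ext) (simp add: left_diff_distrib)
  then have "fps_recip (1 - fps_X :: 'a fps) = Abs_fps (\<lambda>_. 1)"
    by (rule fps_recip_unique[symmetric]) simp
  moreover have "(1 - fps_X ^ m :: 'a fps) = (1 - fps_X) oo fps_X ^ m"
    using assms by (simp add: fps_compose_sub_distrib)
  ultimately show ?thesis
    using assms by (simp add: fps_recip_compose fps_nth_compose_X_power)
qed

text \<open>In a geometric series the coefficient at 3n is 1 iff m divides 3n, which for m prime to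
  3 means that m divides n.\<close>

lemma fps_third_recip:
  assumes "m > 0" "coprime m 3"
  shows "fps_third (fps_recip (1 - fps_X ^ m)) = (fps_recip (1 - fps_X ^ m) :: 'a::idom fps)"
  using assms by (simp add: fps_eq_iff fps_recip_one_minus_X_power_nth coprime_dvd_mult_right_iff)

section \<open>Euler products f_k and the case Q = q^6\<close>

definition euler :: "nat \<Rightarrow> int fps" where
  "euler k = qpoch_inf (fps_X ^ k) (fps_X ^ k)"

lemma euler_nth_0: "k > 0 \<Longrightarrow> euler k $ 0 = 1"
  unfolding euler_def by (rule qpoch_inf_nth_0) simp

lemma euler_compose: "k > 0 \<Longrightarrow> m > 0 \<Longrightarrow> euler m oo fps_X ^ k = euler (k * m)"
  unfolding euler_def by (subst qpoch_inf_compose) (auto simp: fps_compose_power power_mult fps_X_power_compose)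

text \<open>The left product runs over exponents prime to 6; inclusion-exclusion over the divisors 2
  and 3 expresses it through Euler products.\<close>

lemma qpoch_inf_euler_6:
  "qpoch_inf fps_X (fps_X ^ 6) * qpoch_inf (fps_X ^ 5) (fps_X ^ 6) * (euler 2 * euler 3) = euler 1 * euler 6"
proof -
  have "euler 1 = (\<Prod>i<6. qpoch_inf (fps_X ^ 1 * (fps_X ^ 1) ^ i) ((fps_X ^ 1) ^ 6))"
    unfolding euler_def by (rule qpoch_inf_split) simp_all
  moreover have "euler 2 = (\<Prod>i<3. qpoch_inf (fps_X ^ 2 * (fps_X ^ 2) ^ i) ((fps_X ^ 2) ^ 3))"
    unfolding euler_def by (rule qpoch_inf_split) simp_all
  moreover have "euler 3 = (\<Prod>i<2. qpoch_inf (fps_X ^ 3 * (fps_X ^ 3) ^ i) ((fps_X ^ 3) ^ 2))"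
    unfolding euler_def by (rule qpoch_inf_split) simp_all
  ultimately show ?thesis
    by (simp add: euler_def eval_nat_numeral lessThan_Suc mult_ac flip: power_mult)
qed

lemma xi_term_Suc: "xi_term (Suc n) = fps_X * ((fps_X ^ 6) ^ (n * (n + 1)) *
  fps_recip (qpochhammer fps_X (fps_X ^ 6) (Suc n) * qpochhammer (fps_X ^ 5) (fps_X ^ 6) (Suc n)))"
proof -
  have "6 * Suc n ^ 2 - 6 * Suc n + 1 = Suc (6 * (n * (n + 1)))"
    by (simp add: power2_eq_square algebra_simps)
  then show ?thesis
    by (simp only: xi_term_def xi_denom_def fps_recip_def power_Suc power_mult mult.assoc)
qed

lemma appell_term_xi:
  defines "b \<equiv> \<lambda>j. fps_recip (1 - fps_X ^ (6 * j + 1)) + fps_recip (1 - fps_X ^ (6 * j + 5)) - 1"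
  shows "appell_term fps_X (fps_X ^ 5) (fps_X ^ 6) j = (- 1) ^ j * fps_X ^ (3 * (j * (j + 1))) * (b j :: int fps)"
proof -
  define x y :: "int fps" where "x = fps_X ^ (6 * j + 1)" and "y = fps_X ^ (6 * j + 5)"
  have xy: "(1 - x) $ 0 = 1" "(1 - y) $ 0 = 1" by (simp_all add: x_def y_def)
  have "b j * ((1 - x) * (1 - y)) =
      ((1 - x) * fps_recip (1 - x)) * (1 - y) + ((1 - y) * fps_recip (1 - y)) * (1 - x) - (1 - x) * (1 - y)"
    by (simp add: b_def x_def y_def algebra_simps)
  also have "\<dots> = 1 - x * y"
    unfolding fps_recip[OF xy(1)] fps_recip[OF xy(2)] by (simp add: algebra_simps)
  finally have bxy: "b j * ((1 - x) * (1 - y)) = 1 - x * y" .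
  have "(1 - x * y) * fps_recip ((1 - x) * (1 - y)) = b j * ((1 - x) * (1 - y) * fps_recip ((1 - x) * (1 - y)))"
    unfolding bxy[symmetric] by (simp only: mult.assoc)
  also have "\<dots> = b j" by (subst fps_recip) (use xy in simp_all)
  finally have 1: "(1 - x * y) * fps_recip ((1 - x) * (1 - y)) = b j" .
  have 2: "theta_denom fps_X (fps_X ^ 5) (fps_X ^ 6) j = (1 - x) * (1 - y)"
    by (simp add: theta_denom_def x_def y_def power_add flip: power_mult)
  have 3: "(fps_X ^ 6) ^ (2 * j + 1) = x * y"
    unfolding x_def y_def power_mult[symmetric] power_add[symmetric]
    by (rule arg_cong[of _ _ "\<lambda>n. fps_X ^ n"]) simp
  have "6 * (j * (j + 1) div 2) = 3 * (j * (j + 1))"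
  proof -
    have "2 * (j * (j + 1) div 2) = j * (j + 1)" by (rule dvd_mult_div_cancel) simp
    then show ?thesis by linarith
  qed
  then show ?thesis unfolding appell_term_def 2 3 1 by (simp add: mult.assoc flip: power_mult)
qed

lemma fps_third_appell_term:
  fixes j :: nat
  defines "t \<equiv> appell_term fps_X (fps_X ^ 5) (fps_X ^ 6) j :: int fps"
  shows "fps_third (t * ((fps_X ^ 6) ^ (j * (j + 1)) * fps_recip (euler 6))) = t * fps_recip (euler 2)"
proof -
  define b :: "int fps" where "b = fps_recip (1 - fps_X ^ (6 * j + 1)) + fps_recip (1 - fps_X ^ (6 * j + 5)) - 1"
  have cop: "coprime (6 * j + 1) (3::nat)" "coprime (6 * j + 5) (3::nat)"
  proof -
    have *: "coprime m 3" if "\<not> 3 dvd m" for m :: nat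
      using prime_imp_coprime[of 3 m] that by (simp add: coprime_commute)
    show "coprime (6 * j + 1) (3::nat)" by (rule *) presburger
    show "coprime (6 * j + 5) (3::nat)" by (rule *) presburger
  qed
  have b3: "fps_third b = b"
  proof -
    have "fps_third b = fps_third (fps_recip (1 - fps_X ^ (6 * j + 1))) +
        fps_third (fps_recip (1 - fps_X ^ (6 * j + 5))) - 1"
      by (simp add: b_def fps_eq_iff)
    also have "fps_third (fps_recip (1 - fps_X ^ (6 * j + 1))) = (fps_recip (1 - fps_X ^ (6 * j + 1)) :: int fps)"
      by (rule fps_third_recip[OF _ cop(1)]) simp
    also have "fps_third (fps_recip (1 - fps_X ^ (6 * j + 5))) = (fps_recip (1 - fps_X ^ (6 * j + 5)) :: int fps)"
      by (rule fps_third_recip[OF _ cop(2)]) simp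
    finally show ?thesis unfolding b_def .
  qed
  have t: "t = (- 1) ^ j * fps_X ^ (3 * (j * (j + 1))) * b"
    unfolding t_def b_def by (rule appell_term_xi)
  have r: "fps_recip (euler 6) = fps_recip (euler 2) oo fps_X ^ 3"
    using fps_recip_compose[of "euler 2" 3] euler_compose[of 3 2] by (simp add: euler_nth_0)
  \<comment> \<open>Chosen so that \<open>c\<close> at q^3 gathers everything that is a series in
    q^3: the sign, 1/f_6, and the exponent 9j(j+1), of which 3j(j+1) comes from \<open>t\<close> and
    6j(j+1) from the weight.\<close>
  define c :: "int fps" where "c = (- 1) ^ j * fps_X ^ (3 * (j * (j + 1))) * fps_recip (euler 2)"
  have c3: "c oo fps_X ^ 3 = (- 1) ^ j * fps_X ^ (9 * (j * (j + 1))) * fps_recip (euler 6)"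
    unfolding c_def r by (cases "even j") (simp_all add: fps_compose_mult_distrib fps_compose_uminus
        fps_X_power_compose flip: power_mult)
  have X9: "fps_X ^ (9 * (j * (j + 1))) = (fps_X ^ (3 * (j * (j + 1))) * (fps_X ^ 6) ^ (j * (j + 1)) :: int fps)"
    by (simp flip: power_mult power_add)
  have "t * ((fps_X ^ 6) ^ (j * (j + 1)) * fps_recip (euler 6)) = (c oo fps_X ^ 3) * b"
    unfolding t c3 X9 by (simp only: mult_ac)
  then have "fps_third (t * ((fps_X ^ 6) ^ (j * (j + 1)) * fps_recip (euler 6))) = c * b"
    by (simp only: fps_third_mult b3)
  then show ?thesis
    unfolding t c_def by (simp only: mult_ac)
qed

lemma p_xi_3n_plus_1:
  obtains a where "euler 1 * a = euler 3 * euler 6" "\<And>n. p_xi (3 * n + 1) = 2 * a $ n"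
proof -
  define h :: "nat \<Rightarrow> int fps" where "h n = (fps_X ^ 6) ^ (n * (n + 1)) *
    fps_recip (qpochhammer fps_X (fps_X ^ 6) (Suc n) * qpochhammer (fps_X ^ 5) (fps_X ^ 6) (Suc n))" for n
  define t :: "nat \<Rightarrow> int fps" where "t = appell_term fps_X (fps_X ^ 5) (fps_X ^ 6)"
  define g where "g = (\<Sum>j. t j * ((fps_X ^ 6) ^ (j * (j + 1)) * fps_recip (euler 6)))"
  have X6: "fps_X * fps_X ^ 5 = (fps_X ^ 6 :: int fps)" by (simp flip: power_Suc)
  have h: "h sums g"
    unfolding h_def g_def t_def euler_def using universal_mock_theta_sums[OF X6] by simp
  have "(\<lambda>n. xi_term (Suc n)) sums (fps_X * g)"
    using fps_sums_mult[OF h, of fps_X] unfolding xi_term_Suc h_def .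
  then have xi: "xi = 1 + 2 * (fps_X * g)"
    unfolding xi_def by (simp add: sums_iff)
  \<comment> \<open>The factor \<open>fps_X\<close> in front of \<open>g\<close> moves the exponents
    1 modulo 3 to the multiples of three.\<close>
  have p: "p_xi (3 * n + 1) = 2 * fps_third g $ n" for n
    by (simp add: p_xi_def xi numeral_fps_const)
  have t0: "t j $ k = 0" if "k < j" for j k
    unfolding t_def using that by (intro appell_term_nth_eq_0) simp_all
  have "(\<lambda>j. t j * ((fps_X ^ 6) ^ (j * (j + 1)) * fps_recip (euler 6))) sums g"
    unfolding g_def using t0 by (intro sums_fps_null) (simp add: fps_mult_nth)
  from fps_third_sums[OF this] have "(\<lambda>j. fps_recip (euler 2) * t j) sums fps_third g"
    unfolding t_def fps_third_appell_term by (simp only: mult.commute)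
  moreover have T: "t sums suminf t" by (rule sums_fps_null[OF t0])
  ultimately have third: "fps_third g = fps_recip (euler 2) * suminf t"
    using fps_sums_mult[OF T, of "fps_recip (euler 2)"] sums_unique2 by metis
  have "(\<Sum>j. t j * (fps_recip (euler 6) * fps_recip (euler 6))) = fps_recip (euler 6) * fps_recip (euler 6) * suminf t"
    using fps_sums_mult[OF T, of "fps_recip (euler 6) * fps_recip (euler 6)"] by (simp add: sums_iff mult_ac)
  with partial_fractions[OF X6, folded euler_def] have pf: "fps_recip (euler 6) * fps_recip (euler 6) * suminf t *
      (qpoch_inf fps_X (fps_X ^ 6) * qpoch_inf (fps_X ^ 5) (fps_X ^ 6)) = 1"
    by (simp add: t_def)
  have r2: "euler 2 * fps_recip (euler 2) = 1" and r6: "euler 6 * fps_recip (euler 6) = 1"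
    by (simp_all add: fps_recip euler_nth_0)
  define p15 :: "int fps" where "p15 = qpoch_inf fps_X (fps_X ^ 6) * qpoch_inf (fps_X ^ 5) (fps_X ^ 6)"
  \<comment> \<open>The partial fractions give \<open>suminf t\<close> as f_6^2 /
    \<open>p15\<close>, and \<open>p15\<close> is f_1 f_6 / (f_2 f_3). The extra
    \<open>euler 6\<close> keeps the computation free of division and is cancelled at the
    end.\<close>
  have "euler 6 * (euler 1 * fps_third g) = fps_recip (euler 2) * suminf t * (euler 1 * euler 6)"
    unfolding third by (simp only: mult_ac)
  also have "\<dots> = (euler 2 * fps_recip (euler 2)) * (suminf t * p15) * euler 3"
    unfolding qpoch_inf_euler_6[symmetric] p15_def by (simp only: mult_ac)
  also have "\<dots> = (euler 6 * fps_recip (euler 6)) * (euler 6 * fps_recip (euler 6)) * (suminf t * p15) * euler 3"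
    unfolding r2 r6 by simp
  also have "\<dots> = euler 6 * euler 6 * euler 3 * (fps_recip (euler 6) * fps_recip (euler 6) * suminf t * p15)"
    by (simp only: mult_ac)
  also have "\<dots> = euler 6 * (euler 3 * euler 6)"
    using pf unfolding p15_def by (simp add: mult_ac)
  finally have "euler 1 * fps_third g = euler 3 * euler 6"
    using euler_nth_0[of 6] by auto
  with p show ?thesis using that by blast
qed

section \<open>Theta series and the Jacobi triple product\<close>

text \<open>The series of all w_i q^(e_i). Integer exponents let quadratic identities be checked
  without truncated subtraction; the free index type lets products become sums over pairs that
  bijections can re-index.\<close>

definition expsum :: "('i \<Rightarrow> int) \<Rightarrow> ('i \<Rightarrow> int) \<Rightarrow> int fps" where
  "expsum w e = Abs_fps (\<lambda>N. \<Sum>i | e i = int N. w i)"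

text \<open>Guarantees that every coefficient of \<open>expsum\<close> is a genuine finite sum; an
  infinite fibre would silently count as zero.\<close>

definition proper :: "('i \<Rightarrow> int) \<Rightarrow> bool" where
  "proper e \<longleftrightarrow> (\<forall>i. 0 \<le> e i) \<and> (\<forall>N. finite {i. e i = int N})"

lemma properI_int:
  fixes e :: "int \<Rightarrow> int"
  assumes "\<And>i. \<bar>i\<bar> \<le> e i"
  shows "proper e"
  unfolding proper_def
proof (intro allI conjI)
  fix i show "0 \<le> e i" using assms[of i] by linarith
next
  fix N
  have "{i. e i = int N} \<subseteq> {- int N..int N}" using assms by (auto simp: abs_le_iff) (smt (verit))+
  then show "finite {i. e i = int N}" by (rule finite_subset) simp
qed

lemma expsum_cong: "(\<And>i. w i = w' i) \<Longrightarrow> (\<And>i. e i = e' i) \<Longrightarrow> expsum w e = expsum w' e'"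
  by (metis ext)

lemma proper_pair:
  assumes "proper e" "proper e'"
  shows "proper (\<lambda>(i, j). e i + e' j)"
  unfolding proper_def
proof (intro allI conjI)
  fix N
  have "{ij. (case ij of (i, j) \<Rightarrow> e i + e' j) = int N} \<subseteq>
      (\<Union>k\<in>{..N}. {i. e i = int k}) \<times> (\<Union>k\<in>{..N}. {j. e' j = int k})"
  proof safe
    fix i j assume *: "e i + e' j = int N"
    have nn: "0 \<le> e i" "0 \<le> e' j" using assms by (auto simp: proper_def)
    show "i \<in> (\<Union>k\<in>{..N}. {i. e i = int k})"
      using * nn by (intro UN_I[of "nat (e i)"]) auto
    show "j \<in> (\<Union>k\<in>{..N}. {j. e' j = int k})"
      using * nn by (intro UN_I[of "nat (e' j)"]) auto
  qed
  moreover have "finite \<dots>" using assms by (auto simp: proper_def)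
  ultimately show "finite {ij. (case ij of (i, j) \<Rightarrow> e i + e' j) = int N}" by (rule finite_subset)
qed (use assms in \<open>auto simp: proper_def\<close>)

lemma expsum_mult:
  assumes "proper e" "proper e'"
  shows "expsum w e * expsum w' e' = expsum (\<lambda>(i, j). w i * w' j) (\<lambda>(i, j). e i + e' j)"
proof (rule fps_ext)
  fix N
  have fin: "finite {i. e i = int k}" "finite {i. e' i = int k}" for k
    using assms by (auto simp: proper_def)
  have "(expsum w e * expsum w' e') $ N =
      (\<Sum>k=0..N. \<Sum>(i, j)\<in>{i. e i = int k} \<times> {j. e' j = int (N - k)}. w i * w' j)"
    by (simp add: expsum_def fps_mult_nth sum_product sum.cartesian_product)
  also have "\<dots> = (\<Sum>(i, j)\<in>(\<Union>k\<in>{0..N}. {i. e i = int k} \<times> {j. e' j = int (N - k)}). w i * w' j)"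
    by (subst sum.UNION_disjoint) (auto intro!: finite_cartesian_product fin simp del: of_nat_diff)
  also have "(\<Union>k\<in>{0..N}. {i. e i = int k} \<times> {j. e' j = int (N - k)}) =
      {ij. (case ij of (i, j) \<Rightarrow> e i + e' j) = int N}"
  proof safe
    fix i j assume *: "e i + e' j = int N"
    have nn: "0 \<le> e i" "0 \<le> e' j" using assms by (auto simp: proper_def)
    show "(i, j) \<in> (\<Union>k\<in>{0..N}. {i. e i = int k} \<times> {j. e' j = int (N - k)})"
      using * nn by (intro UN_I[of "nat (e i)"]) (auto simp: of_nat_diff nat_le_iff)
  qed (auto simp: of_nat_diff)
  finally show "(expsum w e * expsum w' e') $ N =
      expsum (\<lambda>(i, j). w i * w' j) (\<lambda>(i, j). e i + e' j) $ N"
    by (simp add: expsum_def case_prod_unfold)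
qed

lemma expsum_split:
  assumes "proper e" "bij_betw f UNIV {i. P i}" "bij_betw g UNIV {i. \<not> P i}"
  shows "expsum w e = expsum (w \<circ> f) (e \<circ> f) + expsum (w \<circ> g) (e \<circ> g)"
proof (rule fps_ext)
  fix N
  have fin: "finite {i. e i = int N}" using assms by (auto simp: proper_def)
  have "(\<Sum>i | e i = int N. w i) =
      (\<Sum>i\<in>{i. P i} \<inter> {i. e i = int N}. w i) + (\<Sum>i\<in>{i. \<not> P i} \<inter> {i. e i = int N}. w i)"
    using fin by (subst sum.union_disjoint[symmetric]) (auto intro!: sum.cong)
  also have "(\<Sum>i\<in>{i. P i} \<inter> {i. e i = int N}. w i) = (\<Sum>i | e (f i) = int N. w (f i))"
    using assms(2) by (intro sum.reindex_bij_betw[symmetric]) (auto simp: bij_betw_def inj_on_def)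
  also have "(\<Sum>i\<in>{i. \<not> P i} \<inter> {i. e i = int N}. w i) = (\<Sum>i | e (g i) = int N. w (g i))"
    using assms(3) by (intro sum.reindex_bij_betw[symmetric]) (auto simp: bij_betw_def inj_on_def)
  finally show "expsum w e $ N = (expsum (w \<circ> f) (e \<circ> f) + expsum (w \<circ> g) (e \<circ> g)) $ N"
    by (simp add: expsum_def)
qed

lemma expsum_compose:
  assumes "k > 0" "\<And>i. 0 \<le> e i"
  shows "expsum w e oo fps_X ^ k = expsum w (\<lambda>i. int k * e i)"
proof (rule fps_ext)
  fix N
  show "(expsum w e oo fps_X ^ k) $ N = expsum w (\<lambda>i. int k * e i) $ N"
  proof (cases "k dvd N")
    case True
    then obtain n where "N = k * n" by blast
    then show ?thesis using assms by (simp add: fps_nth_compose_X_power expsum_def)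
  next
    case False
    have "{i. int k * e i = int N} = {}"
    proof safe
      fix i assume "int k * e i = int N"
      then have "int k dvd int N" by (metis dvd_triv_left)
      then show "i \<in> {}" using False by simp
    qed
    then show ?thesis using False by (simp add: fps_nth_compose_X_power expsum_def)
  qed
qed

lemma expsum_shift:
  assumes "\<And>i. 0 \<le> e i"
  shows "fps_X ^ c * expsum w e = expsum w (\<lambda>i. e i + int c)"
proof (rule fps_ext)
  fix N
  have "e i + int c = int N \<longleftrightarrow> c \<le> N \<and> e i = int (N - c)" for i
    using assms[of i] by (auto simp: of_nat_diff)
  then show "(fps_X ^ c * expsum w e) $ N = expsum w (\<lambda>i. e i + int c) $ N"
    by (auto simp: expsum_def fps_X_power_mult_nth intro!: sum.cong)
qed

lemma expsum_uminus: "expsum (\<lambda>i. - w i) e = - expsum w e"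
  by (rule fps_ext) (simp add: expsum_def sum_negf)

text \<open>The limit of the finite triple product. Asking only that each signed term be a monomial
  covers alternating series, with x = q^a, and positive ones, with x = -q^a.\<close>

lemma jacobi_triple_product_aux:
  fixes x y Q :: "int fps"
  assumes Q: "x * y = Q" "Q $ 0 = 0" and e: "proper e"
    and c: "\<And>j. alt_sign j * theta_term x y j = fps_const (w j) * fps_X ^ nat (e j)"
  shows "expsum w e = qpoch_inf x Q * qpoch_inf y Q * qpoch_inf Q Q"
proof -
  define c where "c j = alt_sign j * theta_term x y j" for j
  define q where "q = qpochhammer Q Q"
  define u where "u n j = recip_qfact Q (int n - j) * recip_qfact Q (int n + j)" for n j
  have e0: "0 \<le> e j" for j using e by (auto simp: proper_def)
  have c_nth: "c j $ k = (if e j = int k then w j else 0)" for j k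
    using e0[of j] by (auto simp: c_def assms(4))
  define S where "S N = (\<Union>k\<in>{..N}. {j. e j = int k})" for N
  \<comment> \<open>The square of (Q; Q)_n normalises the coefficients: for fixed \<open>j\<close>
    the kernel then tends to 1.\<close>
  have lim: "(\<lambda>n. \<Sum>j\<in>{- int n - 1..int n}. c j * (u n j * (q n * q n))) \<longlonglongrightarrow>
      Abs_fps (\<lambda>N. \<Sum>j\<in>S N. (c j * 1) $ N)"
  proof (rule tendsto_fps_tannery)
    show "finite (S N)" for N using e by (auto simp: S_def proper_def)
    show "c j $ k = 0" if "k \<le> N" "j \<notin> S N" for N j k
      using that by (auto simp: c_nth S_def)
    show "\<forall>\<^sub>F n in sequentially. j \<in> {- int n - 1..int n}" for j
      unfolding eventually_sequentially by (intro exI[of _ "nat \<bar>j\<bar>"]) auto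
    show "(\<lambda>n. u n j * (q n * q n)) \<longlonglongrightarrow> 1" for j
    proof (rule LIMSEQ_offset[of _ "nat \<bar>j\<bar>"])
      define k l where "k = nat (\<bar>j\<bar> - j)" and "l = nat (\<bar>j\<bar> + j)"
      have kl: "int (n + nat \<bar>j\<bar>) - j = int (n + k)" "int (n + nat \<bar>j\<bar>) + j = int (n + l)" for n
        by (simp_all add: k_def l_def)
      have r: "(\<lambda>n. recip_qfact Q (int (n + k))) \<longlonglongrightarrow> fps_recip (qpoch_inf Q Q)" for k
        by (rule LIMSEQ_ignore_initial_segment[OF recip_qfact_tendsto[OF Q(2)]])
      have q: "(\<lambda>n. q (n + m)) \<longlonglongrightarrow> qpoch_inf Q Q" for m
        unfolding q_def by (rule LIMSEQ_ignore_initial_segment[OF qpochhammer_tendsto[OF Q(2)]])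
      have "(\<lambda>n. u (n + nat \<bar>j\<bar>) j * (q (n + nat \<bar>j\<bar>) * q (n + nat \<bar>j\<bar>))) \<longlonglongrightarrow>
          fps_recip (qpoch_inf Q Q) * fps_recip (qpoch_inf Q Q) * (qpoch_inf Q Q * qpoch_inf Q Q)"
        unfolding u_def kl by (intro tendsto_mult r q)
      also have "fps_recip (qpoch_inf Q Q) * fps_recip (qpoch_inf Q Q) * (qpoch_inf Q Q * qpoch_inf Q Q) =
          (qpoch_inf Q Q * fps_recip (qpoch_inf Q Q)) * (qpoch_inf Q Q * fps_recip (qpoch_inf Q Q))"
        by (simp only: mult_ac)
      also have "\<dots> = 1" by (simp add: fps_recip qpoch_inf_nth_0 Q)
      finally show "(\<lambda>n. u (n + nat \<bar>j\<bar>) j * (q (n + nat \<bar>j\<bar>) * q (n + nat \<bar>j\<bar>))) \<longlonglongrightarrow> 1" .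
    qed
  qed simp
  have "Abs_fps (\<lambda>N. \<Sum>j\<in>S N. (c j * 1) $ N) = expsum w e"
  proof (rule fps_ext)
    fix N
    have "(\<Sum>j\<in>S N. if e j = int N then w j else 0) = (\<Sum>j | e j = int N. w j)"
      using e by (intro sum.mono_neutral_cong_right) (auto simp: S_def proper_def)
    then show "Abs_fps (\<lambda>N. \<Sum>j\<in>S N. (c j * 1) $ N) $ N = expsum w e $ N"
      by (simp add: expsum_def c_nth)
  qed
  with lim have 1: "(\<lambda>n. \<Sum>j\<in>{- int n - 1..int n}. c j * (u n j * (q n * q n))) \<longlonglongrightarrow> expsum w e"
    by simp
  have q2: "(\<lambda>n. q (n * 2)) \<longlonglongrightarrow> qpoch_inf Q Q"
    using LIMSEQ_subseq_LIMSEQ[OF qpochhammer_tendsto[OF Q(2), of Q], of "\<lambda>n. n * 2"]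
    by (simp add: q_def o_def strict_mono_def)
  have eq: "q (n * 2) * (\<Sum>j\<in>{- int n - 1..int n}. c j * (u n j * (q n * q n))) =
      qpochhammer x Q n * qpochhammer y Q n * q n * q n" for n
  proof -
    have "q (n * 2) * (\<Sum>j\<in>{- int n - 1..int n}. c j * (u n j * (q n * q n))) =
        (qpochhammer Q Q (2 * n) * (\<Sum>j\<in>{- int n - 1..int n}. c j * u n j)) * (q n * q n)"
      by (simp add: q_def mult.commute[of n 2] mult.assoc sum_distrib_left sum_distrib_right)
    also have "\<dots> = (qpochhammer x Q n * qpochhammer y Q n) * (q n * q n)"
      using finite_triple_product[OF Q, of n n] by (simp add: c_def u_def)
    finally show ?thesis by (simp only: mult.assoc)
  qed
  have "(\<lambda>n. qpochhammer x Q n * qpochhammer y Q n * q n * q n) \<longlonglongrightarrow>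
      qpoch_inf x Q * qpoch_inf y Q * qpoch_inf Q Q * qpoch_inf Q Q"
    unfolding q_def by (intro tendsto_mult qpochhammer_tendsto Q)
  from LIMSEQ_unique[OF tendsto_mult[OF q2 1, unfolded eq] this]
  have "qpoch_inf Q Q * expsum w e = qpoch_inf Q Q * (qpoch_inf x Q * qpoch_inf y Q * qpoch_inf Q Q)"
    by (simp only: mult_ac)
  moreover have "qpoch_inf Q Q \<noteq> 0"
    using qpoch_inf_nth_0[OF Q(2), of Q] by auto
  ultimately show ?thesis by simp
qed

lemma theta_exponent:
  assumes "a > 0" "b > 0" "\<And>j. e j = int a * triangular j + int b * triangular (- j)"
  shows "proper e"
proof (rule properI_int)
  fix j :: int
  have "triangular j + triangular (- j) = j * j"
    using triangular[of j] triangular[of "- j"] by (simp add: algebra_simps)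
  moreover have "\<bar>j\<bar> \<le> j * j"
    using mult_right_mono[of 1 "\<bar>j\<bar>" "\<bar>j\<bar>"] by (cases "j = 0") auto
  moreover have "triangular j \<le> int a * triangular j" "triangular (- j) \<le> int b * triangular (- j)"
    using mult_right_mono[of 1 "int a" "triangular j"] mult_right_mono[of 1 "int b" "triangular (- j)"] assms(1,2)
    by simp_all
  ultimately show "\<bar>j\<bar> \<le> e j" using assms(3)[of j] by linarith
qed

lemma theta_term_X:
  "theta_term (fps_X ^ a) (fps_X ^ b) j =
    (fps_X ^ nat (int a * triangular j + int b * triangular (- j)) :: 'a::comm_ring_1 fps)"
  by (simp add: theta_term_def nat_add_distrib nat_mult_distrib power_add power_mult)

lemma jacobi_triple_product_alt:
  assumes "a > 0" "b > 0" "\<And>j. e j = int a * triangular j + int b * triangular (- j)" "m = a + b"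
  shows "expsum alt_sign e =
    qpoch_inf (fps_X ^ a) (fps_X ^ m) * qpoch_inf (fps_X ^ b) (fps_X ^ m) * euler m"
  unfolding euler_def
proof (rule jacobi_triple_product_aux)
  show "proper e" by (rule theta_exponent[OF assms(1-3)])
  show "alt_sign j * theta_term (fps_X ^ a) (fps_X ^ b) j = fps_const (alt_sign j) * fps_X ^ nat (e j)" for j
    by (simp add: theta_term_X assms(3) alt_sign_def)
qed (use assms in \<open>simp_all add: power_add\<close>)

lemma jacobi_triple_product:
  assumes "a > 0" "b > 0" "\<And>j. e j = int a * triangular j + int b * triangular (- j)" "m = a + b"
  shows "expsum (\<lambda>_. 1) e =
    qpoch_inf (- (fps_X ^ a)) (fps_X ^ m) * qpoch_inf (- (fps_X ^ b)) (fps_X ^ m) * euler m"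
  unfolding euler_def
proof (rule jacobi_triple_product_aux)
  show "proper e" by (rule theta_exponent[OF assms(1-3)])
  show "alt_sign j * theta_term (- (fps_X ^ a)) (- (fps_X ^ b) :: int fps) j = fps_const 1 * fps_X ^ nat (e j)" for j
  proof -
    have "theta_term (- (fps_X ^ a)) (- (fps_X ^ b) :: int fps) j =
        (- 1) ^ (nat (triangular j) + nat (triangular (- j))) * theta_term (fps_X ^ a) (fps_X ^ b :: int fps) j"
      unfolding theta_term_def power_minus[of "fps_X ^ a"] power_minus[of "fps_X ^ b"]
      by (simp add: power_add mult_ac)
    \<comment> \<open>The signs of both arguments contribute (-1)^(j^2), which cancels
      \<open>alt_sign j\<close>.\<close>
    moreover have "nat (triangular j) + nat (triangular (- j)) = nat (j * j)"
    proof -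
      have "triangular j + triangular (- j) = j * j"
        using triangular[of j] triangular[of "- j"] by (simp add: algebra_simps)
      then show ?thesis by (simp flip: nat_add_distrib)
    qed
    moreover have "even (nat (j * j)) \<longleftrightarrow> even j" by (simp add: even_nat_iff)
    ultimately show ?thesis
      by (auto simp: theta_term_X assms(3) alt_sign_def)
  qed
qed (use assms in \<open>simp_all add: power_add\<close>)

text \<open>In Ramanujan's notation these are \<open>\<phi>(q)\<close>, \<open>\<psi>(q)\<close>, \<open>f(q, q\<^sup>5)\<close>, \<open>f(q, q\<^sup>2)\<close> and, for the
  alternating versions, \<open>\<phi>(-q)\<close>, \<open>\<psi>(-q)\<close>, \<open>f(-q, -q\<^sup>5)\<close>.\<close>
definition ramphi :: "int fps" where "ramphi = expsum (\<lambda>_. 1) (\<lambda>n. n * n)"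
definition rampsi :: "int fps" where "rampsi = expsum (\<lambda>_. 1) (\<lambda>n. 2 * (n * n) + n)"
definition theta15 :: "int fps" where "theta15 = expsum (\<lambda>_. 1) (\<lambda>n. 3 * (n * n) + 2 * n)"
definition theta12 :: "int fps" where "theta12 = expsum (\<lambda>_. 1) (\<lambda>n. n * n + triangular n)"
definition ramphi_alt :: "int fps" where "ramphi_alt = expsum alt_sign (\<lambda>n. n * n)"
definition rampsi_alt :: "int fps" where "rampsi_alt = expsum alt_sign (\<lambda>n. 2 * (n * n) + n)"
definition theta15_alt :: "int fps" where "theta15_alt = expsum alt_sign (\<lambda>n. 3 * (n * n) + 2 * n)"

lemma theta_exponents:
  "n * n = int 1 * triangular n + int 1 * triangular (- n)"
  "2 * (n * n) + n = int 3 * triangular n + int 1 * triangular (- n)"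
  "3 * (n * n) + 2 * n = int 5 * triangular n + int 1 * triangular (- n)"
  "n * n + triangular n = int 2 * triangular n + int 1 * triangular (- n)"
  using triangular[of n] triangular[of "- n"] by (simp_all add: algebra_simps)

lemma proper_theta [simp]:
  "proper (\<lambda>n. n * n)" "proper (\<lambda>n. 2 * (n * n) + n)" "proper (\<lambda>n. 3 * (n * n) + 2 * n)"
  "proper (\<lambda>n. n * n + triangular n)"
  by (rule theta_exponent[OF _ _ theta_exponents(1)] theta_exponent[OF _ _ theta_exponents(2)]
      theta_exponent[OF _ _ theta_exponents(3)] theta_exponent[OF _ _ theta_exponents(4)]; simp)+

section \<open>Theta series as quotients of Euler products\<close>

abbreviation qpoch_plus :: "nat \<Rightarrow> nat \<Rightarrow> int fps" where
  "qpoch_plus a m \<equiv> qpoch_inf (- (fps_X ^ a)) (fps_X ^ m)"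

abbreviation qpoch_minus :: "nat \<Rightarrow> nat \<Rightarrow> int fps" where
  "qpoch_minus a m \<equiv> qpoch_inf (fps_X ^ a) (fps_X ^ m)"

lemma theta_products:
  "ramphi = qpoch_plus 1 2 * qpoch_plus 1 2 * euler 2"
  "rampsi = qpoch_plus 3 4 * qpoch_plus 1 4 * euler 4"
  "theta15 = qpoch_plus 5 6 * qpoch_plus 1 6 * euler 6"
  "theta12 = qpoch_plus 2 3 * qpoch_plus 1 3 * euler 3"
  "ramphi_alt = qpoch_minus 1 2 * qpoch_minus 1 2 * euler 2"
  "rampsi_alt = qpoch_minus 3 4 * qpoch_minus 1 4 * euler 4"
  "theta15_alt = qpoch_minus 5 6 * qpoch_minus 1 6 * euler 6"
  "expsum alt_sign (\<lambda>n. n * n + triangular n) = qpoch_minus 2 3 * qpoch_minus 1 3 * euler 3"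
  unfolding ramphi_def rampsi_def theta15_def theta12_def ramphi_alt_def rampsi_alt_def theta15_alt_def
  using jacobi_triple_product[OF _ _ theta_exponents(1), of 2] jacobi_triple_product[OF _ _ theta_exponents(2), of 4]
    jacobi_triple_product[OF _ _ theta_exponents(3), of 6] jacobi_triple_product[OF _ _ theta_exponents(4), of 3]
    jacobi_triple_product_alt[OF _ _ theta_exponents(1), of 2] jacobi_triple_product_alt[OF _ _ theta_exponents(2), of 4]
    jacobi_triple_product_alt[OF _ _ theta_exponents(3), of 6] jacobi_triple_product_alt[OF _ _ theta_exponents(4), of 3]
  by (simp_all only: zero_less_one zero_less_numeral numeral_plus_one one_plus_numeral one_add_one add_num_simps simp_thms)

lemma qpoch_minus_split:
  assumes "m > 0" "k > 0"
  shows "qpoch_minus a m = (\<Prod>i<k. qpoch_minus (a + m * i) (m * k))"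
  using qpoch_inf_split[of "fps_X ^ m :: int fps" k "fps_X ^ a"] assms
  by (simp add: power_add power_mult)

lemma qpoch_plus_split:
  assumes "m > 0" "k > 0"
  shows "qpoch_plus a m = (\<Prod>i<k. qpoch_plus (a + m * i) (m * k))"
  using qpoch_inf_split[of "fps_X ^ m :: int fps" k "- (fps_X ^ a)"] assms
  by (simp add: power_add power_mult)

lemma qpoch_plus_minus:
  assumes "m > 0"
  shows "qpoch_minus a m * qpoch_plus a m = qpoch_minus (2 * a) (2 * m)"
  using qpoch_inf_minus[of "fps_X ^ m :: int fps" "fps_X ^ a"] assms
  by (simp add: power_mult[symmetric] mult.commute)

lemma euler_nonzero [simp]: "k > 0 \<Longrightarrow> euler k \<noteq> 0"
  using euler_nth_0[of k] by auto

lemma qpoch_minus_euler: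
  "euler 1 = qpoch_minus 1 2 * euler 2" "euler 2 = qpoch_minus 2 4 * euler 4"
  "euler 1 = qpoch_minus 1 3 * qpoch_minus 2 3 * euler 3"
  "qpoch_minus 1 6 * qpoch_minus 5 6 * (euler 2 * euler 3) = euler 1 * euler 6"
  "qpoch_minus 2 12 * qpoch_minus 10 12 * (euler 4 * euler 6) = euler 2 * euler 12"
  "qpoch_minus 1 2 = qpoch_minus 1 4 * qpoch_minus 3 4"
  "qpoch_plus 1 2 = qpoch_plus 1 4 * qpoch_plus 3 4"
  "qpoch_plus 1 1 = qpoch_plus 1 3 * qpoch_plus 2 3 * qpoch_plus 3 3"
proof -
  show 4: "qpoch_minus 1 6 * qpoch_minus 5 6 * (euler 2 * euler 3) = euler 1 * euler 6"
    using qpoch_inf_euler_6 by simp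
  have "(qpoch_minus 1 6 * qpoch_minus 5 6 * (euler 2 * euler 3)) oo fps_X ^ 2 = (euler 1 * euler 6) oo fps_X ^ 2"
    by (simp only: 4)
  then show "qpoch_minus 2 12 * qpoch_minus 10 12 * (euler 4 * euler 6) = euler 2 * euler 12"
    by (simp add: fps_compose_mult_distrib euler_compose qpoch_inf_compose fps_X_power_compose flip: power_mult)
qed (use qpoch_minus_split[of 1 2 1] qpoch_minus_split[of 2 2 2] qpoch_minus_split[of 1 3 1]
    qpoch_minus_split[of 2 2 1] qpoch_plus_split[of 2 2 1] qpoch_plus_split[of 1 3 1] in
    \<open>simp_all add: euler_def eval_nat_numeral lessThan_Suc mult_ac\<close>)

lemma
  shows ramphi_alt_euler: "euler 2 * ramphi_alt = euler 1 ^ 2"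
    and ramphi_euler: "euler 1 ^ 2 * euler 4 ^ 2 * ramphi = euler 2 ^ 5"
    and rampsi_euler: "euler 1 * rampsi = euler 2 ^ 2"
    and rampsi_alt_euler: "euler 2 * rampsi_alt = euler 1 * euler 4"
    and theta15_alt_euler: "euler 2 * euler 3 * theta15_alt = euler 1 * euler 6 ^ 2"
    and theta15_euler: "euler 1 * euler 4 * euler 6 * theta15 = euler 2 ^ 2 * euler 3 * euler 12"
    and theta12_euler: "euler 1 * euler 6 * theta12 = euler 2 * euler 3 ^ 2"
    and pentagonal: "expsum alt_sign (\<lambda>n. n * n + triangular n) = euler 1"
proof -
  note pm = qpoch_plus_minus[of 2 1, simplified] qpoch_plus_minus[of 6 1, simplified]
    qpoch_plus_minus[of 6 5, simplified] qpoch_plus_minus[of 1 1, simplified] qpoch_plus_minus[of 3 3, simplified]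
  \<comment> \<open>(-q; q^2)_infinity = f_2^2 / (f_1 f_4), common to phi(q) and psi(q).\<close>
  have *: "euler 1 * euler 4 * qpoch_plus 1 2 = euler 2 ^ 2"
  proof -
    have "euler 1 * euler 4 * qpoch_plus 1 2 = (qpoch_minus 1 2 * qpoch_plus 1 2) * euler 4 * euler 2"
      unfolding qpoch_minus_euler(1) by (simp only: mult_ac)
    also have "\<dots> = (qpoch_minus 2 4 * euler 4) * euler 2"
      by (simp add: pm)
    finally show ?thesis
      unfolding qpoch_minus_euler(2)[symmetric] by (simp add: power2_eq_square)
  qed
  show "euler 2 * ramphi_alt = euler 1 ^ 2"
    unfolding theta_products qpoch_minus_euler(1) by (simp add: power2_eq_square mult_ac)
  show "euler 1 ^ 2 * euler 4 ^ 2 * ramphi = euler 2 ^ 5"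
  proof -
    have "euler 1 ^ 2 * euler 4 ^ 2 * ramphi = (euler 1 * euler 4 * qpoch_plus 1 2) ^ 2 * euler 2"
      unfolding theta_products by (simp add: power2_eq_square mult_ac)
    then show ?thesis unfolding * by (simp add: eval_nat_numeral)
  qed
  show "euler 1 * rampsi = euler 2 ^ 2"
    using * unfolding theta_products qpoch_minus_euler(7) by (simp add: mult_ac)
  show "euler 2 * rampsi_alt = euler 1 * euler 4"
    unfolding theta_products qpoch_minus_euler(1,6) by (simp add: mult_ac)
  show "euler 2 * euler 3 * theta15_alt = euler 1 * euler 6 ^ 2"
    using arg_cong[OF qpoch_minus_euler(4), of "\<lambda>z. z * euler 6"]
    unfolding theta_products by (simp add: power2_eq_square mult_ac)
  show "euler 1 * euler 4 * euler 6 * theta15 = euler 2 ^ 2 * euler 3 * euler 12"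
  proof -
    have "euler 1 * euler 4 * euler 6 * theta15 = 
        (euler 1 * euler 6) * (qpoch_plus 1 6 * qpoch_plus 5 6) * (euler 4 * euler 6)"
      unfolding theta_products by (simp only: mult_ac)
    also have "\<dots> = (qpoch_minus 1 6 * qpoch_plus 1 6) * (qpoch_minus 5 6 * qpoch_plus 5 6) *
        (euler 4 * euler 6) * (euler 2 * euler 3)"
      unfolding qpoch_minus_euler(4)[symmetric] by (simp only: mult_ac)
    also have "\<dots> = (qpoch_minus 2 12 * qpoch_minus 10 12 * (euler 4 * euler 6)) * (euler 2 * euler 3)"
      by (simp add: pm)
    also have "\<dots> = euler 2 ^ 2 * euler 3 * euler 12"
      unfolding qpoch_minus_euler(5) by (simp add: power2_eq_square mult_ac)
    finally show ?thesis .
  qed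
  show "euler 1 * euler 6 * theta12 = euler 2 * euler 3 ^ 2"
  proof -
    have "euler 6 = euler 3 * qpoch_plus 3 3" "euler 2 = euler 1 * qpoch_plus 1 1"
      using pm(4,5) by (simp_all add: euler_def)
    then show ?thesis
      unfolding theta_products qpoch_minus_euler(8) by (simp add: power2_eq_square mult_ac)
  qed
  show "expsum alt_sign (\<lambda>n. n * n + triangular n) = euler 1"
    unfolding theta_products qpoch_minus_euler(3) by (simp only: mult_ac)
qed

section \<open>Parity splittings of theta series\<close>

definition dil :: "nat \<Rightarrow> int fps \<Rightarrow> int fps" where
  "dil k F = F oo fps_X ^ k"

lemma dil_simps [simp]:
  assumes "k > 0"
  shows "dil k (F + G) = dil k F + dil k G" "dil k (F - G) = dil k F - dil k G"
    "dil k (- F) = - dil k F" "dil k (F * G) = dil k F * dil k G" "dil k (F ^ n) = dil k F ^ n"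
    "dil k 1 = 1" "dil k 0 = 0" "dil k (numeral l) = numeral l" "dil k fps_X = fps_X ^ k"
    "m > 0 \<Longrightarrow> dil k (dil m F) = dil (k * m) F" "m > 0 \<Longrightarrow> dil k (euler m) = euler (k * m)"
  using assms
  by (simp_all add: dil_def fps_compose_add_distrib fps_compose_sub_distrib fps_compose_uminus
      fps_compose_mult_distrib fps_compose_power numeral_fps_const euler_compose
      fps_X_power_compose power_mult flip: fps_compose_assoc)

lemma dil_1 [simp]: "dil 1 F = F"
  by (simp add: dil_def)

lemma dil_nth: "dil k F $ n = (if k dvd n then F $ (n div k) else 0)"
  by (simp add: dil_def fps_nth_compose_X_power)

lemma proper_scale:
  assumes "proper e" "k > 0"
  shows "proper (\<lambda>i. int k * e i)"
  unfolding proper_def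
proof (intro allI conjI)
  fix N
  have "{i. int k * e i = int N} \<subseteq> {i. e i = int (N div k)}"
  proof
    fix i assume "i \<in> {i. int k * e i = int N}"
    then have "int N div int k = e i" using assms(2) by (metis mem_Collect_eq nonzero_mult_div_cancel_left of_nat_0_less_iff order_less_irrefl)
    then show "i \<in> {i. e i = int (N div k)}" by (simp add: zdiv_int)
  qed
  then show "finite {i. int k * e i = int N}"
    by (rule finite_subset) (use assms(1) in \<open>simp add: proper_def\<close>)
qed (use assms in \<open>auto simp: proper_def\<close>)

lemma expsum_const: "expsum (\<lambda>i. c * w i) e = fps_const c * expsum w e"
  by (rule fps_ext) (simp add: expsum_def sum_distrib_left)

lemma dil_expsum: "k > 0 \<Longrightarrow> proper e \<Longrightarrow> dil k (expsum w e) = expsum w (\<lambda>i. int k * e i)"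
  unfolding dil_def by (rule expsum_compose) (auto simp: proper_def)

lemma dil_expsum_mult:
  assumes "proper e" "proper e'" "a > 0" "b > 0"
  shows "dil a (expsum w e) * dil b (expsum w' e') =
    expsum (\<lambda>(i, j). w i * w' j) (\<lambda>(i, j). int a * e i + int b * e' j)"
  using assms by (simp add: dil_expsum expsum_mult proper_scale)

lemma X_dil_expsum_mult:
  assumes "proper e" "proper e'" "a > 0" "b > 0"
  shows "fps_X ^ c * (dil a (expsum w e) * dil b (expsum w' e')) =
    expsum (\<lambda>(i, j). w i * w' j) (\<lambda>(i, j). int a * e i + int b * e' j + int c)"
  unfolding dil_expsum_mult[OF assms]
  by (subst expsum_shift) (use assms in \<open>auto simp: proper_def intro!: expsum_cong\<close>)

lemma bij_even: "bij_betw (\<lambda>k. 2 * k) UNIV {n::int. even n}"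
  by (rule bij_betw_byWitness[where f' = "\<lambda>n. n div 2"]) auto

lemma bij_odd: "bij_betw (\<lambda>k. 2 * k + 1) UNIV {n::int. \<not> even n}"
  by (rule bij_betw_byWitness[where f' = "\<lambda>n. n div 2"]) auto

text \<open>The reflected parametrisation of the odd numbers. With it n(n+1)/2 and 3n^2 + 2n turn
  directly into 2k^2 + k and 4(3k^2 + 2k) + 1; \<open>2 * k + 1\<close> would need a further
  reflection of k.\<close>

lemma bij_odd_neg: "bij_betw (\<lambda>k. - 2 * k - 1) UNIV {n::int. \<not> even n}"
  by (rule bij_betw_byWitness[where f' = "\<lambda>n. (- n) div 2"]) (auto; presburger)+

lemma triangular_even: "triangular (2 * k) = 2 * (k * k) + k"
  and triangular_odd_neg: "triangular (- 2 * k - 1) = 2 * (k * k) + k"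
  using triangular[of "2 * k"] triangular[of "- 2 * k - 1"]
  by (simp_all add: algebra_simps)

lemma proper_triangular: "proper triangular"
  unfolding proper_def
proof (intro allI conjI)
  fix N
  have "{i. triangular i = int N} \<subseteq> {- 2 * int N - 1..2 * int N + 1}"
  proof
    fix i assume "i \<in> {i. triangular i = int N}"
    then have i: "i * (i + 1) = 2 * int N" using triangular[of i] by simp
    have "i \<le> 2 * int N"
      using i mult_left_mono[of 1 "i + 1" i] by (cases "i > 0") auto
    moreover have "- i - 1 \<le> 2 * int N"
      using i mult_left_mono[of 1 "- i" "- i - 1"] by (cases "i < - 1") (auto simp: algebra_simps)
    ultimately show "i \<in> {- 2 * int N - 1..2 * int N + 1}" by simp
  qed
  then show "finite {i. triangular i = int N}" by (rule finite_subset) simp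
qed simp

text \<open>n and -n-1 have the same triangular number, so even and odd indices each give one copy
  of psi(q). Sums over all triangular exponents are the shape in which 2 psi arises from
  splittings.\<close>

lemma two_rampsi: "2 * rampsi = expsum (\<lambda>_. 1) triangular"
proof -
  have "expsum (\<lambda>_. 1) triangular = rampsi + rampsi"
    unfolding rampsi_def
    by (subst expsum_split[OF proper_triangular bij_even bij_odd_neg])
      (intro arg_cong2[of _ _ _ _ "(+)"] expsum_cong; simp add: triangular_even triangular_odd_neg[simplified])
  then show ?thesis by simp
qed

lemma two_dil_rampsi: "k > 0 \<Longrightarrow> 2 * dil k rampsi = dil k (expsum (\<lambda>_. 1) triangular)"
  unfolding two_rampsi[symmetric] by simp

text \<open>The weight \<open>c\<close> on odd indices treats phi(q) and phi(-q) together, as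
  \<open>c = 1\<close> and \<open>c = - 1\<close>.\<close>

lemma ramphi_split_aux:
  "expsum (\<lambda>n. if even n then 1 else c) (\<lambda>n. n * n) =
    dil 4 ramphi + fps_const c * (fps_X * (2 * dil 8 rampsi))"
proof -
  have "2 * dil 8 rampsi = dil 8 (2 * rampsi)" by simp
  also have "\<dots> = expsum (\<lambda>_. 1) (\<lambda>k. 8 * triangular k)"
    unfolding two_rampsi by (simp add: dil_expsum proper_triangular)
  finally have 1: "fps_const c * (fps_X * (2 * dil 8 rampsi)) = expsum (\<lambda>_. c) (\<lambda>k. 8 * triangular k + 1)"
    using expsum_shift[of "\<lambda>k. 8 * triangular k" 1 "\<lambda>_::int. 1"] expsum_const[of c "\<lambda>_::int. 1"] by simp
  have 2: "dil 4 ramphi = expsum (\<lambda>_. 1) (\<lambda>k. 4 * (k * k))"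
    unfolding ramphi_def by (simp add: dil_expsum)
  show ?thesis unfolding 1 2
  proof (subst expsum_split[OF _ bij_even bij_odd], simp, intro arg_cong2[of _ _ _ _ "(+)"] expsum_cong)
    fix k :: int
    show "((\<lambda>n. n * n) \<circ> (\<lambda>k. 2 * k + 1)) k = 8 * triangular k + 1"
      using triangular[of k] by (simp add: algebra_simps)
  qed simp_all
qed

lemma alt_sign_eq: "alt_sign = (\<lambda>n. if even n then 1 else - 1)"
  by (simp add: alt_sign_def fun_eq_iff)

lemma ramphi_split: "ramphi = dil 4 ramphi + fps_X * (2 * dil 8 rampsi)"
  using ramphi_split_aux[of 1] by (simp add: ramphi_def[symmetric])

lemma ramphi_alt_split: "ramphi_alt = dil 4 ramphi - fps_X * (2 * dil 8 rampsi)"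
  unfolding ramphi_alt_def alt_sign_eq using ramphi_split_aux[of "- 1"]
  by (simp flip: fps_const_neg)

lemma theta15_split_aux:
  "expsum (\<lambda>n. if even n then 1 else c) (\<lambda>n. 3 * (n * n) + 2 * n) =
    dil 8 theta12 + fps_const c * (fps_X * dil 4 theta15)"
proof -
  have "dil 4 theta15 = expsum (\<lambda>_. 1) (\<lambda>k. 4 * (3 * (k * k) + 2 * k))"
    unfolding theta15_def by (simp add: dil_expsum)
  moreover have "0 \<le> 4 * (3 * (k * k) + 2 * k)" for k :: int
    using proper_theta(3) unfolding proper_def by (intro mult_nonneg_nonneg) auto
  ultimately have 1: "fps_const c * (fps_X * dil 4 theta15) = expsum (\<lambda>_. c) (\<lambda>k. 4 * (3 * (k * k) + 2 * k) + 1)"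
    using expsum_shift[of "\<lambda>k. 4 * (3 * (k * k) + 2 * k)" 1 "\<lambda>_::int. 1"] expsum_const[of c "\<lambda>_::int. 1"] by simp
  have 2: "dil 8 theta12 = expsum (\<lambda>_. 1) (\<lambda>k. 8 * (k * k + triangular k))"
    unfolding theta12_def by (simp add: dil_expsum)
  show ?thesis unfolding 1 2
  proof (subst expsum_split[OF _ bij_even bij_odd_neg], simp, intro arg_cong2[of _ _ _ _ "(+)"] expsum_cong)
    fix k :: int
    show "((\<lambda>n. 3 * (n * n) + 2 * n) \<circ> (\<lambda>k. 2 * k)) k = 8 * (k * k + triangular k)"
      using triangular[of k] by (simp add: algebra_simps)
    show "((\<lambda>n. 3 * (n * n) + 2 * n) \<circ> (\<lambda>k. - 2 * k - 1)) k = 4 * (3 * (k * k) + 2 * k) + 1"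
      by (simp add: algebra_simps)
  qed simp_all
qed

lemma theta15_split: "theta15 = dil 8 theta12 + fps_X * dil 4 theta15"
  using theta15_split_aux[of 1] by (simp add: theta15_def[symmetric])

lemma theta15_alt_split: "theta15_alt = dil 8 theta12 - fps_X * dil 4 theta15"
  unfolding theta15_alt_def alt_sign_eq using theta15_split_aux[of "- 1"]
  by (simp flip: fps_const_neg)

section \<open>Products of two theta series\<close>

lemma proper_psi_psi: "proper (\<lambda>(n, m). 2 * (n * n) + n + 3 * (2 * (m * m) + m))"
  using proper_pair[OF proper_theta(2) proper_scale[OF proper_theta(2), of 3]] by simp

text \<open>The bijections here and in \<open>rampsi_theta12_split\<close> come from multiplying \<open>x + y \<surd>-3\<close> by a sixth root
  of unity chosen so that both coordinates become even.\<close>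
lemma rampsi_rampsi_split_aux:
  "expsum (\<lambda>(n, m). if even (n + m) then 1 else c) (\<lambda>(n, m). 2 * (n * n) + n + 3 * (2 * (m * m) + m)) =
    dil 6 ramphi * dil 4 rampsi + fps_const c * (fps_X * (dil 12 rampsi * dil 2 ramphi))"
proof -
  define f :: "int \<times> int \<Rightarrow> int \<times> int" where "f = (\<lambda>(v, u).
    if even v then (u - 3 * (v div 2), u + v div 2) else (v div 2 - u - 2 * v, v div 2 - u))"
  define f' :: "int \<times> int \<Rightarrow> int \<times> int" where "f' = (\<lambda>(n, m). let v = (m - n) div 2 in
    (v, if even v then m - v div 2 else v div 2 - m))"
  define g :: "int \<times> int \<Rightarrow> int \<times> int" where "g = (\<lambda>(u, v).
    if even v then (v div 2 - 3 * u - 1, v div 2 + u) else (v div 2 + 3 * u + 1, v div 2 - u))"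
  define g' :: "int \<times> int \<Rightarrow> int \<times> int" where "g' = (\<lambda>(n, m). let v = (n + 3 * m + 1) div 2 in
    (if even v then (m - n - 1) div 4 else (n - m - 1) div 4, v))"
  have f_eq: "f (2 * l, u) = (u - 3 * l, l + u)" "f (2 * l + 1, u) = (- 3 * l - u - 2, l - u)"
    and f'_eq: "f' (n, n + 4 * l) = (2 * l, n + 3 * l)" "f' (n, n + 4 * l + 2) = (2 * l + 1, - n - 3 * l - 2)"
    and g_eq: "g (u, 2 * l) = ((l + u) - 4 * u - 1, l + u)" "g (u, 2 * l + 1) = ((l - u) + 4 * u + 1, l - u)"
    for l u n :: int
    by (simp_all add: f_def f'_def g_def)
  have g'_eq: "g' (m - 4 * u - 1, m) = (u, 2 * (m - u))" "g' (m + 4 * u + 1, m) = (u, 2 * (m + u) + 1)"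
    for u m :: int
  proof -
    have "(m - 4 * u - 1 + 3 * m + 1) div 2 = 2 * (m - u)" "(m + 4 * u + 1 + 3 * m + 1) div 2 = 2 * (m + u) + 1"
      "(m - (m - 4 * u - 1) - 1) div 4 = u" "(m + 4 * u + 1 - m - 1) div 4 = u" by simp_all
    then show "g' (m - 4 * u - 1, m) = (u, 2 * (m - u))" "g' (m + 4 * u + 1, m) = (u, 2 * (m + u) + 1)"
      by (simp_all only: g'_def Let_def prod.case) simp_all
  qed
  have parity: "\<exists>l. v = 2 * l \<or> v = 2 * l + 1" for v :: int by presburger
  have f: "bij_betw f UNIV {p. case p of (n, m) \<Rightarrow> even (n + m)}"
  proof (rule bij_betw_byWitness[where f' = f'])
    show "\<forall>p\<in>UNIV. f' (f p) = p"
    proof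
      fix p :: "int \<times> int"
      obtain v u where p: "p = (v, u)" by force
      obtain l where "v = 2 * l \<or> v = 2 * l + 1" using parity by blast
      then show "f' (f p) = p"
        using f'_eq(1)[of "u - 3 * l" l] f'_eq(2)[of "- 3 * l - u - 2" l] by (auto simp: p f_eq)
    qed
    show "range f \<subseteq> {p. case p of (n, m) \<Rightarrow> even (n + m)}"
      by (auto simp: f_def split: if_splits)
    show "\<forall>p\<in>{p. case p of (n, m) \<Rightarrow> even (n + m)}. f (f' p) = p"
    proof safe
      fix n m :: int assume "even (n + m)"
      then have "even (m - n)" by simp
      then obtain v where v: "m = n + 2 * v" by (metis add.commute diff_add_cancel evenE)
      obtain l where "v = 2 * l \<or> v = 2 * l + 1" using parity by blast
      then have "m = n + 4 * l \<or> m = n + 4 * l + 2" using v by auto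
      then show "f (f' (n, m)) = (n, m)" by (elim disjE) (simp_all only: f'_eq f_eq, simp_all)
    qed
  qed simp
  have g: "bij_betw g UNIV {p. \<not> (case p of (n, m) \<Rightarrow> even (n + m))}"
  proof (rule bij_betw_byWitness[where f' = g'])
    show "\<forall>p\<in>UNIV. g' (g p) = p"
    proof
      fix p :: "int \<times> int"
      obtain u v where p: "p = (u, v)" by force
      obtain l where "v = 2 * l \<or> v = 2 * l + 1" using parity by blast
      then show "g' (g p) = p"
        by (elim disjE) (simp_all only: p g_eq g'_eq, simp_all)
    qed
    show "range g \<subseteq> {p. \<not> (case p of (n, m) \<Rightarrow> even (n + m))}"
      by (auto simp: g_def split: if_splits)
    show "\<forall>p\<in>{p. \<not> (case p of (n, m) \<Rightarrow> even (n + m))}. g (g' p) = p"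
    proof safe
      fix n m :: int assume "odd (n + m)"
      then have "\<exists>u. m - n = 4 * u + 1 \<or> n - m = 4 * u + 1" by presburger
      then obtain u where "n = m - 4 * u - 1 \<or> n = m + 4 * u + 1" by (auto simp: algebra_simps)
      then show "g (g' (n, m)) = (n, m)" by (elim disjE) (simp_all only: g'_eq g_eq, simp_all)
    qed
  qed simp
  have 1: "dil 6 ramphi * dil 4 rampsi =
      expsum (\<lambda>(v, u). 1) (\<lambda>(v, u). 6 * (v * v) + 4 * (2 * (u * u) + u))"
    unfolding ramphi_def rampsi_def by (subst dil_expsum_mult) simp_all
  have "fps_X * (dil 12 rampsi * dil 2 ramphi) =
      expsum (\<lambda>(u, v). 1) (\<lambda>(u, v). 12 * (2 * (u * u) + u) + 2 * (v * v) + 1)"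
    unfolding ramphi_def rampsi_def
    by (subst X_dil_expsum_mult[where c = 1, simplified]) simp_all
  then have 2: "fps_const c * (fps_X * (dil 12 rampsi * dil 2 ramphi)) =
      expsum (\<lambda>(u, v). c) (\<lambda>(u, v). 12 * (2 * (u * u) + u) + 2 * (v * v) + 1)"
    using expsum_const[of c "\<lambda>_::int \<times> int. 1"] by (simp add: case_prod_unfold)
  show ?thesis unfolding 1 2
  proof (subst expsum_split[OF proper_psi_psi f g], intro arg_cong2[of _ _ _ _ "(+)"] expsum_cong)
    fix p :: "int \<times> int"
    obtain v u where p: "p = (v, u)" by force
    show "((\<lambda>(n, m). if even (n + m) then 1 else c) \<circ> f) p = (case p of (v, u) \<Rightarrow> 1)"
    proof -
      have "f p \<in> {p. case p of (n, m) \<Rightarrow> even (n + m)}" using f by (metis bij_betw_def rangeI)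
      then show ?thesis by (simp add: case_prod_unfold)
    qed
    show "((\<lambda>(n, m). if even (n + m) then 1 else c) \<circ> g) p = (case p of (v, u) \<Rightarrow> c)"
    proof -
      have "g p \<in> {p. \<not> (case p of (n, m) \<Rightarrow> even (n + m))}" using g by (metis bij_betw_def rangeI)
      then show ?thesis by (simp add: case_prod_unfold)
    qed
    show "((\<lambda>(n, m). 2 * (n * n) + n + 3 * (2 * (m * m) + m)) \<circ> f) p =
        (case p of (v, u) \<Rightarrow> 6 * (v * v) + 4 * (2 * (u * u) + u))"
      by (cases "even v") (auto simp: p f_def algebra_simps elim!: evenE oddE)
    show "((\<lambda>(n, m). 2 * (n * n) + n + 3 * (2 * (m * m) + m)) \<circ> g) p =
        (case p of (u, v) \<Rightarrow> 12 * (2 * (u * u) + u) + 2 * (v * v) + 1)"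
      by (cases "even u") (auto simp: p g_def algebra_simps elim!: evenE oddE)
  qed
qed

lemma rampsi_rampsi_split:
  "rampsi * dil 3 rampsi = dil 6 ramphi * dil 4 rampsi + fps_X * (dil 12 rampsi * dil 2 ramphi)"
proof -
  have "dil 1 rampsi * dil 3 rampsi =
      expsum (\<lambda>(n, m). 1) (\<lambda>(n, m). 2 * (n * n) + n + 3 * (2 * (m * m) + m))"
    unfolding rampsi_def by (subst dil_expsum_mult) simp_all
  then show ?thesis using rampsi_rampsi_split_aux[of 1] by (simp add: dil_1[unfolded One_nat_def])
qed

lemma rampsi_alt_rampsi_alt_split:
  "rampsi_alt * dil 3 rampsi_alt = dil 6 ramphi * dil 4 rampsi - fps_X * (dil 12 rampsi * dil 2 ramphi)"
proof -
  have "dil 1 rampsi_alt * dil 3 rampsi_alt = expsum (\<lambda>(n, m). if even (n + m) then 1 else - 1)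
      (\<lambda>(n, m). 2 * (n * n) + n + 3 * (2 * (m * m) + m))"
    unfolding rampsi_alt_def
    by (subst dil_expsum_mult) (auto simp: alt_sign_def intro!: expsum_cong)
  then show ?thesis using rampsi_rampsi_split_aux[of "- 1"]
    by (simp add: dil_1[unfolded One_nat_def] flip: fps_const_neg)
qed

lemma bij_sum_even: "bij_betw (\<lambda>(v, u). (u + v, u - v)) UNIV {p :: int \<times> int. case p of (m, n) \<Rightarrow> even (m + n)}"
  by (rule bij_betw_byWitness[where f' = "\<lambda>(m, n). ((m - n) div 2, (m + n) div 2)"]) (auto; presburger)+

text \<open>Here m + n = -2u - 1 and m - n = 2v + 1, so a form in m^2 + n^2 and m + n has no mixed
  term in u and v. The signs make the linear terms come out right for both squares that
  follow.\<close>

lemma bij_sum_odd: "bij_betw (\<lambda>(v, u). (v - u, - u - v - 1)) UNIV {p :: int \<times> int. \<not> (case p of (m, n) \<Rightarrow> even (m + n))}"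
  by (rule bij_betw_byWitness[where f' = "\<lambda>(m, n). ((m - n - 1) div 2, (- m - n - 1) div 2)"]) (auto; presburger)+

text \<open>Serves to recognise the odd part of phi(-q^3) f(q, q^5). The sign (-1)^(m+n) is constant
  on each of the two parity classes.\<close>

lemma theta15_alt_square:
  "theta15_alt * theta15_alt = dil 6 ramphi * dil 2 theta15 - fps_X * (2 * dil 12 rampsi * dil 4 theta12)"
proof -
  have e: "proper (\<lambda>(m, n). 3 * (m * m) + 2 * m + (3 * (n * n) + 2 * n))"
    by (intro proper_pair proper_theta)
  have 2: "fps_X * (2 * dil 12 rampsi * dil 4 theta12) =
      expsum (\<lambda>(v, u). 1) (\<lambda>(v, u). 12 * triangular v + 4 * (u * u + triangular u) + 1)"
    unfolding two_dil_rampsi[OF zero_less_numeral] theta12_def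
    using X_dil_expsum_mult[OF proper_triangular proper_theta(4), of 12 4 1 "\<lambda>_. 1" "\<lambda>_. 1"] by simp
  have 1: "dil 6 ramphi * dil 2 theta15 =
      expsum (\<lambda>(v, u). 1) (\<lambda>(v, u). 6 * (v * v) + 2 * (3 * (u * u) + 2 * u))"
    unfolding ramphi_def theta15_def by (subst dil_expsum_mult) simp_all
  have "theta15_alt * theta15_alt = expsum (\<lambda>(m, n). alt_sign m * alt_sign n)
      (\<lambda>(m, n). 3 * (m * m) + 2 * m + (3 * (n * n) + 2 * n))"
    unfolding theta15_alt_def by (rule expsum_mult) simp_all
  also have "\<dots> = dil 6 ramphi * dil 2 theta15 + - (fps_X * (2 * dil 12 rampsi * dil 4 theta12))"
    unfolding 1 2 expsum_uminus[symmetric]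
  proof (subst expsum_split[OF e bij_sum_even bij_sum_odd], intro arg_cong2[of _ _ _ _ "(+)"] expsum_cong)
    fix p :: "int \<times> int"
    obtain v u where p: "p = (v, u)" by force
    show "((\<lambda>(m, n). 3 * (m * m) + 2 * m + (3 * (n * n) + 2 * n)) \<circ> (\<lambda>(v, u). (u + v, u - v))) p =
        (case p of (v, u) \<Rightarrow> 6 * (v * v) + 2 * (3 * (u * u) + 2 * u))"
      by (simp add: p algebra_simps)
    show "((\<lambda>(m, n). 3 * (m * m) + 2 * m + (3 * (n * n) + 2 * n)) \<circ> (\<lambda>(v, u). (v - u, - u - v - 1))) p =
        (case p of (v, u) \<Rightarrow> 12 * triangular v + 4 * (u * u + triangular u) + 1)"
      using triangular[of u] triangular[of v] by (simp add: p algebra_simps)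
  qed (auto simp: alt_sign_def)
  finally show ?thesis by simp
qed

text \<open>The companion for the even part of phi(-q^3) f(q, q^5), obtained by squaring the
  pentagonal series at q^2.\<close>

lemma euler_2_square:
  "euler 2 * euler 2 = dil 6 ramphi * dil 4 theta12 - fps_X ^ 2 * (2 * dil 12 rampsi * dil 2 theta15)"
proof -
  have e: "proper (\<lambda>(m, n). 2 * (m * m + triangular m) + 2 * (n * n + triangular n))"
    using proper_pair[OF proper_scale[OF proper_theta(4)] proper_scale[OF proper_theta(4)], of 2 2] by simp
  have 2: "fps_X ^ 2 * (2 * dil 12 rampsi * dil 2 theta15) =
      expsum (\<lambda>(v, u). 1) (\<lambda>(v, u). 12 * triangular v + 2 * (3 * (u * u) + 2 * u) + 2)"
    unfolding two_dil_rampsi[OF zero_less_numeral] theta15_def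
    using X_dil_expsum_mult[OF proper_triangular proper_theta(3), of 12 2 2 "\<lambda>_. 1" "\<lambda>_. 1"] by simp
  have 1: "dil 6 ramphi * dil 4 theta12 =
      expsum (\<lambda>(v, u). 1) (\<lambda>(v, u). 6 * (v * v) + 4 * (u * u + triangular u))"
    unfolding ramphi_def theta12_def by (subst dil_expsum_mult) simp_all
  have "euler 2 = dil 2 (euler 1)" by (subst dil_simps(11)) simp_all
  then have "euler 2 * euler 2 = dil 2 (euler 1) * dil 2 (euler 1)" by simp
  also have "\<dots> = expsum (\<lambda>(m, n). alt_sign m * alt_sign n)
      (\<lambda>(m, n). 2 * (m * m + triangular m) + 2 * (n * n + triangular n))"
    unfolding pentagonal[symmetric] by (subst dil_expsum_mult) simp_all
  also have "\<dots> = dil 6 ramphi * dil 4 theta12 + - (fps_X ^ 2 * (2 * dil 12 rampsi * dil 2 theta15))"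
    unfolding 1 2 expsum_uminus[symmetric]
  proof (subst expsum_split[OF e bij_sum_even bij_sum_odd], intro arg_cong2[of _ _ _ _ "(+)"] expsum_cong)
    fix p :: "int \<times> int"
    obtain v u where p: "p = (v, u)" by force
    show "((\<lambda>(m, n). 2 * (m * m + triangular m) + 2 * (n * n + triangular n)) \<circ> (\<lambda>(v, u). (u + v, u - v))) p =
        (case p of (v, u) \<Rightarrow> 6 * (v * v) + 4 * (u * u + triangular u))"
      using triangular[of "u + v"] triangular[of "u - v"] triangular[of u] by (simp add: p algebra_simps)
    show "((\<lambda>(m, n). 2 * (m * m + triangular m) + 2 * (n * n + triangular n)) \<circ> (\<lambda>(v, u). (v - u, - u - v - 1))) p =
        (case p of (v, u) \<Rightarrow> 12 * triangular v + 2 * (3 * (u * u) + 2 * u) + 2)"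
      using triangular[of "v - u"] triangular[of "- u - v - 1"] triangular[of v] by (simp add: p algebra_simps)
  qed (auto simp: alt_sign_def)
  finally show ?thesis by simp
qed

lemma rampsi_theta12_split:
  "rampsi * theta12 = dil 2 ramphi * dil 4 theta12 + fps_X * (2 * dil 4 rampsi * dil 2 theta15)"
proof -
  define f :: "int \<times> int \<Rightarrow> int \<times> int" where "f = (\<lambda>(u, v).
    if even (u + v) then let k = (v - u) div 2 in (2 * u + 3 * k, 2 * k)
    else let k = (u + v - 1) div 2 in (k - 2 * v, 2 * k + 1))"
  define f' :: "int \<times> int \<Rightarrow> int \<times> int" where "f' = (\<lambda>(n, m). let k = m div 2 in
    if even m then ((n - 3 * k) div 2, (n + k) div 2) else ((n + 3 * k + 2) div 2, (k - n) div 2))"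
  define g :: "int \<times> int \<Rightarrow> int \<times> int" where "g = (\<lambda>(u, v).
    if even (u + v) then let k = (- (u + v + 2)) div 2 in (k + 2 * v + 1, 2 * k + 1)
    else let k = (- (u + v + 1)) div 2 in (- 2 * v - 1 - k, 2 * k))"
  define g' :: "int \<times> int \<Rightarrow> int \<times> int" where "g' = (\<lambda>(n, m). let k = m div 2 in
    if even m then ((n - 3 * k - 1) div 2, (- 1 - n - k) div 2)
    else ((- (n + 3 * k + 2) - 1) div 2, (n - k - 1) div 2))"
  have f_eq: "f (u, u + 2 * k) = (2 * u + 3 * k, 2 * k)" "f (u, 2 * k + 1 - u) = (k - 2 * (2 * k + 1 - u), 2 * k + 1)"
    and f'_eq: "f' (n, 2 * k) = ((n - 3 * k) div 2, (n + k) div 2)"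
      "f' (n, 2 * k + 1) = ((n + 3 * k + 2) div 2, (k - n) div 2)"
    and g_eq: "g (u, - 2 * k - 2 - u) = (k + 2 * (- 2 * k - 2 - u) + 1, 2 * k + 1)"
      "g (u, - 2 * k - 1 - u) = (- 2 * (- 2 * k - 1 - u) - 1 - k, 2 * k)"
    and g'_eq: "g' (n, 2 * k) = ((n - 3 * k - 1) div 2, (- 1 - n - k) div 2)"
      "g' (n, 2 * k + 1) = ((- (n + 3 * k + 2) - 1) div 2, (n - k - 1) div 2)" for u k n
    by (simp_all add: f_def f'_def g_def g'_def)
  \<comment> \<open>\<open>n + m div 2\<close> has the parity of the exponent, so this separates
    even from odd powers. For the exponent e, 24e + 4 = 3(4n+1)^2 + (6m+1)^2, which is the norm form
    being rotated.\<close>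
  have f: "bij_betw f UNIV {p. case p of (n, m) \<Rightarrow> even (n + m div 2)}"
  proof (rule bij_betw_byWitness[where f' = f'])
    have f_cases: "\<exists>k. v = u + 2 * k \<or> v = 2 * k + 1 - u" for u v :: int
      by presburger
    show "\<forall>p\<in>UNIV. f' (f p) = p"
    proof
      fix p :: "int \<times> int"
      obtain u v where p: "p = (u, v)" by force
      obtain k where "v = u + 2 * k \<or> v = 2 * k + 1 - u" using f_cases by blast
      then show "f' (f p) = p" by (auto simp: p f_eq f'_eq)
    qed
    show "range f \<subseteq> {p. case p of (n, m) \<Rightarrow> even (n + m div 2)}"
    proof safe
      fix n m u v assume nm: "(n, m) = f (u, v)"
      obtain k where "v = u + 2 * k \<or> v = 2 * k + 1 - u" using f_cases by blast
      then show "even (n + m div 2)" using nm by (auto simp: f_eq)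
    qed
    show "\<forall>p\<in>{p. case p of (n, m) \<Rightarrow> even (n + m div 2)}. f (f' p) = p"
    proof safe
      fix n m :: int assume *: "even (n + m div 2)"
      define k l where "k = m div 2" and "l = (n + k) div 2"
      have n: "n = 2 * l - k" using * by (simp add: k_def l_def)
      have m: "m = 2 * k \<or> m = 2 * k + 1" unfolding k_def by presburger
      then show "f (f' (n, m)) = (n, m)"
      proof
        assume m: "m = 2 * k"
        have "f' (n, m) = (l - 2 * k, (l - 2 * k) + 2 * k)" by (simp add: m n f'_eq)
        then show ?thesis by (simp only: f_eq) (simp add: m n)
      next
        assume m: "m = 2 * k + 1"
        have "f' (n, m) = (l + k + 1, 2 * k + 1 - (l + k + 1))" by (simp add: m n f'_eq)
        then show ?thesis by (simp only: f_eq) (simp add: m n)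
      qed
    qed
  qed simp
  have g: "bij_betw g UNIV {p. \<not> (case p of (n, m) \<Rightarrow> even (n + m div 2))}"
  proof (rule bij_betw_byWitness[where f' = g'])
    have g_cases: "\<exists>k. v = - 2 * k - 2 - u \<or> v = - 2 * k - 1 - u" for u v :: int
      by presburger
    show "\<forall>p\<in>UNIV. g' (g p) = p"
    proof
      fix p :: "int \<times> int"
      obtain u v where p: "p = (u, v)" by force
      obtain k where "v = - 2 * k - 2 - u \<or> v = - 2 * k - 1 - u" using g_cases by blast
      then show "g' (g p) = p"
        by (elim disjE; simp only: p g_eq g'_eq) (simp_all add: algebra_simps)
    qed
    show "range g \<subseteq> {p. \<not> (case p of (n, m) \<Rightarrow> even (n + m div 2))}"
    proof safe
      fix n m u v assume nm: "(n, m) = g (u, v)" and ev: "even (n + m div 2)"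
      obtain k where "v = - 2 * k - 2 - u \<or> v = - 2 * k - 1 - u" using g_cases by blast
      then show False using nm ev by (elim disjE; simp only: g_eq) simp_all
    qed
    show "\<forall>p\<in>{p. \<not> (case p of (n, m) \<Rightarrow> even (n + m div 2))}. g (g' p) = p"
    proof safe
      fix n m :: int assume *: "odd (n + m div 2)"
      define k l where "k = m div 2" and "l = (n + k) div 2"
      have n: "n = 2 * l + 1 - k" using * unfolding k_def l_def by presburger
      have m: "m = 2 * k \<or> m = 2 * k + 1" unfolding k_def by presburger
      then show "g (g' (n, m)) = (n, m)"
      proof
        assume m: "m = 2 * k"
        have "g' (n, m) = (l - 2 * k, - 2 * k - 1 - (l - 2 * k))"
          unfolding m g'_eq by (simp add: n)
        then show ?thesis by (simp only: g_eq) (simp add: m n)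
      next
        assume m: "m = 2 * k + 1"
        have "g' (n, m) = (- l - k - 2, - 2 * k - 2 - (- l - k - 2))"
          unfolding m g'_eq by (simp add: n)
        then show ?thesis by (simp only: g_eq) (simp add: m n)
      qed
    qed
  qed simp
  have e: "proper (\<lambda>(n, m). 2 * (n * n) + n + (m * m + triangular m))"
    by (intro proper_pair proper_theta)
  have 1: "dil 2 ramphi * dil 4 theta12 =
      expsum (\<lambda>(u, v). 1) (\<lambda>(u, v). 2 * (u * u) + 4 * (v * v + triangular v))"
    unfolding ramphi_def theta12_def by (subst dil_expsum_mult) simp_all
  have 2: "fps_X * (2 * dil 4 rampsi * dil 2 theta15) =
      expsum (\<lambda>(u, v). 1) (\<lambda>(u, v). 4 * triangular u + 2 * (3 * (v * v) + 2 * v) + 1)"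
    unfolding two_dil_rampsi[OF zero_less_numeral] theta15_def
    using X_dil_expsum_mult[OF proper_triangular proper_theta(3), of 4 2 1 "\<lambda>_. 1" "\<lambda>_. 1"] by simp
  have "rampsi * theta12 = expsum (\<lambda>(n, m). 1) (\<lambda>(n, m). 2 * (n * n) + n + (m * m + triangular m))"
    unfolding rampsi_def theta12_def by (subst expsum_mult) simp_all
  also have "\<dots> = dil 2 ramphi * dil 4 theta12 + fps_X * (2 * dil 4 rampsi * dil 2 theta15)"
    unfolding 1 2
  proof (subst expsum_split[OF e f g], intro arg_cong2[of _ _ _ _ "(+)"] expsum_cong)
    fix p :: "int \<times> int"
    obtain u v where p: "p = (u, v)" by force
    show "((\<lambda>(n, m). 2 * (n * n) + n + (m * m + triangular m)) \<circ> f) p =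
        (case p of (u, v) \<Rightarrow> 2 * (u * u) + 4 * (v * v + triangular v))"
    proof (cases "even (u + v)")
      case True
      define k where "k = (v - u) div 2"
      have v: "v = u + 2 * k" using True by (simp add: k_def)
      have "f p = (2 * u + 3 * k, 2 * k)" using True by (simp add: p f_def k_def)
      then show ?thesis using triangular[of v] triangular[of "2 * k"] by (simp add: p v algebra_simps)
    next
      case False
      define k where "k = (u + v - 1) div 2"
      have v: "v = 2 * k + 1 - u" using False by (simp add: k_def)
      have "f p = (k - 2 * v, 2 * k + 1)" using False by (simp add: p f_def k_def)
      then show ?thesis using triangular[of v] triangular[of "2 * k + 1"] by (simp add: p v algebra_simps)
    qed
    show "((\<lambda>(n, m). 2 * (n * n) + n + (m * m + triangular m)) \<circ> g) p =
        (case p of (u, v) \<Rightarrow> 4 * triangular u + 2 * (3 * (v * v) + 2 * v) + 1)"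
    proof (cases "even (u + v)")
      case True
      define k where "k = (- (u + v + 2)) div 2"
      have v: "v = - 2 * k - 2 - u" using True unfolding k_def by presburger
      have "g p = (k + 2 * v + 1, 2 * k + 1)" using True by (simp add: p g_def k_def)
      then show ?thesis using triangular[of u] triangular[of "2 * k + 1"] by (simp add: p v algebra_simps)
    next
      case False
      define k where "k = (- (u + v + 1)) div 2"
      have v: "v = - 2 * k - 1 - u" using False unfolding k_def by presburger
      have "g p = (- 2 * v - 1 - k, 2 * k)" using False by (simp add: p g_def k_def)
      then show ?thesis using triangular[of u] triangular[of "2 * k"] by (simp add: p v algebra_simps)
    qed
  qed auto
  finally show ?thesis .
qed

section \<open>Reduction modulo 9\<close>

definition fps_even :: "int fps \<Rightarrow> int fps" where "fps_even F = Abs_fps (\<lambda>n. F $ (2 * n))"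
definition fps_odd :: "int fps \<Rightarrow> int fps" where "fps_odd F = Abs_fps (\<lambda>n. F $ (2 * n + 1))"

lemma fps_even_nth: "fps_even F $ n = F $ (2 * n)"
  and fps_odd_nth: "fps_odd F $ n = F $ (2 * n + 1)"
  by (simp_all add: fps_even_def fps_odd_def)

lemma fps_even_odd_simps [simp]:
  "fps_even (F + G) = fps_even F + fps_even G" "fps_odd (F + G) = fps_odd F + fps_odd G"
  "fps_even (F - G) = fps_even F - fps_even G" "fps_odd (F - G) = fps_odd F - fps_odd G"
  by (simp_all add: fps_eq_iff fps_even_nth fps_odd_nth)

lemma fps_even_dil_mult: "fps_even (dil 2 A * B) = A * fps_even B"
  and fps_odd_dil_mult: "fps_odd (dil 2 A * B) = A * fps_odd B"
  using fps_compose_X_power_mult_nth[of 2 0 A B] fps_compose_X_power_mult_nth[of 2 1 A B]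
  by (simp_all add: fps_eq_iff fps_mult_nth fps_even_nth fps_odd_nth dil_def atLeast0AtMost)

lemma fps_even_numeral_mult: "fps_even (numeral k * B) = numeral k * fps_even B"
  and fps_odd_numeral_mult: "fps_odd (numeral k * B) = numeral k * fps_odd B"
  using fps_even_dil_mult[of "numeral k" B] fps_odd_dil_mult[of "numeral k" B] by simp_all

lemma fps_odd_X_mult: "fps_odd (fps_X * dil 2 A) = A"
  and fps_even_dil: "fps_even (dil 2 A) = A"
  and fps_odd_dil: "fps_odd (dil 2 A) = 0"
  and fps_even_X_mult: "fps_even (fps_X * dil 2 A) = 0"
  by (auto simp: fps_eq_iff fps_even_nth fps_odd_nth dil_nth; presburger)+

lemma fps_even_odd_eqI:
  assumes "F = dil 2 P + fps_X * dil 2 R"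
  shows "fps_even F = P" "fps_odd F = R"
  unfolding assms by (simp_all add: fps_odd_X_mult fps_even_dil fps_odd_dil fps_even_X_mult)

lemma fps_even_odd_decomp: "F = dil 2 (fps_even F) + fps_X * dil 2 (fps_odd F)"
proof (rule fps_ext)
  fix n
  show "F $ n = (dil 2 (fps_even F) + fps_X * dil 2 (fps_odd F)) $ n"
    by (cases "even n") (auto simp: dil_nth fps_even_nth fps_odd_nth elim!: evenE oddE)
qed

lemma fps_zero_if_dil_4:
  assumes "D = fps_X * dil 4 D"
  shows "D = 0"
proof -
  have "D $ n = 0" for n
  proof (induction n rule: less_induct)
    case (less n)
    have "D $ n = (fps_X * dil 4 D) $ n" using assms by simp
    also have "\<dots> = 0"
      using less[of "(n - 1) div 4"] by (cases n) (auto simp: dil_nth)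
    finally show ?case .
  qed
  then show ?thesis by (simp add: fps_eq_iff)
qed

lemma numeral_dvd_fps_iff: "(numeral k dvd (F :: int fps)) \<longleftrightarrow> (\<forall>n. numeral k dvd F $ n)"
proof
  assume "numeral k dvd F"
  then obtain H where "F = fps_const (numeral k) * H" by (auto simp: numeral_fps_const)
  then show "\<forall>n. numeral k dvd F $ n" by simp
next
  assume *: "\<forall>n. numeral k dvd F $ n"
  have "F = numeral k * Abs_fps (\<lambda>n. F $ n div numeral k)"
    using * by (simp add: fps_eq_iff numeral_fps_const)
  then show "numeral k dvd F" by (rule dvdI)
qed

lemma dvd_fps_unit_cancel:
  fixes c :: "int fps"
  assumes "c dvd U * F" "U $ 0 = 1"
  shows "c dvd F"
proof -
  have "F = (U * fps_recip U) * F" using assms(2) by (simp add: fps_recip)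
  also have "\<dots> = fps_recip U * (U * F)" by (simp only: mult_ac)
  finally show ?thesis using assms(1) by (metis dvd_mult)
qed

lemma fps_even_dvd: "numeral k dvd F \<Longrightarrow> numeral k dvd fps_even F"
  and fps_odd_dvd: "numeral k dvd F \<Longrightarrow> numeral k dvd fps_odd F"
  by (simp_all add: numeral_dvd_fps_iff fps_even_nth fps_odd_nth)

lemma dil_dvd: "numeral k dvd F \<Longrightarrow> numeral k dvd dil m F"
  by (simp add: numeral_dvd_fps_iff dil_nth)

text \<open>Factor by factor, 1 - z^3 and (1 - z)^3 differ by 3(z - z^2). Divisibility passes to the
  limit because each coefficient is eventually constant.\<close>

lemma euler_frobenius: "3 dvd euler 3 - euler 1 ^ 3"
proof -
  have "3 dvd qpochhammer (fps_X ^ 3) (fps_X ^ 3) n - (qpochhammer fps_X fps_X n :: int fps) ^ 3" for n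
  proof (induction n)
    case (Suc n)
    define A C z where "A = qpochhammer (fps_X ^ 3) (fps_X ^ 3 :: int fps) n"
      and "C = qpochhammer fps_X (fps_X :: int fps) n" and "z = (fps_X * fps_X ^ n :: int fps)"
    have 1: "fps_X ^ 3 * (fps_X ^ 3) ^ n = z ^ 3"
      by (simp add: z_def power_mult_distrib flip: power_mult)
    have "A * (1 - z ^ 3) - (C * (1 - z)) ^ 3 = (A - C ^ 3) * (1 - z ^ 3) + 3 * (C ^ 3 * (z - z ^ 2))"
      by (simp add: power2_eq_square power3_eq_cube algebra_simps)
    moreover have "3 dvd A - C ^ 3" using Suc by (simp add: A_def C_def)
    ultimately have "3 dvd A * (1 - z ^ 3) - (C * (1 - z)) ^ 3" by simp
    then show ?case unfolding qpochhammer_Suc 1 by (simp add: A_def C_def z_def)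
  qed simp
  then have *: "3 dvd (qpochhammer (fps_X ^ 3) (fps_X ^ 3) n - (qpochhammer fps_X fps_X n :: int fps) ^ 3) $ k" for n k
    using numeral_dvd_fps_iff[of "num.Bit1 num.One"] by blast
  have "(\<lambda>n. qpochhammer (fps_X ^ 3) (fps_X ^ 3) n - (qpochhammer fps_X fps_X n :: int fps) ^ 3) \<longlonglongrightarrow>
      euler 3 - euler 1 ^ 3"
    unfolding euler_def using qpochhammer_tendsto[of "fps_X ^ 3" "fps_X ^ 3"] qpochhammer_tendsto[of fps_X fps_X]
    unfolding power3_eq_cube[of "qpochhammer _ _ _"] power3_eq_cube[of "qpoch_inf _ _"]
    by (intro tendsto_diff tendsto_mult) simp_all
  then have lim: "\<forall>\<^sub>F n in sequentially. (qpochhammer (fps_X ^ 3) (fps_X ^ 3) n - (qpochhammer fps_X fps_X n :: int fps) ^ 3) $ k =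
      (euler 3 - euler 1 ^ 3) $ k" for k
    by (simp only: tendsto_fps_iff)
  have "3 dvd (euler 3 - euler 1 ^ 3) $ k" for k
  proof -
    obtain N where "\<And>n. n \<ge> N \<Longrightarrow> (qpochhammer (fps_X ^ 3) (fps_X ^ 3) n - (qpochhammer fps_X fps_X n :: int fps) ^ 3) $ k =
        (euler 3 - euler 1 ^ 3) $ k"
      using lim[of k] unfolding eventually_sequentially by blast
    then show ?thesis using *[of N k] by simp
  qed
  then show ?thesis by (simp only: numeral_dvd_fps_iff) simp
qed

lemma theta15_odd: "fps_odd theta15 = dil 2 theta15"
proof (rule fps_even_odd_eqI)
  show "theta15 = dil 2 (dil 4 theta12) + fps_X * dil 2 (dil 2 theta15)"
    using theta15_split by simp
qed

text \<open>Trades a denominator phi(-q) for a numerator phi(q), leaving only a series in q^2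
  below.\<close>

lemma ramphi_ramphi_alt: "ramphi * ramphi_alt = dil 2 ramphi_alt ^ 2"
proof -
  have 1: "euler 2 * ramphi_alt = euler 1 ^ 2" "euler 1 ^ 2 * euler 4 ^ 2 * ramphi = euler 2 ^ 5"
    by (rule ramphi_alt_euler ramphi_euler)+
  have 2: "euler 4 * dil 2 ramphi_alt = euler 2 ^ 2"
    using arg_cong[OF ramphi_alt_euler, of "dil 2"] by simp
  have "(euler 1 ^ 2 * euler 4 ^ 2 * euler 2) * (ramphi * ramphi_alt) =
      (euler 1 ^ 2 * euler 4 ^ 2 * ramphi) * (euler 2 * ramphi_alt)" by (simp only: mult_ac)
  also have "\<dots> = euler 1 ^ 2 * euler 2 * (euler 2 ^ 2) ^ 2" unfolding 1 by (simp add: eval_nat_numeral)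
  also have "\<dots> = (euler 1 ^ 2 * euler 4 ^ 2 * euler 2) * dil 2 ramphi_alt ^ 2"
    unfolding 2[symmetric] by (simp add: power2_eq_square)
  finally show ?thesis by simp
qed

lemma ramphi_split_dil_3: "dil 3 ramphi = dil 12 ramphi + fps_X ^ 3 * (2 * dil 24 rampsi)"
  by (subst ramphi_split) simp

lemma ramphi_alt_split_dil_3: "dil 3 ramphi_alt = dil 12 ramphi - fps_X ^ 3 * (2 * dil 24 rampsi)"
  by (subst ramphi_alt_split) simp

text \<open>With phi(q) = a + b and phi(-q^3) = a' - b' the even part is aa' - bb', which is phi(q)
  phi(q^3) - 4q psi(q^2) psi(q^6) taken at q^4. By the splitting of psi(q) psi(q^3) the subtracted
  term equals 2(ab' + a'b), so that expression is (a - b)(a' - b') = phi(-q) phi(-q^3).\<close>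

lemma ramphi_ramphi_alt_3_even: "fps_even (ramphi * dil 3 ramphi_alt) = dil 2 ramphi_alt * dil 6 ramphi_alt"
proof -
  define a b a' b' where "a = dil 4 ramphi" and "b = fps_X * (2 * dil 8 rampsi)"
    and "a' = dil 12 ramphi" and "b' = fps_X ^ 3 * (2 * dil 24 rampsi)"
  have s: "ramphi = a + b" "ramphi_alt = a - b" "dil 3 ramphi = a' + b'" "dil 3 ramphi_alt = a' - b'"
    using ramphi_split ramphi_alt_split ramphi_split_dil_3 ramphi_alt_split_dil_3
    by (simp_all only: a_def b_def a'_def b'_def)
  have "4 * (fps_X * (dil 2 rampsi * dil 6 rampsi)) = 4 * (fps_X * dil 2 (rampsi * dil 3 rampsi))" by simp
  also have "\<dots> = 2 * (a * b' + a' * b)"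
    unfolding rampsi_rampsi_split by (simp add: a_def b_def a'_def b'_def algebra_simps power3_eq_cube power2_eq_square)
  finally have c: "ramphi * dil 3 ramphi - 4 * (fps_X * (dil 2 rampsi * dil 6 rampsi)) = ramphi_alt * dil 3 ramphi_alt"
    unfolding s(3,4) unfolding s(1,2) by (simp add: algebra_simps)
  have "ramphi * dil 3 ramphi_alt = (a + b) * (a' - b')" unfolding s(4) by (subst s(1)) (rule refl)
  also have "\<dots> = dil 2 (dil 2 (ramphi * dil 3 ramphi - 4 * (fps_X * (dil 2 rampsi * dil 6 rampsi)))) +
      fps_X * dil 2 (2 * (dil 4 rampsi * dil 6 ramphi - fps_X * (dil 2 ramphi * dil 12 rampsi)))"
    by (simp add: a_def b_def a'_def b'_def) algebra
  finally have "ramphi * dil 3 ramphi_alt = \<dots>" .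
  from fps_even_odd_eqI(1)[OF this] show ?thesis unfolding c by simp
qed

lemma rampsi_alt_rampsi_alt_odd: "fps_odd (rampsi_alt * dil 3 rampsi_alt) = - (dil 6 rampsi * ramphi)"
proof (rule fps_even_odd_eqI)
  show "rampsi_alt * dil 3 rampsi_alt =
      dil 2 (dil 3 ramphi * dil 2 rampsi) + fps_X * dil 2 (- (dil 6 rampsi * ramphi))"
    unfolding rampsi_alt_rampsi_alt_split by simp
qed

section \<open>The quotient P = f_3^3 / f_1, a third of Borwein's cubic theta function c(q) up to a
  power of q\<close>

context
  fixes P :: "int fps"
  assumes P: "euler 1 * P = euler 3 ^ 3"
begin

lemma cubic_dil: "euler 2 * dil 2 P = euler 6 ^ 3"
  using arg_cong[OF P, of "dil 2"] by simp

text \<open>Isolates phi(-q^3) and f(q, q^5) as the only factors besides \<open>P\<close> that are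
  not series in q^2.\<close>

lemma cubic_theta: "P * (euler 2 ^ 2 * euler 12) = euler 4 * euler 6 ^ 2 * (dil 3 ramphi_alt * theta15)"
proof -
  have 1: "euler 6 * dil 3 ramphi_alt = euler 3 ^ 2"
    using arg_cong[OF ramphi_alt_euler, of "dil 3"] by simp
  have "euler 1 * (P * (euler 2 ^ 2 * euler 12)) = euler 3 ^ 2 * (euler 2 ^ 2 * euler 3 * euler 12)"
    using P by algebra
  also have "\<dots> = euler 1 * (euler 4 * euler 6 ^ 2 * (dil 3 ramphi_alt * theta15))"
    using 1 theta15_euler by algebra
  finally show ?thesis by simp
qed

lemma cubic_even: "fps_even P = rampsi * theta12"
  and cubic_odd: "fps_odd P = dil 2 P"
proof -
  \<comment> \<open>\<open>E\<close> and \<open>R\<close> are the even and odd parts of phi(-q^3)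
    f(q, q^5). The two square identities show that they equal f_2^2 and f(-q, -q^5)^2, which turns
    both parts of \<open>P\<close> into products.\<close>
  define E where "E = dil 6 ramphi * dil 4 theta12 - fps_X ^ 2 * (2 * dil 12 rampsi * dil 2 theta15)"
  define R where "R = dil 6 ramphi * dil 2 theta15 - fps_X * (2 * dil 12 rampsi * dil 4 theta12)"
  have d: "dil 3 ramphi_alt * theta15 = dil 2 E + fps_X * dil 2 R"
  proof -
    note 1 = ramphi_alt_split_dil_3
    have 2: "theta15 = dil 8 theta12 + fps_X * dil 4 theta15" by (rule theta15_split)
    show ?thesis unfolding 1 by (subst 2) (simp add: E_def R_def, algebra)
  qed
  have "P * (euler 2 ^ 2 * euler 12) = dil 2 (euler 1 ^ 2 * euler 6) * P" by simp
  with cubic_theta have *: "dil 2 (euler 1 ^ 2 * euler 6) * P =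
      dil 2 (euler 2 * euler 3 ^ 2) * (dil 3 ramphi_alt * theta15)" by simp
  have even: "euler 1 ^ 2 * euler 6 * fps_even P = euler 2 * euler 3 ^ 2 * E"
    using arg_cong[OF *, of fps_even] fps_even_odd_eqI(1)[OF d] by (simp only: fps_even_dil_mult)
  have odd: "euler 1 ^ 2 * euler 6 * fps_odd P = euler 2 * euler 3 ^ 2 * R"
    using arg_cong[OF *, of fps_odd] fps_even_odd_eqI(2)[OF d] by (simp only: fps_odd_dil_mult)
  have "euler 1 ^ 2 * euler 6 * fps_even P = euler 1 ^ 2 * euler 6 * (rampsi * theta12)"
    using even euler_2_square rampsi_euler theta12_euler unfolding E_def[symmetric] by algebra
  then show "fps_even P = rampsi * theta12" by simp
  have "euler 2 * (euler 1 ^ 2 * euler 6 * fps_odd P) = euler 2 * (euler 1 ^ 2 * euler 6 * dil 2 P)"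
    using odd theta15_alt_square theta15_alt_euler cubic_dil unfolding R_def[symmetric] by algebra
  then show "fps_odd P = dil 2 P" by simp
qed

text \<open>Both sides have the even part \<open>3 \<psi> f(q, q\<^sup>2)\<close>, and the odd part of either side is that side at \<open>q\<^sup>2\<close>.
  Hence the difference \<open>D\<close> satisfies \<open>D(q) = q D(q\<^sup>4)\<close>, which forces \<open>D = 0\<close>.\<close>
lemma cubic_sum: "ramphi * theta15 + 2 * (dil 2 rampsi * dil 2 theta12) = 3 * P"
proof -
  define L where "L = ramphi * theta15 + 2 * (dil 2 rampsi * dil 2 theta12)"
  have d: "ramphi * theta15 = dil 2 (rampsi * theta12) +
      fps_X * dil 2 (dil 2 ramphi * dil 2 theta15 + 2 * (dil 4 rampsi * dil 4 theta12))"
    unfolding rampsi_theta12_split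
    by (subst ramphi_split, subst theta15_split) (simp, algebra)
  have L: "fps_even L = 3 * (rampsi * theta12)" "fps_odd L = dil 2 L"
  proof -
    have "L = dil 2 (3 * (rampsi * theta12)) + fps_X * dil 2 (dil 2 L)"
      unfolding L_def by (subst d) (simp add: algebra_simps)
    from fps_even_odd_eqI[OF this] show "fps_even L = 3 * (rampsi * theta12)" "fps_odd L = dil 2 L"
      by simp_all
  qed
  define D where "D = L - 3 * P"
  have "fps_even D = 0" "fps_odd D = dil 2 D"
    by (simp_all add: D_def L fps_even_numeral_mult fps_odd_numeral_mult cubic_even cubic_odd)
  then have "D = fps_X * dil 4 D" using fps_even_odd_decomp[of D] by simp
  then have "D = 0" by (rule fps_zero_if_dil_4)
  then show ?thesis by (simp add: D_def L_def)
qed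

text \<open>Up to factors in q^2 the left side is b = f_1^3 / f_3. The odd part is minus that sum of
  theta products which \<open>cubic_sum\<close> evaluates; this is where the factor 3 in the
  splitting of b arises.\<close>

lemma ramphi_alt_theta15_alt:
  "ramphi_alt * theta15_alt = dil 2 (rampsi * theta12) + fps_X * dil 2 (- 3 * dil 2 P)"
proof -
  have 1: "- 3 * dil 2 P = - dil 2 (ramphi * theta15 + 2 * (dil 2 rampsi * dil 2 theta12))"
    unfolding cubic_sum by simp
  show ?thesis unfolding 1 rampsi_theta12_split
    by (subst ramphi_alt_split, subst theta15_alt_split) (simp, algebra)
qed

end

lemma cubic_quotient_dvd_9:
  assumes a: "euler 1 * a = euler 3 * euler 6"
  shows "9 dvd a $ (32 * n + 25)"
proof -
  define P where "P = fps_recip (euler 1) * euler 3 ^ 3"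
  have recip: "euler 1 * fps_recip (euler 1) = 1" "euler 3 * fps_recip (euler 3) = 1"
    by (simp_all add: fps_recip euler_nth_0)
  have P: "euler 1 * P = euler 3 ^ 3"
    using recip(1) unfolding P_def by algebra
  define b where "b = fps_recip (euler 3) * euler 1 ^ 3"
  have b: "euler 3 * b = euler 1 ^ 3"
    using recip(2) unfolding b_def by algebra
  define \<beta> where "\<beta> = fps_recip (euler 3) ^ 2 * (euler 1 ^ 2 * dil 2 P)"
  have \<beta>: "euler 3 ^ 2 * \<beta> = euler 1 ^ 2 * dil 2 P"
    using recip(2) unfolding \<beta>_def by algebra
  \<comment> \<open>Prepared so that \<open>dil 2 K\<close> is the product
    \<open>h * ramphi * b\<close> met below.\<close>
  define K where "K = fps_recip (euler 3) * (euler 1 * ramphi_alt ^ 4 * dil 3 rampsi)"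
  have K: "euler 3 * K = euler 1 * ramphi_alt ^ 4 * dil 3 rampsi"
    using recip(2) unfolding K_def by algebra
  have ramphi_alt_2: "euler 4 * dil 2 ramphi_alt = euler 2 ^ 2"
    using arg_cong[OF ramphi_alt_euler, of "dil 2"] by simp
  have ramphi_alt_3: "euler 6 * dil 3 ramphi_alt = euler 3 ^ 2"
    using arg_cong[OF ramphi_alt_euler, of "dil 3"] by simp
  have ramphi_alt_6: "euler 12 * dil 6 ramphi_alt = euler 6 ^ 2"
    using arg_cong[OF ramphi_alt_euler, of "dil 6"] by simp
  have rampsi_3: "euler 3 * dil 3 rampsi = euler 6 ^ 2"
    using arg_cong[OF rampsi_euler, of "dil 3"] by simp
  have rampsi_alt_3: "euler 6 * dil 3 rampsi_alt = euler 3 * euler 12"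
    using arg_cong[OF rampsi_alt_euler, of "dil 3"] by simp
  have theta15_2: "euler 2 * euler 8 * euler 12 * dil 2 theta15 = euler 4 ^ 2 * euler 6 * euler 24"
    using arg_cong[OF theta15_euler, of "dil 2"] by simp
  have b_even: "fps_even b = dil 2 b" and b_odd: "fps_odd b = - 3 * \<beta>"
  proof -
    have "euler 3 * (b * euler 6 ^ 2) = euler 3 * (euler 2 ^ 2 * (ramphi_alt * theta15_alt))"
      using b ramphi_alt_euler theta15_alt_euler by algebra
    then have *: "dil 2 (euler 3 ^ 2) * b = dil 2 (euler 1 ^ 2) * (ramphi_alt * theta15_alt)"
      by (simp add: mult.commute)
    have e: "euler 3 ^ 2 * fps_even b = euler 1 ^ 2 * (rampsi * theta12)"
      using arg_cong[OF *, of fps_even] fps_even_odd_eqI(1)[OF ramphi_alt_theta15_alt[OF P]]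
      by (simp only: fps_even_dil_mult)
    have o: "euler 3 ^ 2 * fps_odd b = euler 1 ^ 2 * (- 3 * dil 2 P)"
      using arg_cong[OF *, of fps_odd] fps_even_odd_eqI(2)[OF ramphi_alt_theta15_alt[OF P]]
      by (simp only: fps_odd_dil_mult)
    have "euler 6 * dil 2 b = euler 2 ^ 3" using arg_cong[OF b, of "dil 2"] by simp
    then have "euler 3 ^ 2 * euler 6 * fps_even b = euler 3 ^ 2 * euler 6 * dil 2 b"
      using e rampsi_euler theta12_euler by algebra
    then show "fps_even b = dil 2 b" by simp
    have "euler 3 ^ 2 * fps_odd b = euler 3 ^ 2 * (- 3 * \<beta>)" using o \<beta> by algebra
    then show "fps_odd b = - 3 * \<beta>" by (subst (asm) mult_left_cancel) simp_all
  qed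
  have b_split: "b = dil 4 b - fps_X * (3 * dil 2 \<beta>)"
    using fps_even_odd_decomp[of b] by (simp add: b_even b_odd)
  have frob: "3 dvd euler 3 - euler 1 ^ 3" by (rule euler_frobenius)
  have frob_2: "3 dvd euler 6 - euler 2 ^ 3" using dil_dvd[OF frob, of 2] by simp
  have "euler 3 * (b - 1) = - (euler 3 - euler 1 ^ 3)" using b by (simp add: algebra_simps)
  then have "3 dvd euler 3 * (b - 1)" using frob by (simp only: dvd_minus_iff)
  then have "3 dvd b - 1" by (rule dvd_fps_unit_cancel) (simp add: euler_nth_0)
  then obtain c where c: "b - 1 = 3 * c" by (rule dvdE)
  have b_c: "b = 1 + 3 * c" using c by (simp add: algebra_simps)
  define a1 where "a1 = fps_odd a"
  define a2 where "a2 = fps_even a1"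
  define a3 where "a3 = fps_even a2"
  define a4 where "a4 = fps_odd a3"
  define a5 where "a5 = fps_odd a4"
  have "a5 $ n = a $ (32 * n + 25)"
    unfolding a1_def a2_def a3_def a4_def a5_def fps_even_nth fps_odd_nth
    by (rule arg_cong[where f = "fps_nth a"]) simp
  \<comment> \<open>Exhibits \<open>a\<close> as a quotient of series in q^2 times f(q, q^5), whose
    odd part is itself at q^2.\<close>
  have "euler 1 * (a * (euler 2 ^ 2 * euler 12)) = euler 1 * (euler 4 * euler 6 ^ 2 * theta15)"
    using a theta15_euler by algebra
  then have "dil 2 (euler 1 ^ 2 * euler 6) * a = dil 2 (euler 2 * euler 3 ^ 2) * theta15"
    by (simp add: mult.commute)
  from arg_cong[OF this, of fps_odd] have a1: "euler 1 ^ 2 * euler 6 * a1 = euler 2 * euler 3 ^ 2 * dil 2 theta15"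
    by (simp only: a1_def fps_odd_dil_mult theta15_odd)
  \<comment> \<open>Here 1/f_1^2 is 1/(f_2 phi(-q)), and 1/phi(-q) = phi(q)/phi(-q^2)^2; together
    with f_3^2 = f_6 phi(-q^3) only phi(q) phi(-q^3) is left outside the series in q^2.\<close>
  have "(euler 1 ^ 2 * euler 6) * (a1 * (euler 8 * euler 12 * euler 2 * dil 2 ramphi_alt ^ 2)) =
      (euler 1 ^ 2 * euler 6) * (euler 4 ^ 2 * euler 24 * euler 6 * (ramphi * dil 3 ramphi_alt))"
  proof -
    have "(euler 1 ^ 2 * euler 6) * (a1 * (euler 8 * euler 12 * euler 2 * dil 2 ramphi_alt ^ 2)) =
        (euler 1 ^ 2 * euler 6 * a1) * (euler 8 * euler 12 * euler 2) * dil 2 ramphi_alt ^ 2"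
      by (simp only: mult_ac)
    also have "\<dots> = euler 3 ^ 2 * (euler 2 * euler 8 * euler 12 * dil 2 theta15) * (euler 2 * (ramphi * ramphi_alt))"
      unfolding a1 ramphi_ramphi_alt by (simp only: mult_ac)
    also have "\<dots> = (euler 6 * dil 3 ramphi_alt) * (euler 4 ^ 2 * euler 6 * euler 24) * (ramphi * (euler 2 * ramphi_alt))"
      unfolding theta15_2 ramphi_alt_3 by (simp only: mult_ac)
    also have "\<dots> = (euler 1 ^ 2 * euler 6) * (euler 4 ^ 2 * euler 24 * euler 6 * (ramphi * dil 3 ramphi_alt))"
      unfolding ramphi_alt_euler by (simp only: mult_ac)
    finally show ?thesis .
  qed
  then have "dil 2 (euler 4 * euler 6 * euler 1 * ramphi_alt ^ 2) * a1 =
      dil 2 (euler 2 ^ 2 * euler 12 * euler 3) * (ramphi * dil 3 ramphi_alt)"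
    by (simp add: mult_ac)
  from arg_cong[OF this, of fps_even] have a2: "euler 4 * euler 6 * euler 1 * ramphi_alt ^ 2 * a2 =
      euler 2 ^ 2 * euler 12 * euler 3 * (dil 2 ramphi_alt * dil 6 ramphi_alt)"
    by (simp only: a2_def fps_even_dil_mult ramphi_ramphi_alt_3_even)
  define \<Phi> where "\<Phi> = dil 2 (euler 1 * euler 3) * ramphi"
  have \<Phi>_eq: "\<Phi> = euler 2 * euler 6 * ramphi" by (simp add: \<Phi>_def)
  have \<Phi>: "a2 * b = \<Phi>"
  proof -
    have "euler 6 * (euler 4 ^ 2 * (euler 1 * ramphi_alt ^ 2 * a2)) = euler 6 * (euler 2 ^ 4 * euler 3 * euler 6)"
      using a2 ramphi_alt_2 ramphi_alt_6 by algebra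
    then have a2': "euler 4 ^ 2 * (euler 1 * ramphi_alt ^ 2 * a2) = euler 2 ^ 4 * euler 3 * euler 6"
      by simp
    have "euler 1 ^ 5 * euler 4 ^ 2 * a2 = euler 2 ^ 6 * euler 3 * euler 6"
      using a2' ramphi_alt_euler by algebra
    then have "euler 3 * euler 1 ^ 2 * euler 4 ^ 2 * (a2 * b) = euler 3 * euler 1 ^ 2 * euler 4 ^ 2 * \<Phi>"
      unfolding \<Phi>_eq using b ramphi_euler by algebra
    then show ?thesis by simp
  qed
  \<comment> \<open>1 - b(2 - b) = (b - 1)^2 = 9c^2, so 2 - b replaces 1/b.\<close>
  have "a2 - \<Phi> * (2 - b) = 9 * (a2 * c ^ 2)"
    unfolding \<Phi>[symmetric] b_c by (simp add: algebra_simps power2_eq_square)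
  then have "9 dvd a2 - \<Phi> * (2 - b)" by simp
  then have 3: "9 dvd a3 - fps_even (\<Phi> * (2 - b))"
    using fps_even_dvd unfolding a3_def fps_even_odd_simps[symmetric] by blast
  have "ramphi * (2 - b) =
      dil 2 (dil 2 ramphi * (2 - dil 2 b) + 6 * (fps_X * (dil 4 rampsi * \<beta>))) +
      fps_X * dil 2 (2 * (dil 4 rampsi * (2 - dil 2 b)) + 3 * (dil 2 ramphi * \<beta>))"
    by (subst ramphi_split, subst b_split) (simp, algebra)
  from fps_even_odd_eqI(1)[OF this] have "fps_even (\<Phi> * (2 - b)) =
      euler 1 * euler 3 * (dil 2 ramphi * (2 - dil 2 b) + 6 * (fps_X * (dil 4 rampsi * \<beta>)))"
    unfolding \<Phi>_def mult.assoc[of _ ramphi] fps_even_dil_mult by simp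
  moreover have "euler 1 * euler 3 * \<beta> = b * dil 2 P"
  proof -
    have "euler 3 * (euler 1 * euler 3 * \<beta>) = euler 3 * (b * dil 2 P)" using \<beta> b by algebra
    then show ?thesis by simp
  qed
  ultimately have even_\<Phi>: "fps_even (\<Phi> * (2 - b)) =
      euler 1 * euler 3 * (dil 2 ramphi * (2 - dil 2 b)) + 6 * (fps_X * (dil 4 rampsi * (b * dil 2 P)))"
    by algebra
  \<comment> \<open>In the term with coefficient 6 the factor b is replaced by 1, which costs a
    multiple of 18. Both summands are then ready for an odd part.\<close>
  define T where "T = dil 2 (ramphi * (2 - b)) * (euler 1 * euler 3) + 6 * (fps_X * dil 2 (dil 2 rampsi * P))"
  have "a3 - T = (a3 - fps_even (\<Phi> * (2 - b))) + 6 * (fps_X * (dil 4 rampsi * ((b - 1) * dil 2 P)))"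
    unfolding even_\<Phi> T_def by (simp add: algebra_simps)
  also have "\<dots> = (a3 - fps_even (\<Phi> * (2 - b))) + 9 * (2 * (fps_X * (dil 4 rampsi * (c * dil 2 P))))"
    unfolding c by simp
  finally have *: "a3 - T = \<dots>" .
  have "9 dvd a3 - T" unfolding * by (intro dvd_add 3 dvd_triv_left)
  then have 4: "9 dvd a4 - fps_odd T"
    using fps_odd_dvd unfolding a4_def fps_even_odd_simps[symmetric] by blast
  define h where "h = - fps_odd (euler 1 * euler 3)"
  have h: "euler 2 * euler 6 * h = euler 1 * euler 3 * (dil 6 rampsi * ramphi)"
  proof -
    have "euler 4 * euler 12 * (euler 1 * euler 3) = euler 2 * euler 6 * (rampsi_alt * dil 3 rampsi_alt)"
      using rampsi_alt_euler rampsi_alt_3 by algebra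
    then have "dil 2 (euler 2 * euler 6) * (euler 1 * euler 3) = dil 2 (euler 1 * euler 3) * (rampsi_alt * dil 3 rampsi_alt)"
      by simp
    from arg_cong[OF this, of fps_odd] show ?thesis
      by (simp only: fps_odd_dil_mult rampsi_alt_rampsi_alt_odd h_def) (simp add: algebra_simps minus_equation_iff)
  qed
  have T_odd: "fps_odd T = 6 * (dil 2 rampsi * P) - h * ramphi * (2 - b)"
    by (simp only: T_def fps_even_odd_simps fps_odd_dil_mult fps_odd_numeral_mult fps_odd_X_mult h_def)
      (simp add: algebra_simps)
  \<comment> \<open>Although \<open>h * ramphi\<close> is not a series in q^2, its product with b
    is. This is the reason for passing from 2 - b to b^2: in the next odd part only the second copy
    of b has to be split.\<close>
  have hb: "h * ramphi * b = dil 2 K"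
  proof -
    have K2: "euler 6 * dil 2 K = euler 2 * dil 2 ramphi_alt ^ 4 * dil 6 rampsi"
      using arg_cong[OF K, of "dil 2"] by simp
    have "euler 2 * euler 6 * (h * ramphi * b) = (euler 1 * (euler 3 * b)) * ramphi ^ 2 * dil 6 rampsi"
      using h by algebra
    also have "\<dots> = (euler 1 ^ 2) ^ 2 * ramphi ^ 2 * dil 6 rampsi"
      unfolding b by (simp add: eval_nat_numeral)
    also have "\<dots> = euler 2 ^ 2 * (ramphi * ramphi_alt) ^ 2 * dil 6 rampsi"
      unfolding ramphi_alt_euler[symmetric] by (simp only: power_mult_distrib mult_ac)
    also have "\<dots> = euler 2 * (euler 2 * dil 2 ramphi_alt ^ 4 * dil 6 rampsi)"
      unfolding ramphi_ramphi_alt by (simp add: eval_nat_numeral mult_ac)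
    also have "\<dots> = euler 2 * euler 6 * dil 2 K"
      unfolding K2[symmetric] by (simp only: mult_ac)
    finally show ?thesis by simp
  qed
  \<comment> \<open>Uses b^2 - (2 - b) = 9c(c + 1).\<close>
  have *: "a4 - (6 * (dil 2 rampsi * P) - dil 2 K * b) =
      (a4 - fps_odd T) + 9 * (h * ramphi * (c * (c + 1)))"
    unfolding T_odd hb[symmetric] b_c by (simp add: algebra_simps)
  have "9 dvd a4 - (6 * (dil 2 rampsi * P) - dil 2 K * b)"
    unfolding * by (intro dvd_add 4 dvd_triv_left)
  then have "9 dvd fps_odd (a4 - (6 * (dil 2 rampsi * P) - dil 2 K * b))" by (rule fps_odd_dvd)
  also have "fps_odd (a4 - (6 * (dil 2 rampsi * P) - dil 2 K * b)) = a5 - 3 * (K * \<beta> + 2 * (rampsi * dil 2 P))"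
    by (simp only: fps_even_odd_simps fps_odd_numeral_mult fps_odd_dil_mult a5_def b_odd cubic_odd[OF P])
      (simp add: algebra_simps)
  finally have 5: "9 dvd a5 - 3 * (K * \<beta> + 2 * (rampsi * dil 2 P))" .
  \<comment> \<open>Modulo 3 this makes \<open>K * \<beta> + 2 * (rampsi * dil 2 P)\<close> three
    times one series, hence zero.\<close>
  have "3 dvd K * \<beta> - rampsi * dil 2 P"
  proof -
    have K\<beta>: "euler 2 ^ 4 * euler 3 ^ 4 * (K * \<beta>) = euler 1 ^ 11 * euler 6 ^ 2 * dil 2 P"
    proof -
      have "euler 2 ^ 4 * euler 3 ^ 4 * (K * \<beta>) = euler 2 ^ 4 * euler 3 * (euler 3 * K) * (euler 3 ^ 2 * \<beta>)"
        by (simp add: eval_nat_numeral mult_ac)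
      also have "\<dots> = (euler 2 * ramphi_alt) ^ 4 * (euler 3 * dil 3 rampsi) * euler 1 ^ 3 * dil 2 P"
        unfolding K \<beta> by (simp add: eval_nat_numeral mult_ac)
      also have "\<dots> = euler 1 ^ 11 * euler 6 ^ 2 * dil 2 P"
        unfolding ramphi_alt_euler rampsi_3 by (simp add: eval_nat_numeral mult_ac)
      finally show ?thesis .
    qed
    have "euler 1 * euler 2 ^ 4 * euler 3 ^ 4 * (K * \<beta> - rampsi * dil 2 P) =
        (euler 1 ^ 12 * euler 6 ^ 2 - euler 2 ^ 6 * euler 3 ^ 4) * dil 2 P"
      using K\<beta> rampsi_euler by algebra
    \<comment> \<open>Both products are congruent to f_1^12 f_2^6 modulo 3.\<close>
    moreover have "3 dvd euler 1 ^ 12 * euler 6 ^ 2 - euler 2 ^ 6 * euler 3 ^ 4"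
    proof -
      have "3 dvd euler 6 ^ 2 - (euler 2 ^ 3) ^ 2" "3 dvd euler 3 ^ 4 - (euler 1 ^ 3) ^ 4"
        unfolding power_diff_sumr2 using frob frob_2 by (intro dvd_mult2; simp)+
      moreover have "euler 1 ^ 12 * euler 6 ^ 2 - euler 2 ^ 6 * euler 3 ^ 4 =
          euler 1 ^ 12 * (euler 6 ^ 2 - (euler 2 ^ 3) ^ 2) - euler 2 ^ 6 * (euler 3 ^ 4 - (euler 1 ^ 3) ^ 4)"
        by (simp add: algebra_simps flip: power_mult)
      ultimately show ?thesis by (metis dvd_diff dvd_mult)
    qed
    ultimately have "3 dvd euler 1 * euler 2 ^ 4 * euler 3 ^ 4 * (K * \<beta> - rampsi * dil 2 P)" by simp
    then show ?thesis by (rule dvd_fps_unit_cancel) (simp add: euler_nth_0 fps_nth_power_0)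
  qed
  then obtain d where "K * \<beta> - rampsi * dil 2 P = 3 * d" by (rule dvdE)
  then have "3 * (K * \<beta> + 2 * (rampsi * dil 2 P)) = 9 * (d + rampsi * dil 2 P)" by algebra
  then have "9 dvd a5" using 5 by (metis dvd_diff_left_iff dvd_triv_left)
  then have "9 dvd a5 $ n" by (simp only: numeral_dvd_fps_iff)
  then show ?thesis using \<open>a5 $ n = a $ (32 * n + 25)\<close> by simp
qed

theorem theorem5p5:
  fixes n :: nat
  shows "[p_xi (96 * n + 76) = 0] (mod 9)"
proof -
  obtain a where a: "euler 1 * a = euler 3 * euler 6" "\<And>n. p_xi (3 * n + 1) = 2 * a $ n"
    using p_xi_3n_plus_1 by blast
  have "p_xi (96 * n + 76) = 2 * a $ (32 * n + 25)"
    using a(2)[of "32 * n + 25"] by (simp add: algebra_simps)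
  then show ?thesis
    using cubic_quotient_dvd_9[OF a(1), of n] by (simp add: cong_0_iff)
qed

end
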